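(* Let $K$ be a field of prime characteristic $p$ with $[K:K^p]<\infty$, and let $S$ denote the ring $K[x_1,\dots,x_n]$ or the ring $K[\![x_1,\dots,x_n]\!]$. Let $I$ be a monomial ideal in $S$ generated by monomials $f_1,\dots,f_t$. If $R=S/I$, then $R$ has finite F-representation type (FFRT) over $R$.
   Context: A monomial is an element $x_1^{r_1}\cdots x_n^{r_n}$ with nonnegative integers $r_i$. For a ring $A$ of characteristic $p$, an $A$-module $M$ and a positive integer $e$, $F_*^e(M)$ is the $A$-module equal to $M$ as an abelian group (the element corresponding to $m$ is written $F_*^e(m)$) with $aF_*^e(m)=F_*^e(a^{p^e}m)$. A Noetherian ring $A$ of prime characteristic $p$ has finite F-representation type (FFRT) if there are finitely generated $A$-modules $M_1,\dots,M_s$ such that for every positive integer $e$ there are nonnegative integers $t_{(e,1)},\dots,t_{(e,s)}$ with $F_*^e(A)\cong\bigoplus_{j=1}^s M_j^{\oplus t_{(e,j)}}$ as $A$-modules. *)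

theory Defs
  imports
    "HOL-Algebra.Algebra"
    "HOL-Computational_Algebra.Primes"
    "Jordan_Normal_Form.Missing_VectorSpace"
begin

section \<open>Polynomials and formal power series in finitely many variables\<close>

text \<open>
  An exponent vector \<open>(a\<^sub>1, \<dots>, a\<^sub>n)\<close> is a function supported in \<open>{..<n}\<close>. A power series is the
  function that sends an exponent vector to its coefficient (extensional, that is, \<open>undefined\<close>
  elsewhere); a polynomial is a power series with finitely many nonzero coefficients.
\<close>

definition exponents :: "nat \<Rightarrow> (nat \<Rightarrow> nat) set" where
  "exponents n = {a. \<forall>i\<ge>n. a i = 0}"

definition monomial :: "('a, 'b) ring_scheme \<Rightarrow> nat \<Rightarrow> (nat \<Rightarrow> nat) \<Rightarrow> ((nat \<Rightarrow> nat) \<Rightarrow> 'a)" where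
  "monomial K n r = (\<lambda>a\<in>exponents n. if a = r then \<one>\<^bsub>K\<^esub> else \<zero>\<^bsub>K\<^esub>)"

definition monomials :: "('a, 'b) ring_scheme \<Rightarrow> nat \<Rightarrow> ((nat \<Rightarrow> nat) \<Rightarrow> 'a) set" where
  "monomials K n = monomial K n ` exponents n"

definition mpowser_ring :: "('a, 'b) ring_scheme \<Rightarrow> nat \<Rightarrow> ((nat \<Rightarrow> nat) \<Rightarrow> 'a) ring" where
  "mpowser_ring K n =
    \<lparr>carrier = exponents n \<rightarrow>\<^sub>E carrier K,
     monoid.mult = (\<lambda>f g. \<lambda>c\<in>exponents n. \<Oplus>\<^bsub>K\<^esub>a\<in>{a. a \<le> c}. f a \<otimes>\<^bsub>K\<^esub> g (\<lambda>i. c i - a i)),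
     one = monomial K n (\<lambda>_. 0),
     ring.zero = (\<lambda>a\<in>exponents n. \<zero>\<^bsub>K\<^esub>),
     add = (\<lambda>f g. \<lambda>a\<in>exponents n. f a \<oplus>\<^bsub>K\<^esub> g a)\<rparr>"

definition mpoly_ring :: "('a, 'b) ring_scheme \<Rightarrow> nat \<Rightarrow> ((nat \<Rightarrow> nat) \<Rightarrow> 'a) ring" where
  "mpoly_ring K n = (mpowser_ring K n)
    \<lparr>carrier := {f \<in> exponents n \<rightarrow>\<^sub>E carrier K. finite {a \<in> exponents n. f a \<noteq> \<zero>\<^bsub>K\<^esub>}}\<rparr>"


section \<open>Modules\<close>

text \<open>
  The fields \<open>mult\<close> and \<open>one\<close>, which the record type of modules inherits from rings, play no role
  in the theory of modules. The Frobenius push-forward keeps the underlying abelian group, so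
  \<open>F\<^sup>e\<^sub>*(m)\<close> is represented by \<open>m\<close> itself.
\<close>

definition finitely_generated_module ::
    "('a, 'b) ring_scheme \<Rightarrow> ('a, 'm, 'c) module_scheme \<Rightarrow> bool" where
  "finitely_generated_module A M \<longleftrightarrow>
    module A M \<and> (\<exists>G. G \<subseteq> carrier M \<and> finite G \<and> module.span A M G = carrier M)"

definition module_isomorphic ::
    "('a, 'b) ring_scheme \<Rightarrow> ('a, 'm, 'c) module_scheme \<Rightarrow> ('a, 'n, 'd) module_scheme \<Rightarrow> bool" where
  "module_isomorphic A M N \<longleftrightarrow> (\<exists>h \<in> module_hom A M N. bij_betw h (carrier M) (carrier N))"

definition regular_module :: "('a, 'b) ring_scheme \<Rightarrow> ('a, 'a) module" where
  "regular_module A =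
    \<lparr>carrier = carrier A, monoid.mult = monoid.mult A, one = one A,
     ring.zero = ring.zero A, add = add A, smult = monoid.mult A\<rparr>"

definition frobenius_pushforward ::
    "nat \<Rightarrow> nat \<Rightarrow> ('a, 'b) ring_scheme \<Rightarrow> ('a, 'm, 'c) module_scheme \<Rightarrow> ('a, 'm, 'c) module_scheme" where
  "frobenius_pushforward p e A M = M\<lparr>smult := (\<lambda>a m. (a [^]\<^bsub>A\<^esub> (p ^ e)) \<odot>\<^bsub>M\<^esub> m)\<rparr>"

text \<open>Used only for finite \<open>J\<close>, where the direct sum is the full product.\<close>

definition direct_sum_module :: "'i set \<Rightarrow> ('i \<Rightarrow> ('a, 'm, 'c) module_scheme) \<Rightarrow> ('a, 'i \<Rightarrow> 'm) module" where
  "direct_sum_module J M =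
    \<lparr>carrier = (\<Pi>\<^sub>E j\<in>J. carrier (M j)),
     monoid.mult = (\<lambda>x y. \<lambda>j\<in>J. x j \<otimes>\<^bsub>M j\<^esub> y j),
     one = (\<lambda>j\<in>J. \<one>\<^bsub>M j\<^esub>),
     ring.zero = (\<lambda>j\<in>J. \<zero>\<^bsub>M j\<^esub>),
     add = (\<lambda>x y. \<lambda>j\<in>J. x j \<oplus>\<^bsub>M j\<^esub> y j),
     smult = (\<lambda>a x. \<lambda>j\<in>J. a \<odot>\<^bsub>M j\<^esub> x j)\<rparr>"


section \<open>Finite F-representation type\<close>

text \<open>The order of \<open>1\<close> in the additive group; \<^const>\<open>group.ord\<close> is \<open>0\<close> for infinite order.\<close>

definition ring_char :: "('a, 'b) ring_scheme \<Rightarrow> nat" where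
  "ring_char A = group.ord (add_monoid A) \<one>\<^bsub>A\<^esub>"

text \<open>
  A nonzero ring has prime characteristic \<open>p\<close> iff \<open>p \<cdot> 1 = 0\<close>. The definition asks for the latter, so
  that it also covers the zero ring, which is \<open>S/I\<close> when one of the generators of \<open>I\<close> is the
  monomial \<open>1\<close>.

  A quantifier over modules needs a fixed type of module elements. A module generated by
  \<open>x\<^sub>0, \<dots>, x\<^bsub>k-1\<^esub>\<close> is isomorphic to a quotient of \<open>A\<^sup>k\<close>, whose elements are sets of functions
  \<open>nat \<Rightarrow> 'a\<close>, so that the type \<open>(nat \<Rightarrow> 'a) set\<close> contains a copy of every finitely generated
  module over a ring with elements in \<open>'a\<close>; see \<open>finitely_generated_module_copy\<close> below.

  The direct sum of \<open>t j\<close> copies of \<open>M j\<close> for \<open>j < s\<close> is indexed by the pairs \<open>(j, k)\<close> with \<open>k < t j\<close>.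
\<close>

definition FFRT :: "nat \<Rightarrow> ('a, 'b) ring_scheme \<Rightarrow> bool" where
  "FFRT p A \<longleftrightarrow>
    cring A \<and> noetherian_ring A \<and> Factorial_Ring.prime p \<and> [p] \<cdot>\<^bsub>A\<^esub> \<one>\<^bsub>A\<^esub> = \<zero>\<^bsub>A\<^esub> \<and>
    (\<exists>(s :: nat) (M :: nat \<Rightarrow> ('a, (nat \<Rightarrow> 'a) set) module).
      (\<forall>j<s. finitely_generated_module A (M j)) \<and>
      (\<forall>e>0. \<exists>t :: nat \<Rightarrow> nat.
        module_isomorphic A (frobenius_pushforward p e A (regular_module A))
          (direct_sum_module (SIGMA j:{..<s}. {..<t j}) (\<lambda>(j, k). M j))))"

lemma finitely_generated_module_copy:
  fixes A :: "('a, 'b) ring_scheme" and M :: "('a, 'm, 'c) module_scheme"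
  assumes "finitely_generated_module A M"
  shows "\<exists>N :: ('a, (nat \<Rightarrow> 'a) set) module.
    finitely_generated_module A N \<and> module_isomorphic A M N"
proof -
  interpret M: module A M
    using assms by (simp add: finitely_generated_module_def)
  obtain G where G: "G \<subseteq> carrier M" "finite G" "M.span G = carrier M"
    using assms by (auto simp: finitely_generated_module_def)
  obtain y :: "'m \<Rightarrow> nat" where y: "inj_on y G"
    using finite_imp_inj_to_nat_seg[OF G(2)] by blast
  define g where
    "g m = {c. c \<in> y ` G \<rightarrow> carrier A \<and> M.lincomb (\<lambda>v. c (y v)) G = m}" for m
  have g_ne: "g m \<noteq> {}" if m: "m \<in> carrier M" for m
  proof -
    obtain a where a: "a \<in> G \<rightarrow> carrier A" "M.lincomb a G = m"
      using M.finite_in_span[OF G(2,1)] G(3) m by blast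
    have "M.lincomb (\<lambda>v. a (the_inv_into G y (y v))) G = M.lincomb a G"
      unfolding M.lincomb_def using a G y
      by (intro M.finsum_cong') (auto simp: the_inv_into_f_f)
    then have "(\<lambda>i. a (the_inv_into G y i)) \<in> g m"
      using a y by (auto simp: g_def the_inv_into_f_f)
    then show ?thesis by blast
  qed
  have inj: "inj_on g (carrier M)"
  proof (rule inj_onI)
    fix m m' assume "m \<in> carrier M" "m' \<in> carrier M" "g m = g m'"
    with g_ne obtain c where "c \<in> g m" "c \<in> g m'" by blast
    then show "m = m'" by (simp add: g_def)
  qed
  define h where "h = the_inv_into (carrier M) g"
  have hg [simp]: "h (g m) = m" if "m \<in> carrier M" for m
    using that inj by (simp add: h_def the_inv_into_f_f)
  define N :: "('a, (nat \<Rightarrow> 'a) set) module" where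
    "N = \<lparr>carrier = g ` carrier M, monoid.mult = (\<lambda>u v. u), one = g \<zero>\<^bsub>M\<^esub>, ring.zero = g \<zero>\<^bsub>M\<^esub>,
          add = (\<lambda>u v. g (h u \<oplus>\<^bsub>M\<^esub> h v)), smult = (\<lambda>a u. g (a \<odot>\<^bsub>M\<^esub> h u))\<rparr>"
  have N: "carrier N = g ` carrier M" "\<zero>\<^bsub>N\<^esub> = g \<zero>\<^bsub>M\<^esub>"
    "u \<oplus>\<^bsub>N\<^esub> v = g (h u \<oplus>\<^bsub>M\<^esub> h v)" "a \<odot>\<^bsub>N\<^esub> u = g (a \<odot>\<^bsub>M\<^esub> h u)" for a u v
    by (simp_all add: N_def)
  have "abelian_group N"
  proof (rule abelian_groupI)
    fix u assume "u \<in> carrier N"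
    then obtain m where m: "m \<in> carrier M" "u = g m" by (auto simp: N)
    then show "\<exists>v\<in>carrier N. v \<oplus>\<^bsub>N\<^esub> u = \<zero>\<^bsub>N\<^esub>"
      by (intro bexI[of _ "g (\<ominus>\<^bsub>M\<^esub> m)"]) (auto simp: N M.l_neg)
  qed (auto simp: N M.a_ac)
  then interpret N: module A N
    by (intro moduleI M.is_cring)
       (auto simp: N M.smult_l_distr M.smult_r_distr M.smult_assoc1)
  have g_hom: "g \<in> module_hom A M N"
    by (auto simp: module_hom_def N)
  interpret g: mod_hom A M N g
    by unfold_locales (rule g_hom)
  have "carrier N \<subseteq> N.span (g ` G)"
  proof
    fix u assume "u \<in> carrier N"
    then obtain m where m: "m \<in> carrier M" "u = g m" by (auto simp: N)
    obtain a where a: "a \<in> G \<rightarrow> carrier A" "M.lincomb a G = m"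
      using M.finite_in_span[OF G(2,1)] G(3) m by blast
    have inj_G: "inj_on g G"
      using inj G(1) by (rule inj_on_subset)
    have "N.lincomb (\<lambda>v. a (h v)) (g ` G) = (\<Oplus>\<^bsub>N\<^esub>v\<in>G. a (h (g v)) \<odot>\<^bsub>N\<^esub> g v)"
      unfolding N.lincomb_def using a G inj_G
      by (intro N.finsum_reindex) (auto simp: subset_iff intro!: N.smult_closed)
    also have "\<dots> = (\<Oplus>\<^bsub>N\<^esub>v\<in>G. g (a v \<odot>\<^bsub>M\<^esub> v))"
      using a G by (intro N.finsum_cong') (auto simp: subset_iff Pi_iff g.f_smult)
    also have "\<dots> = g (\<Oplus>\<^bsub>M\<^esub>v\<in>G. a v \<odot>\<^bsub>M\<^esub> v)"
      using G a by (subst g.hom_sum) (auto simp: subset_iff Pi_iff)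
    also have "\<dots> = u"
      using a m by (simp add: M.lincomb_def)
    finally have "u = N.lincomb (\<lambda>v. a (h v)) (g ` G)" by simp
    moreover have "(\<lambda>v. a (h v)) \<in> g ` G \<rightarrow> carrier A"
      using a G by (auto simp: subset_iff)
    ultimately show "u \<in> N.span (g ` G)"
      using G unfolding N.span_def by blast
  qed
  moreover have gG: "g ` G \<subseteq> carrier N"
    using G by (auto simp: N)
  ultimately have "N.span (g ` G) = carrier N"
    using N.span_is_subset2 by blast
  then have "finitely_generated_module A N"
    using gG G N.module_axioms unfolding finitely_generated_module_def by blast
  moreover have "module_isomorphic A M N"
    using g_hom inj by (auto simp: module_isomorphic_def bij_betw_def N)
  ultimately show ?thesis by blast
qed

end

theory Submission
  imports Defs "HOL-Library.Function_Algebras"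
begin

text \<open>
  Let \<open>q = p\<^sup>e\<close>. Over \<open>S\<close>, the push-forward \<open>F\<^sup>e\<^sub>*(S)\<close> is free: if \<open>\<beta>\<close> runs through a basis of \<open>K\<close>
  over its subfield of \<open>q\<close>-th powers and \<open>a\<close> through the exponent vectors with all entries below
  \<open>q\<close>, then the elements \<open>\<beta> x\<^sup>a\<close> are a basis, because every exponent vector is \<open>a + q c\<close> for
  exactly one such \<open>a\<close> and one \<open>c\<close>. A monomial ideal \<open>I\<close> consists of all series supported in an
  upward closed set \<open>D\<close> of exponents, so it is compatible with this decomposition: in the coordinate
  \<open>\<beta> x\<^sup>a\<close> it becomes the monomial ideal \<open>J\<^sub>a\<close> with exponent set \<open>{c. a + q c \<in> D}\<close>. Hence
  \<open>F\<^sup>e\<^sub>*(S/I)\<close> is the direct sum of the cyclic modules \<open>S/J\<^sub>a\<close>, one for each pair of \<open>\<beta>\<close> and \<open>a\<close>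
  (\<open>frobenius_decomposition\<close>).

  The point is that only finitely many ideals \<open>J\<^sub>a\<close> occur for all \<open>e\<close> together. If \<open>I\<close> is generated
  by monomials with exponents \<open>r\<close> in a finite set \<open>G\<close>, then \<open>J\<^sub>a\<close> is generated by monomials whose
  exponents lie below some \<open>r \<in> G\<close>: from \<open>r \<le> a + q c\<close> follows \<open>r \<le> a + q min(c, r)\<close>
  (\<open>residual_generated\<close>). There are finitely many such exponents, hence finitely many such ideals.

  Polynomials and power series are treated together, as the series whose support belongs to a class
  of allowed sets: the finite sets or all sets. Only Noetherianity, which is part of FFRT, needs two
  arguments (\<open>poly_ideal_finitely_generated\<close>, \<open>powser_ideal_finitely_generated\<close>); both rest on
  Dickson's lemma and on division by finitely many elements whose leading exponents, or lowest ones
  for power series, generate those of the whole ideal.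
\<close>

section \<open>Sums and the Frobenius map in commutative rings\<close>

lemma (in abelian_monoid) finsum_Sigma:
  assumes "finite A" "\<And>a. a \<in> A \<Longrightarrow> finite (B a)"
    "\<And>a b. a \<in> A \<Longrightarrow> b \<in> B a \<Longrightarrow> g a b \<in> carrier G"
  shows "(\<Oplus>a\<in>A. \<Oplus>b\<in>B a. g a b) = finsum G (\<lambda>(a, b). g a b) (Sigma A B)"
proof -
  have inner: "(\<Oplus>b\<in>B a. g a b) = finsum G (\<lambda>(a, b). g a b) (Pair a ` B a)" if "a \<in> A" for a
    using assms(3) that by (subst add.finprod_reindex) (auto intro: inj_onI)
  have "finsum G (\<lambda>(a, b). g a b) (Sigma A B) = finsum G (\<lambda>(a, b). g a b) (\<Union>a\<in>A. Pair a ` B a)"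
    by (intro arg_cong[where f = "finsum G _"]) auto
  also have "\<dots> = (\<Oplus>a\<in>A. finsum G (\<lambda>(a, b). g a b) (Pair a ` B a))"
    using assms by (intro add.finprod_UN_disjoint) (auto simp: pairwise_def disjnt_def)
  also have "\<dots> = (\<Oplus>a\<in>A. \<Oplus>b\<in>B a. g a b)"
    using assms(3) by (intro finsum_cong') (auto simp: inner intro!: finsum_closed)
  finally show ?thesis by simp
qed

lemma (in abelian_monoid) finsum_mono_neutral:
  assumes "finite B" "A \<subseteq> B" "g \<in> A \<rightarrow> carrier G"
    "\<And>b. b \<in> B - A \<Longrightarrow> g b = \<zero>"
  shows "finsum G g B = finsum G g A"
proof (rule add.finprod_mono_neutral_cong_right)
  show "g \<in> B \<rightarrow> carrier G"
  proof
    fix b assume "b \<in> B"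
    then show "g b \<in> carrier G"
      using assms(3) assms(4)[of b] by (cases "b \<in> A") auto
  qed
qed (use assms in auto)

lemma (in abelian_group) add_minus_cancel:
  "x \<in> carrier G \<Longrightarrow> y \<in> carrier G \<Longrightarrow> x \<oplus> (y \<ominus> x) = y"
  by (simp add: a_minus_def a_comm[of y] a_assoc[symmetric] r_neg)

lemma (in abelian_group) minus_eq_minus:
  assumes "a \<in> carrier G" "b \<in> carrier G" "s \<in> carrier G" "t \<in> carrier G" "a \<oplus> s = b \<oplus> t"
  shows "a \<ominus> b = t \<ominus> s"
proof -
  have "a \<ominus> b = (s \<oplus> \<ominus> s) \<oplus> (a \<oplus> \<ominus> b)"
    using assms by (simp add: a_minus_def r_neg)
  also have "\<dots> = (a \<oplus> s) \<oplus> (\<ominus> s \<oplus> \<ominus> b)"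
    using assms(1-4) by (simp add: a_ac)
  also have "\<dots> = (b \<oplus> \<ominus> b) \<oplus> (t \<oplus> \<ominus> s)"
    unfolding assms(5) using assms(1-4) by (simp add: a_ac)
  also have "\<dots> = t \<ominus> s"
    using assms(1-4) by (simp add: a_minus_def r_neg)
  finally show ?thesis .
qed

lemma (in cring) binomial_theorem:
  assumes x: "x \<in> carrier R" and y: "y \<in> carrier R"
  shows "(x \<oplus> y) [^] (m :: nat) = (\<Oplus>k\<in>{..m}. [(m choose k)] \<cdot>\<^bsub>R\<^esub> (x [^] k \<otimes> y [^] (m - k)))"
proof (induction m)
  case 0
  show ?case by simp
next
  case (Suc m)
  let ?T = "\<lambda>m k. [(m choose k)] \<cdot>\<^bsub>R\<^esub> (x [^] k \<otimes> y [^] (m - k))"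
  have T: "?T m k \<in> carrier R" for m k
    using x y by simp
  have T0: "?T (Suc m) 0 = y \<otimes> ?T m 0"
    using x y by (simp add: m_comm)
  have TSuc: "?T (Suc m) (Suc k) = x \<otimes> ?T m k \<oplus> y \<otimes> ?T m (Suc k)" for k
  proof (cases "k < m")
    case True
    then have "y [^] (m - k) = y \<otimes> y [^] (m - Suc k)"
      using y by (metis Suc_diff_Suc nat_pow_Suc2)
    then show ?thesis
      using x y by (simp add: add.nat_pow_mult[symmetric] add_pow_rdistr m_ac)
  next
    case False
    then have "m choose Suc k = 0" "m - k = 0" by simp_all
    then show ?thesis
      using x y by (simp add: add_pow_rdistr m_ac del: binomial_Suc_Suc) (simp add: \<open>m choose Suc k = 0\<close>)
  qed
  have "(\<Oplus>k\<in>{..Suc m}. ?T (Suc m) k) = (\<Oplus>k\<in>{..m}. ?T (Suc m) (Suc k)) \<oplus> ?T (Suc m) 0"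
    using T by (intro finsum_Suc2) auto
  also have "\<dots> = ((\<Oplus>k\<in>{..m}. x \<otimes> ?T m k) \<oplus> (\<Oplus>k\<in>{..m}. y \<otimes> ?T m (Suc k))) \<oplus> y \<otimes> ?T m 0"
    unfolding TSuc T0 using T x y by (subst finsum_addf) auto
  also have "\<dots> = (\<Oplus>k\<in>{..m}. x \<otimes> ?T m k) \<oplus> (\<Oplus>k\<in>{..Suc m}. y \<otimes> ?T m k)"
    using T x y by (subst finsum_Suc2) (auto simp: a_assoc)
  also have "(\<Oplus>k\<in>{..Suc m}. y \<otimes> ?T m k) = (\<Oplus>k\<in>{..m}. y \<otimes> ?T m k)"
    using T x y by (intro finsum_mono_neutral) (auto simp: atMost_Suc binomial_eq_0)
  also have "(\<Oplus>k\<in>{..m}. x \<otimes> ?T m k) \<oplus> (\<Oplus>k\<in>{..m}. y \<otimes> ?T m k) = (x \<oplus> y) \<otimes> (\<Oplus>k\<in>{..m}. ?T m k)"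
    using T x y by (simp add: finsum_rdistr[symmetric] l_distr)
  also have "\<dots> = (x \<oplus> y) [^] Suc m"
    using Suc x y by (simp add: m_comm)
  finally show ?case by simp
qed

lemma (in cring) frobenius_add:
  assumes p: "Factorial_Ring.prime (p :: nat)" and char: "[p] \<cdot>\<^bsub>R\<^esub> \<one> = \<zero>"
    and x: "x \<in> carrier R" and y: "y \<in> carrier R"
  shows "(x \<oplus> y) [^] (p ^ e) = x [^] (p ^ e) \<oplus> y [^] (p ^ e)"
proof (induction e)
  case 0
  show ?case using x y by simp
next
  case (Suc e)
  have p0: "p > 0" using p prime_gt_0_nat by blast
  have mult_p: "[(p * m)] \<cdot>\<^bsub>R\<^esub> z = \<zero>" if "z \<in> carrier R" for m z
  proof -
    have "[p] \<cdot>\<^bsub>R\<^esub> z = ([p] \<cdot>\<^bsub>R\<^esub> \<one>) \<otimes> z"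
      using that by (simp add: add_pow_ldistr)
    then have "[p] \<cdot>\<^bsub>R\<^esub> z = \<zero>" using char that by simp
    then show ?thesis
      using add.nat_pow_pow[of z m p] that by simp
  qed
  have frob: "(u \<oplus> v) [^] p = u [^] p \<oplus> v [^] p" if u: "u \<in> carrier R" and v: "v \<in> carrier R" for u v
  proof -
    let ?T = "\<lambda>k. [(p choose k)] \<cdot>\<^bsub>R\<^esub> (u [^] k \<otimes> v [^] (p - k))"
    have "(u \<oplus> v) [^] p = finsum R ?T {..p}"
      by (rule binomial_theorem[OF u v])
    also have "\<dots> = finsum R ?T {0, p}"
    proof (rule finsum_mono_neutral)
      fix k assume "k \<in> {..p} - {0, p}"
      then have "p dvd p choose k"
        using p by (intro dvd_choose_prime) auto
      then show "?T k = \<zero>"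
        using mult_p u v by (auto elim!: dvdE)
    qed (use u v in auto)
    also have "\<dots> = u [^] p \<oplus> v [^] p"
      using u v p0 by (simp add: a_comm)
    finally show ?thesis .
  qed
  have pow: "z [^] (p ^ Suc e) = (z [^] (p ^ e)) [^] p" if "z \<in> carrier R" for z
    using that by (simp add: nat_pow_pow mult.commute)
  show ?case
    using x y Suc frob[of "x [^] (p ^ e)" "y [^] (p ^ e)"] by (simp only: pow a_closed nat_pow_closed)
qed

lemma (in cring) frobenius_finsum:
  assumes p: "Factorial_Ring.prime (p :: nat)" and char: "[p] \<cdot>\<^bsub>R\<^esub> \<one> = \<zero>"
    and "finite A" "f \<in> A \<rightarrow> carrier R"
  shows "(\<Oplus>a\<in>A. f a) [^] (p ^ e) = (\<Oplus>a\<in>A. f a [^] (p ^ e))"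
  using assms(3,4)
proof (induction A rule: finite_induct)
  case empty
  have "p ^ e > 0" using p prime_gt_0_nat by simp
  then show ?case by (simp add: nat_pow_zero)
next
  case (insert a A)
  then show ?case
    by (simp add: frobenius_add[OF p char] Pi_def finsum_closed)
qed

section \<open>Exponent vectors\<close>

lemma exponents_add: "a \<in> exponents n \<Longrightarrow> b \<in> exponents n \<Longrightarrow> a + b \<in> exponents n"
  by (auto simp: exponents_def)

lemma exponents_le: "a \<le> c \<Longrightarrow> c \<in> exponents n \<Longrightarrow> a \<in> exponents n"
  by (auto simp: exponents_def le_fun_def) (metis le_zero_eq)

lemma exponents_diff: "c \<in> exponents n \<Longrightarrow> c - a \<in> exponents n"
  by (auto simp: exponents_def)

lemma exponents_zero: "0 \<in> exponents n"
  by (auto simp: exponents_def)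

lemma le_add_fun: "a \<le> a + (b :: nat \<Rightarrow> nat)" "b \<le> a + b"
  by (auto simp: le_fun_def)

lemma diff_le_fun: "c - a \<le> (c :: nat \<Rightarrow> nat)"
  by (auto simp: le_fun_def)

lemma add_diff_fun: "a \<le> c \<Longrightarrow> a + (c - a) = (c :: nat \<Rightarrow> nat)" "a \<le> c \<Longrightarrow> c - a + a = c"
  by (auto simp: le_fun_def)

lemma diff_mono_fun: "a \<le> c \<Longrightarrow> a - b \<le> c - (b :: nat \<Rightarrow> nat)"
  by (simp add: le_fun_def diff_le_mono)

lemma le_diff_add_fun: "b \<le> c \<Longrightarrow> d \<le> c - b \<Longrightarrow> b + d \<le> (c :: nat \<Rightarrow> nat)"
  by (simp add: le_fun_def) (metis add.commute le_diff_conv2)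

lemma finite_exponents_le:
  assumes "c \<in> exponents n"
  shows "finite {a. a \<le> c}"
proof -
  have "{a. a \<le> c} \<subseteq> {a. \<forall>i. (i \<in> {..<n} \<longrightarrow> a i \<in> {..Max (c ` {..<n})}) \<and> (i \<notin> {..<n} \<longrightarrow> a i = 0)}"
  proof (intro subsetI CollectI allI conjI impI)
    fix a i assume "a \<in> {a. a \<le> c}" "i \<in> {..<n}"
    then have "a i \<le> c i" "c i \<in> c ` {..<n}" by (auto simp: le_fun_def)
    then show "a i \<in> {..Max (c ` {..<n})}" by (meson Max_ge atMost_iff finite_imageI finite_lessThan le_trans)
  next
    fix a i assume "a \<in> {a. a \<le> c}" "i \<notin> {..<n}"
    then show "a i = 0" using assms by (auto simp: le_fun_def exponents_def) (metis le_zero_eq not_less)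
  qed
  moreover have "finite {a. \<forall>i. (i \<in> {..<n} \<longrightarrow> a i \<in> {..Max (c ` {..<n})}) \<and> (i \<notin> {..<n} \<longrightarrow> a i = (0::nat))}"
    by (intro finite_set_of_finite_funs) auto
  ultimately show ?thesis by (rule finite_subset)
qed


definition nth_prime_number :: "nat \<Rightarrow> nat" where
  "nth_prime_number = enumerate {q. Factorial_Ring.prime q}"

lemma prime_nth_prime_number: "Factorial_Ring.prime (nth_prime_number i)"
  using enumerate_in_set[OF primes_infinite] by (auto simp: nth_prime_number_def)

lemma inj_nth_prime_number: "inj nth_prime_number"
  unfolding nth_prime_number_def
  by (rule strict_mono_imp_inj_on, rule strict_mono_enumerate, rule primes_infinite)

text \<open>
  Unique factorization makes \<open>weight\<close> injective on exponent vectors, and it turns addition into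
  multiplication. Comparing weights is therefore a monomial order in which each exponent vector
  has finitely many predecessors, so that induction on the weight is available both for the largest
  exponents of polynomials and for the smallest exponents of power series.
\<close>

definition weight :: "nat \<Rightarrow> (nat \<Rightarrow> nat) \<Rightarrow> nat" where
  "weight n a = (\<Prod>i<n. nth_prime_number i ^ a i)"

lemma weight_pos: "weight n a > 0"
  unfolding weight_def by (intro prod_pos) (simp add: prime_nth_prime_number prime_gt_0_nat)

lemma weight_add: "weight n (a + b) = weight n a * weight n b"
  by (simp add: weight_def power_add prod.distrib)

lemma inj_on_weight: "inj_on (weight n) (exponents n)"
proof (rule inj_onI)
  fix a b assume ab: "a \<in> exponents n" "b \<in> exponents n" and eq: "weight n a = weight n b"
  have mult: "multiplicity (nth_prime_number i) (weight n a) = a i" if "i < n" for a i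
  proof -
    let ?inv = "the_inv nth_prime_number"
    have "weight n a = (\<Prod>q\<in>nth_prime_number ` {..<n}. q ^ a (?inv q))"
      unfolding weight_def
      by (subst prod.reindex)
         (auto simp: the_inv_f_f[OF inj_nth_prime_number] intro: inj_on_subset[OF inj_nth_prime_number])
    then have "multiplicity (nth_prime_number i) (weight n a) = a (?inv (nth_prime_number i))"
      using that by (simp, subst multiplicity_prod_prime_powers) (auto simp: prime_nth_prime_number)
    then show ?thesis by (simp add: the_inv_f_f[OF inj_nth_prime_number])
  qed
  show "a = b"
  proof
    fix i show "a i = b i"
    proof (cases "i < n")
      case True then show ?thesis using mult[of i a] mult[of i b] eq by simp
    next
      case False then show ?thesis using ab by (simp add: exponents_def)
    qed
  qed
qed

lemma nat_seq_has_mono_subseq: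
  fixes s :: "nat \<Rightarrow> nat"
  shows "\<exists>r :: nat \<Rightarrow> nat. strict_mono r \<and> mono (\<lambda>k. s (r k))"
proof -
  obtain f where f: "strict_mono f" "monoseq (\<lambda>k. s (f k))"
    using seq_monosub by blast
  show ?thesis
  proof (cases "mono (\<lambda>k. s (f k))")
    case False
    then have anti: "s (f k) \<le> s (f m)" if "m \<le> k" for m k
      using f(2) that by (auto simp: monoseq_def mono_def)
    \<comment> \<open>A nonincreasing subsequence is constant from any position of its minimum on.\<close>
    define N where "N = (ARG_MIN (\<lambda>k. s (f k)) k. True)"
    have "s (f N) \<le> s (f k)" for k
      unfolding N_def by (rule arg_min_nat_le) simp
    then have "s (f (N + k)) = s (f N)" for k
      using anti[of N "N + k"] by (simp add: le_antisym)
    then have "mono (\<lambda>k. s (f (N + k)))"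
      by (simp add: mono_def)
    moreover have "strict_mono (\<lambda>k. f (N + k))"
      using f(1) by (simp add: strict_mono_def)
    ultimately show ?thesis by (intro exI[of _ "\<lambda>k. f (N + k)"]) simp
  qed (use f in blast)
qed

lemma vector_seq_has_mono_subseq:
  fixes s :: "nat \<Rightarrow> nat \<Rightarrow> nat"
  shows "\<exists>r :: nat \<Rightarrow> nat. strict_mono r \<and> (\<forall>i<n. mono (\<lambda>k. s (r k) i))"
proof (induction n)
  case 0
  show ?case by (auto intro: exI[of _ id] simp: strict_mono_def)
next
  case (Suc n)
  then obtain r :: "nat \<Rightarrow> nat" where r: "strict_mono r" "\<forall>i<n. mono (\<lambda>k. s (r k) i)" by blast
  obtain u :: "nat \<Rightarrow> nat" where u: "strict_mono u" "mono (\<lambda>k. s (r (u k)) n)"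
    using nat_seq_has_mono_subseq[of "\<lambda>k. s (r k) n"] by blast
  have "mono u" using u(1) by (rule strict_mono_mono)
  then have "\<forall>i<Suc n. mono (\<lambda>k. s (r (u k)) i)"
    using r u by (auto simp: less_Suc_eq mono_def)
  then show ?case
    using r u by (intro exI[of _ "\<lambda>k. r (u k)"]) (auto simp: strict_mono_def)
qed

text \<open>
  The minimal elements of \<open>U\<close> suffice. They form an antichain, whereas any sequence of exponent
  vectors has a coordinatewise nondecreasing subsequence; so there are finitely many of them.
\<close>

theorem dickson:
  assumes U: "U \<subseteq> exponents n"
  obtains F where "finite F" and "F \<subseteq> U" and "\<And>x. x \<in> U \<Longrightarrow> \<exists>a\<in>F. a \<le> x"
proof -
  define F where "F = {a \<in> U. \<forall>b\<in>U. b \<le> a \<longrightarrow> b = a}"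
  have "\<exists>a\<in>F. a \<le> x" if x: "x \<in> U" for x
  proof -
    have "finite {a \<in> U. a \<le> x}"
      using finite_exponents_le[of x n] U x by (auto intro: finite_subset[rotated])
    then obtain a where a: "a \<in> {a \<in> U. a \<le> x}" "a \<le> x" "\<forall>b\<in>{a \<in> U. a \<le> x}. b \<le> a \<longrightarrow> a = b"
      using finite_has_minimal2[of "{a \<in> U. a \<le> x}" x] x by (metis (mono_tags, lifting) mem_Collect_eq order_refl)
    then show ?thesis unfolding F_def by fastforce
  qed
  moreover have "finite F"
  proof (rule ccontr)
    assume "infinite F"
    then obtain s :: "nat \<Rightarrow> nat \<Rightarrow> nat" where s: "inj s" "range s \<subseteq> F"
      using infinite_countable_subset by blast
    obtain r :: "nat \<Rightarrow> nat" where r: "strict_mono r" "\<forall>i<n. mono (\<lambda>k. s (r k) i)"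
      using vector_seq_has_mono_subseq by blast
    have sX: "s k \<in> U" for k using s(2) by (auto simp: F_def)
    have "s (r 0) i \<le> s (r 1) i" for i
    proof (cases "i < n")
      case False
      then show ?thesis using sX[of "r 0"] U by (auto simp: exponents_def)
    qed (use r in \<open>auto simp: mono_def\<close>)
    then have "s (r 0) = s (r 1)"
      using s(2) sX by (auto simp: F_def le_fun_def)
    then have "r 0 = r 1" using s(1) by (simp add: inj_eq)
    then show False using strict_monoD[OF r(1), of 0 1] by simp
  qed
  ultimately show ?thesis using that[of F] by (auto simp: F_def)
qed

section \<open>The ring of power series and its subring of polynomials\<close>

locale coefficient_ring = K?: cring K for K :: "('a, 'b) ring_scheme" (structure) +
  fixes n :: nat
begin

abbreviation P :: "((nat \<Rightarrow> nat) \<Rightarrow> 'a) ring" where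
  "P \<equiv> mpowser_ring K n"

definition supp :: "((nat \<Rightarrow> nat) \<Rightarrow> 'a) \<Rightarrow> (nat \<Rightarrow> nat) set" where
  "supp f = {a \<in> exponents n. f a \<noteq> \<zero>}"

lemma carrier_P: "carrier P = exponents n \<rightarrow>\<^sub>E carrier K"
  by (simp add: mpowser_ring_def)

lemma coeff_closed [simp]: "f \<in> carrier P \<Longrightarrow> a \<in> exponents n \<Longrightarrow> f a \<in> carrier K"
  by (auto simp: carrier_P)

lemma P_eqI:
  "f \<in> carrier P \<Longrightarrow> g \<in> carrier P \<Longrightarrow> (\<And>a. a \<in> exponents n \<Longrightarrow> f a = g a) \<Longrightarrow> f = g"
  unfolding carrier_P by (rule PiE_ext)

lemma coeff_add: "a \<in> exponents n \<Longrightarrow> (f \<oplus>\<^bsub>P\<^esub> g) a = f a \<oplus> g a"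
  by (simp add: mpowser_ring_def)

lemma coeff_zero: "a \<in> exponents n \<Longrightarrow> \<zero>\<^bsub>P\<^esub> a = \<zero>"
  by (simp add: mpowser_ring_def)

lemma coeff_one: "a \<in> exponents n \<Longrightarrow> \<one>\<^bsub>P\<^esub> a = (if a = 0 then \<one> else \<zero>)"
  by (simp add: mpowser_ring_def monomial_def zero_fun_def)

lemma coeff_mult:
  "c \<in> exponents n \<Longrightarrow> (f \<otimes>\<^bsub>P\<^esub> g) c = (\<Oplus>a\<in>{a. a \<le> c}. f a \<otimes> g (c - a))"
  by (simp add: mpowser_ring_def fun_diff_def)

lemma mult_term_closed:
  assumes "f \<in> carrier P" "g \<in> carrier P" "c \<in> exponents n"
  shows "(\<lambda>a. f a \<otimes> g (c - a)) \<in> {a. a \<le> c} \<rightarrow> carrier K"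
  using assms exponents_le[of _ c n] by (auto simp: exponents_diff)

lemma add_closed_P: "f \<in> carrier P \<Longrightarrow> g \<in> carrier P \<Longrightarrow> f \<oplus>\<^bsub>P\<^esub> g \<in> carrier P"
  by (auto simp: mpowser_ring_def)

lemma mult_closed_P: "f \<in> carrier P \<Longrightarrow> g \<in> carrier P \<Longrightarrow> f \<otimes>\<^bsub>P\<^esub> g \<in> carrier P"
  using mult_term_closed[of f g]
  by (auto simp: mpowser_ring_def fun_diff_def intro!: finsum_closed)

lemma zero_closed_P: "\<zero>\<^bsub>P\<^esub> \<in> carrier P"
  by (auto simp: mpowser_ring_def)

lemma monomial_closed_P: "monomial K n r \<in> carrier P"
  by (auto simp: mpowser_ring_def monomial_def)

lemma one_closed_P: "\<one>\<^bsub>P\<^esub> \<in> carrier P"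
  using monomial_closed_P by (simp add: mpowser_ring_def)

lemma mult_comm_P:
  assumes f: "f \<in> carrier P" and g: "g \<in> carrier P"
  shows "f \<otimes>\<^bsub>P\<^esub> g = g \<otimes>\<^bsub>P\<^esub> f"
proof (rule P_eqI)
  fix c assume c: "c \<in> exponents n"
  have "(\<Oplus>a\<in>{a. a \<le> c}. f a \<otimes> g (c - a)) = (\<Oplus>a\<in>{a. a \<le> c}. g a \<otimes> f (c - a))"
  proof (rule finsum_reindex_bij_witness[where i = "\<lambda>a. c - a" and j = "\<lambda>a. c - a"])
    fix a assume a: "a \<in> {a. a \<le> c}"
    then show [simp]: "c - (c - a) = a"
      by (auto simp: le_fun_def)
    show "g (c - a) \<otimes> f (c - (c - a)) = f a \<otimes> g (c - a)"
      using a c f g exponents_le[of a c n] by (simp add: m_comm exponents_diff)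
  qed (use mult_term_closed[OF f g c] mult_term_closed[OF g f c] in \<open>auto simp: le_fun_def\<close>)
  then show "(f \<otimes>\<^bsub>P\<^esub> g) c = (g \<otimes>\<^bsub>P\<^esub> f) c"
    by (simp add: coeff_mult c)
qed (use f g in \<open>simp_all add: mult_closed_P\<close>)

text \<open>
  Both sides sum over the ways to write \<open>c\<close> as a sum of three exponent vectors: on the left these
  are \<open>b\<close>, \<open>a - b\<close> and \<open>c - a\<close> for \<open>b \<le> a \<le> c\<close>.
\<close>

lemma mult_assoc_P:
  assumes f: "f \<in> carrier P" and g: "g \<in> carrier P" and h: "h \<in> carrier P"
  shows "(f \<otimes>\<^bsub>P\<^esub> g) \<otimes>\<^bsub>P\<^esub> h = f \<otimes>\<^bsub>P\<^esub> (g \<otimes>\<^bsub>P\<^esub> h)"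
proof (rule P_eqI)
  fix c assume c: "c \<in> exponents n"
  let ?L = "\<lambda>a b. f b \<otimes> g (a - b) \<otimes> h (c - a)"
  let ?R = "\<lambda>b d. f b \<otimes> (g d \<otimes> h (c - b - d))"
  have exp: "a \<le> c \<Longrightarrow> a \<in> exponents n" "c - a \<in> exponents n" for a
    using c by (auto intro: exponents_le exponents_diff)
  have fin: "finite {a. a \<le> c}" "a \<le> c \<Longrightarrow> finite {b. b \<le> a}" "finite {b. b \<le> c - a}" for a
    by (rule finite_exponents_le[OF c], erule finite_exponents_le[OF exp(1)], rule finite_exponents_le[OF exp(2)])
  have le_exp: "b \<in> exponents n" "a - b \<in> exponents n" if "a \<le> c" "b \<le> a" for a b
    using exponents_le[OF that(2) exp(1)[OF that(1)]] exponents_diff[OF exp(1)[OF that(1)]] by blast+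
  have L: "?L a b \<in> carrier K" if "a \<le> c" "b \<le> a" for a b
    using that f g h exp le_exp by simp
  have R: "?R b d \<in> carrier K" if "b \<le> c" "d \<le> c - b" for b d
    using that f g h exp exponents_diff[OF exp(2)[of b]] exponents_le[OF that(2) exp(2)] by simp
  have RL: "?R b (a - b) \<in> carrier K" if "a \<le> c" "b \<le> a" for a b
    using R[OF order_trans[OF that(2,1)] diff_mono_fun[OF that(1)]] .
  have "((f \<otimes>\<^bsub>P\<^esub> g) \<otimes>\<^bsub>P\<^esub> h) c = (\<Oplus>a\<in>{a. a \<le> c}. (\<Oplus>b\<in>{b. b \<le> a}. f b \<otimes> g (a - b)) \<otimes> h (c - a))"
    unfolding coeff_mult[OF c]
    using exp f g h by (intro finsum_cong')
      (auto simp: coeff_mult mult_term_closed)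
  also have "\<dots> = (\<Oplus>a\<in>{a. a \<le> c}. \<Oplus>b\<in>{b. b \<le> a}. ?L a b)"
    using L fin exp mult_term_closed[OF f g] h
    by (intro finsum_cong') (auto simp: finsum_ldistr intro!: finsum_closed)
  also have "\<dots> = finsum K (\<lambda>(a, b). ?L a b) (SIGMA a:{a. a \<le> c}. {b. b \<le> a})"
    using L fin by (intro finsum_Sigma) auto
  also have "\<dots> = finsum K (\<lambda>(b, d). ?R b d) (SIGMA b:{b. b \<le> c}. {d. d \<le> c - b})"
  proof (rule finsum_reindex_bij_witness[where j = "\<lambda>(a, b). (b, a - b)" and i = "\<lambda>(b, d). (b + d, b)"])
    fix x assume "x \<in> (SIGMA a:{a. a \<le> c}. {b. b \<le> a})"
    then obtain a b where x: "x = (a, b)" and ab: "a \<le> c" "b \<le> a" by auto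
    then have "c - b - (a - b) = c - a" "b + (a - b) = a"
      by (auto simp: le_fun_def fun_eq_iff)
    moreover have "f b \<in> carrier K" "g (a - b) \<in> carrier K" "h (c - a) \<in> carrier K"
      using ab f g h exp le_exp by auto
    ultimately show "(case (case x of (a, b) \<Rightarrow> (b, a - b)) of (b, d) \<Rightarrow> ?R b d) = (case x of (a, b) \<Rightarrow> ?L a b)"
      and "(case (case x of (a, b) \<Rightarrow> (b, a - b)) of (b, d) \<Rightarrow> (b + d, b)) = x"
      by (simp_all add: x m_assoc)
    show "(case x of (a, b) \<Rightarrow> (b, a - b)) \<in> (SIGMA b:{b. b \<le> c}. {d. d \<le> c - b})"
      using ab by (simp add: x diff_mono_fun order_trans[OF ab(2,1)])
  next
    fix x assume "x \<in> (SIGMA b:{b. b \<le> c}. {d. d \<le> c - b})"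
    then obtain b d where x: "x = (b, d)" and bd: "b \<le> c" "d \<le> c - b" by auto
    show "(case (case x of (b, d) \<Rightarrow> (b + d, b)) of (a, b) \<Rightarrow> (b, a - b)) = x"
      by (simp add: x fun_eq_iff)
    show "(case x of (b, d) \<Rightarrow> (b + d, b)) \<in> (SIGMA a:{a. a \<le> c}. {b. b \<le> a})"
      using bd by (simp add: x le_diff_add_fun le_add_fun)
  qed (use L R in \<open>auto intro!: RL\<close>)
  also have "\<dots> = (\<Oplus>b\<in>{b. b \<le> c}. \<Oplus>d\<in>{d. d \<le> c - b}. ?R b d)"
    using R fin by (intro finsum_Sigma[symmetric]) auto
  also have "\<dots> = (\<Oplus>b\<in>{b. b \<le> c}. f b \<otimes> (\<Oplus>d\<in>{d. d \<le> c - b}. g d \<otimes> h (c - b - d)))"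
    using R fin exp mult_term_closed[OF g h] f
    by (intro finsum_cong') (auto simp: finsum_rdistr intro!: finsum_closed)
  also have "\<dots> = (f \<otimes>\<^bsub>P\<^esub> (g \<otimes>\<^bsub>P\<^esub> h)) c"
    unfolding coeff_mult[OF c]
    using exp f g h by (intro finsum_cong')
      (auto simp: coeff_mult mult_closed_P mult_term_closed)
  finally show "((f \<otimes>\<^bsub>P\<^esub> g) \<otimes>\<^bsub>P\<^esub> h) c = (f \<otimes>\<^bsub>P\<^esub> (g \<otimes>\<^bsub>P\<^esub> h)) c" .
qed (use f g h in \<open>simp_all add: mult_closed_P\<close>)

lemma mult_single:
  assumes f: "f \<in> carrier P" and g: "g \<in> carrier P" and c: "c \<in> exponents n"
    and f0: "\<And>a. a \<in> exponents n \<Longrightarrow> a \<noteq> r \<Longrightarrow> f a = \<zero>"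
  shows "(f \<otimes>\<^bsub>P\<^esub> g) c = (if r \<le> c then f r \<otimes> g (c - r) else \<zero>)"
proof -
  have exp: "a \<le> c \<Longrightarrow> a \<in> exponents n" "c - a \<in> exponents n" for a
    using c by (auto intro: exponents_le exponents_diff)
  have "(f \<otimes>\<^bsub>P\<^esub> g) c = (\<Oplus>a\<in>{a. a \<le> c}. f a \<otimes> g (c - a))"
    by (rule coeff_mult[OF c])
  also have "\<dots> = (\<Oplus>a\<in>{a. a \<le> c \<and> a = r}. f a \<otimes> g (c - a))"
    using f0 exp g c mult_term_closed[OF f g c]
    by (intro finsum_mono_neutral) (auto intro: finite_exponents_le[OF c])
  also have "\<dots> = (if r \<le> c then f r \<otimes> g (c - r) else \<zero>)"
  proof (cases "r \<le> c")
    case True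
    then have "{a. a \<le> c \<and> a = r} = {r}" by auto
    then show ?thesis using True exp f g by (simp add: Pi_def)
  next
    case False
    then have empty: "{a. a \<le> c \<and> a = r} = {}" by auto
    show ?thesis unfolding empty using False by simp
  qed
  finally show ?thesis .
qed

lemma cring_P: "cring P"
proof (rule cringI)
  show "abelian_group P"
  proof (rule abelian_groupI)
    fix f assume f: "f \<in> carrier P"
    define g where "g = (\<lambda>a\<in>exponents n. \<ominus> f a)"
    have "g \<in> carrier P" using f by (auto simp: g_def carrier_P)
    moreover from this have "g \<oplus>\<^bsub>P\<^esub> f = \<zero>\<^bsub>P\<^esub>"
      using f by (intro P_eqI add_closed_P zero_closed_P)
        (auto simp: coeff_add coeff_zero g_def l_neg)
    ultimately show "\<exists>g\<in>carrier P. g \<oplus>\<^bsub>P\<^esub> f = \<zero>\<^bsub>P\<^esub>" by blast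
  qed (auto intro!: P_eqI simp: add_closed_P zero_closed_P coeff_add coeff_zero a_ac)
  show "comm_monoid P"
  proof (rule comm_monoidI)
    fix f assume f: "f \<in> carrier P"
    show "\<one>\<^bsub>P\<^esub> \<otimes>\<^bsub>P\<^esub> f = f"
    proof (rule P_eqI)
      fix c assume "c \<in> exponents n"
      moreover have "c - 0 = c" "0 \<le> c" by (auto simp: le_fun_def)
      ultimately show "(\<one>\<^bsub>P\<^esub> \<otimes>\<^bsub>P\<^esub> f) c = f c"
        using f by (subst mult_single[where r = 0])
          (auto simp: coeff_one one_closed_P exponents_zero)
    qed (use f in \<open>simp_all add: mult_closed_P one_closed_P\<close>)
  qed (auto intro: mult_closed_P one_closed_P mult_assoc_P mult_comm_P)
  fix f g h assume fgh: "f \<in> carrier P" "g \<in> carrier P" "h \<in> carrier P"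
  show "(f \<oplus>\<^bsub>P\<^esub> g) \<otimes>\<^bsub>P\<^esub> h = f \<otimes>\<^bsub>P\<^esub> h \<oplus>\<^bsub>P\<^esub> g \<otimes>\<^bsub>P\<^esub> h"
  proof (rule P_eqI)
    fix c assume c: "c \<in> exponents n"
    have "((f \<oplus>\<^bsub>P\<^esub> g) \<otimes>\<^bsub>P\<^esub> h) c = (\<Oplus>a\<in>{a. a \<le> c}. f a \<otimes> h (c - a) \<oplus> g a \<otimes> h (c - a))"
      unfolding coeff_mult[OF c]
    proof (rule finsum_cong')
      fix a assume "a \<in> {a. a \<le> c}"
      then have "a \<in> exponents n" "c - a \<in> exponents n"
        using c by (auto intro: exponents_le exponents_diff)
      then show "(f \<oplus>\<^bsub>P\<^esub> g) a \<otimes> h (c - a) = f a \<otimes> h (c - a) \<oplus> g a \<otimes> h (c - a)"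
        using fgh by (simp add: coeff_add l_distr)
    qed (use fgh c mult_term_closed[of _ h c] in \<open>auto simp: Pi_def\<close>)
    also have "\<dots> = (f \<otimes>\<^bsub>P\<^esub> h \<oplus>\<^bsub>P\<^esub> g \<otimes>\<^bsub>P\<^esub> h) c"
      using fgh c mult_term_closed[of _ h c]
      by (simp add: coeff_add coeff_mult finsum_addf)
    finally show "((f \<oplus>\<^bsub>P\<^esub> g) \<otimes>\<^bsub>P\<^esub> h) c = (f \<otimes>\<^bsub>P\<^esub> h \<oplus>\<^bsub>P\<^esub> g \<otimes>\<^bsub>P\<^esub> h) c" .
  qed (use fgh in \<open>simp_all add: mult_closed_P add_closed_P\<close>)
qed

sublocale P: cring P
  by (rule cring_P)

lemma coeff_minus: "f \<in> carrier P \<Longrightarrow> a \<in> exponents n \<Longrightarrow> (\<ominus>\<^bsub>P\<^esub> f) a = \<ominus> f a"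
proof -
  assume f: "f \<in> carrier P" and a: "a \<in> exponents n"
  have "(f \<oplus>\<^bsub>P\<^esub> \<ominus>\<^bsub>P\<^esub> f) a = \<zero>" using f a by (simp add: P.r_neg coeff_zero)
  then have "f a \<oplus> (\<ominus>\<^bsub>P\<^esub> f) a = \<zero>" using a by (simp add: coeff_add)
  then show ?thesis using f a by (metis P.a_inv_closed a_comm coeff_closed minus_equality)
qed

lemma coeff_diff:
  "f \<in> carrier P \<Longrightarrow> g \<in> carrier P \<Longrightarrow> a \<in> exponents n \<Longrightarrow> (f \<ominus>\<^bsub>P\<^esub> g) a = f a \<ominus> g a"
  by (simp add: a_minus_def coeff_add coeff_minus)

lemma coeff_add_pow:
  "f \<in> carrier P \<Longrightarrow> a \<in> exponents n \<Longrightarrow> ([(m :: nat)] \<cdot>\<^bsub>P\<^esub> f) a = [m] \<cdot>\<^bsub>K\<^esub> f a"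
  by (induction m) (auto simp: coeff_zero coeff_add)

end

context coefficient_ring
begin

lemma restrict_closed:
  "(\<And>a. a \<in> exponents n \<Longrightarrow> h a \<in> carrier K) \<Longrightarrow> (\<lambda>a\<in>exponents n. h a) \<in> carrier P"
  by (simp add: carrier_P)

lemma supp_exponents: "supp f \<subseteq> exponents n"
  by (auto simp: supp_def)

lemma supp_add: "f \<in> carrier P \<Longrightarrow> g \<in> carrier P \<Longrightarrow> supp (f \<oplus>\<^bsub>P\<^esub> g) \<subseteq> supp f \<union> supp g"
  by (auto simp: supp_def coeff_add)

lemma supp_minus: "f \<in> carrier P \<Longrightarrow> supp (\<ominus>\<^bsub>P\<^esub> f) \<subseteq> supp f"
  by (auto simp: supp_def coeff_minus)

lemma coeff_mult_eq_zero:
  assumes "f \<in> carrier P" "g \<in> carrier P" "c \<in> exponents n"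
    and zero: "\<And>a. a \<le> c \<Longrightarrow> f a = \<zero> \<or> g (c - a) = \<zero>"
  shows "(f \<otimes>\<^bsub>P\<^esub> g) c = \<zero>"
  unfolding coeff_mult[OF assms(3)]
proof (rule add.finprod_one_eqI)
  fix a assume "a \<in> {a. a \<le> c}"
  then show "f a \<otimes> g (c - a) = \<zero>"
    using zero[of a] assms(1-3) exponents_le[of a c n] by (auto simp: exponents_diff)
qed

lemma supp_mult:
  assumes "f \<in> carrier P" "g \<in> carrier P"
  shows "supp (f \<otimes>\<^bsub>P\<^esub> g) \<subseteq> (\<lambda>(a, b). a + b) ` (supp f \<times> supp g)"
proof
  fix c assume "c \<in> supp (f \<otimes>\<^bsub>P\<^esub> g)"
  then have c: "c \<in> exponents n" "(f \<otimes>\<^bsub>P\<^esub> g) c \<noteq> \<zero>" by (auto simp: supp_def)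
  then obtain a where a: "a \<le> c" "f a \<noteq> \<zero>" "g (c - a) \<noteq> \<zero>"
    using coeff_mult_eq_zero[OF assms c(1)] by blast
  then show "c \<in> (\<lambda>(a, b). a + b) ` (supp f \<times> supp g)"
    using c(1) exponents_le[of a c n]
    by (intro image_eqI[of _ _ "(a, c - a)"]) (auto simp: supp_def add_diff_fun exponents_diff)
qed

lemma supp_monomial: "supp (monomial K n r) \<subseteq> {r}"
  by (auto simp: supp_def monomial_def)

lemma supp_zero: "supp \<zero>\<^bsub>P\<^esub> = {}"
  by (auto simp: supp_def coeff_zero)

lemma monomial_coeff: "a \<in> exponents n \<Longrightarrow> monomial K n r a = (if a = r then \<one> else \<zero>)"
  by (simp add: monomial_def)

lemma one_eq_monomial: "\<one>\<^bsub>P\<^esub> = monomial K n 0"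
  by (simp add: mpowser_ring_def zero_fun_def)

definition monom :: "(nat \<Rightarrow> nat) \<Rightarrow> 'a \<Rightarrow> (nat \<Rightarrow> nat) \<Rightarrow> 'a" where
  "monom r k = (\<lambda>a\<in>exponents n. if a = r then k else \<zero>)"

lemma monom_closed: "k \<in> carrier K \<Longrightarrow> monom r k \<in> carrier P"
  by (simp add: monom_def restrict_closed)

lemma monom_coeff: "a \<in> exponents n \<Longrightarrow> monom r k a = (if a = r then k else \<zero>)"
  by (simp add: monom_def)

text \<open>
  If \<open>A\<close> is the complement of the exponent set of a monomial ideal, \<open>mask A f\<close> is the canonical
  representative of \<open>f\<close> modulo that ideal.
\<close>

definition mask :: "(nat \<Rightarrow> nat) set \<Rightarrow> ((nat \<Rightarrow> nat) \<Rightarrow> 'a) \<Rightarrow> ((nat \<Rightarrow> nat) \<Rightarrow> 'a)" where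
  "mask A f = (\<lambda>a\<in>exponents n. if a \<in> A then f a else \<zero>)"

lemma mask_coeff: "a \<in> exponents n \<Longrightarrow> mask A f a = (if a \<in> A then f a else \<zero>)"
  by (simp add: mask_def)

lemma mask_closed_P: "f \<in> carrier P \<Longrightarrow> mask A f \<in> carrier P"
  by (auto simp: mask_def carrier_P)

lemma supp_mask: "supp (mask A f) = supp f \<inter> A"
  by (auto simp: supp_def mask_coeff split: if_splits)

lemma mask_add: "f \<in> carrier P \<Longrightarrow> g \<in> carrier P \<Longrightarrow> mask A (f \<oplus>\<^bsub>P\<^esub> g) = mask A f \<oplus>\<^bsub>P\<^esub> mask A g"
  by (rule P_eqI) (auto simp: mask_closed_P add_closed_P mask_coeff coeff_add)

lemma mask_mask: "mask A (mask B f) = mask (A \<inter> B) f"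
  by (auto simp: mask_def)

lemma mask_id: "f \<in> carrier P \<Longrightarrow> supp f \<subseteq> A \<Longrightarrow> mask A f = f"
  by (rule P_eqI) (auto simp: mask_closed_P mask_coeff supp_def)

end

text \<open>
  Polynomials and power series at once: \<open>\<F>\<close> is the class of allowed supports. Arguments that apply
  to both rings construct a series in \<open>carrier P\<close> and then bound its support by an allowed set.
\<close>

locale series_ring = coefficient_ring K n for K :: "('a, 'b) ring_scheme" (structure) and n :: nat +
  fixes S :: "((nat \<Rightarrow> nat) \<Rightarrow> 'a) ring" and \<F> :: "(nat \<Rightarrow> nat) set set"
  assumes S_eq: "S = P\<lparr>carrier := {f \<in> carrier P. supp f \<in> \<F>}\<rparr>"
    and allowed: "\<F> = UNIV \<or> \<F> = {A. finite A}"
begin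

lemma allowed_subset: "B \<in> \<F> \<Longrightarrow> A \<subseteq> B \<Longrightarrow> A \<in> \<F>"
  using allowed by (auto intro: finite_subset)

lemma allowed_Un: "A \<in> \<F> \<Longrightarrow> B \<in> \<F> \<Longrightarrow> A \<union> B \<in> \<F>"
  using allowed by auto

lemma allowed_finite: "finite A \<Longrightarrow> A \<in> \<F>"
  using allowed by auto

lemma allowed_image: "A \<in> \<F> \<Longrightarrow> h ` A \<in> \<F>"
  using allowed by auto

lemma allowed_image2: "A \<in> \<F> \<Longrightarrow> B \<in> \<F> \<Longrightarrow> h ` (A \<times> B) \<in> \<F>"
  using allowed by auto

lemma allowed_vimage: "A \<in> \<F> \<Longrightarrow> inj h \<Longrightarrow> h -` A \<in> \<F>"
  using allowed by (auto intro: finite_vimageI)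

lemma allowed_UN: "finite I \<Longrightarrow> (\<And>i. i \<in> I \<Longrightarrow> A i \<in> \<F>) \<Longrightarrow> (\<Union>i\<in>I. A i) \<in> \<F>"
  using allowed by auto

lemma carrier_S: "f \<in> carrier S \<longleftrightarrow> f \<in> carrier P \<and> supp f \<in> \<F>"
  by (simp add: S_eq)

lemma S_carrier_P [simp]: "f \<in> carrier S \<Longrightarrow> f \<in> carrier P"
  by (simp add: carrier_S)

lemma S_simps: "f \<oplus>\<^bsub>S\<^esub> g = f \<oplus>\<^bsub>P\<^esub> g" "f \<otimes>\<^bsub>S\<^esub> g = f \<otimes>\<^bsub>P\<^esub> g" "\<zero>\<^bsub>S\<^esub> = \<zero>\<^bsub>P\<^esub>" "\<one>\<^bsub>S\<^esub> = \<one>\<^bsub>P\<^esub>"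
  "f [^]\<^bsub>S\<^esub> (m :: nat) = f [^]\<^bsub>P\<^esub> m"
  unfolding S_eq nat_pow_def by simp_all

lemma S_closed_of_supp:
  "f \<in> carrier P \<Longrightarrow> supp f \<subseteq> A \<Longrightarrow> A \<in> \<F> \<Longrightarrow> f \<in> carrier S"
  using allowed_subset by (auto simp: carrier_S)

lemma mask_closed: "f \<in> carrier S \<Longrightarrow> mask A f \<in> carrier S"
  using allowed_subset[of "supp f" "supp f \<inter> A"] by (simp add: carrier_S mask_closed_P supp_mask)

lemma monomial_closed: "monomial K n r \<in> carrier S"
  by (rule S_closed_of_supp[OF monomial_closed_P supp_monomial]) (simp add: allowed_finite)

lemma cring_S: "cring S"
proof -
  have "subring {f \<in> carrier P. supp f \<in> \<F>} P"
  proof (rule P.subringI)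
    fix f g assume f: "f \<in> {f \<in> carrier P. supp f \<in> \<F>}" and g: "g \<in> {f \<in> carrier P. supp f \<in> \<F>}"
    show "\<ominus>\<^bsub>P\<^esub> f \<in> {f \<in> carrier P. supp f \<in> \<F>}"
      using f allowed_subset[OF _ supp_minus] by auto
    show "f \<oplus>\<^bsub>P\<^esub> g \<in> {f \<in> carrier P. supp f \<in> \<F>}"
      using f g allowed_subset[OF allowed_Un supp_add] by auto
    show "f \<otimes>\<^bsub>P\<^esub> g \<in> {f \<in> carrier P. supp f \<in> \<F>}"
      using f g allowed_subset[OF allowed_image2 supp_mult] by auto
  qed (use monomial_closed in \<open>auto simp: carrier_S one_eq_monomial\<close>)
  then have "subcring {f \<in> carrier P. supp f \<in> \<F>} P"
    by (intro P.subcringI) (auto simp: P.m_comm)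
  then show ?thesis
    unfolding S_eq by (rule P.subcring_iff[THEN iffD1, rotated]) auto
qed

sublocale S: cring S
  by (rule cring_S)

lemma S_eqI:
  "f \<in> carrier S \<Longrightarrow> g \<in> carrier S \<Longrightarrow> (\<And>a. a \<in> exponents n \<Longrightarrow> f a = g a) \<Longrightarrow> f = g"
  by (rule P_eqI) auto

lemma S_minus: "f \<in> carrier S \<Longrightarrow> \<ominus>\<^bsub>S\<^esub> f = \<ominus>\<^bsub>P\<^esub> f"
  by (metis P.minus_equality S.a_inv_closed S.l_neg S_carrier_P S_simps(1,3))

lemma S_diff: "f \<in> carrier S \<Longrightarrow> g \<in> carrier S \<Longrightarrow> f \<ominus>\<^bsub>S\<^esub> g = f \<ominus>\<^bsub>P\<^esub> g"
  by (simp add: a_minus_def S_minus S_simps)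

lemma coeff_finsum_S:
  assumes "finite A" "F \<in> A \<rightarrow> carrier S" "c \<in> exponents n"
  shows "(\<Oplus>\<^bsub>S\<^esub>i\<in>A. F i) c = (\<Oplus>i\<in>A. F i c)"
  using assms
  by (induction A rule: finite_induct) (auto simp: S_simps coeff_zero coeff_add Pi_def)

section \<open>Monomial ideals\<close>

text \<open>
  Upward closed sets of exponents are the exponent sets of monomial ideals; \<open>up G\<close> is the one
  generated by \<open>G\<close>.
\<close>

definition upset :: "(nat \<Rightarrow> nat) set \<Rightarrow> bool" where
  "upset D \<longleftrightarrow> D \<subseteq> exponents n \<and> (\<forall>a\<in>D. \<forall>c\<in>exponents n. a \<le> c \<longrightarrow> c \<in> D)"

definition up :: "(nat \<Rightarrow> nat) set \<Rightarrow> (nat \<Rightarrow> nat) set" where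
  "up G = {c \<in> exponents n. \<exists>r\<in>G. r \<le> c}"

definition supported :: "(nat \<Rightarrow> nat) set \<Rightarrow> ((nat \<Rightarrow> nat) \<Rightarrow> 'a) set" where
  "supported D = {f \<in> carrier S. supp f \<subseteq> D}"

lemma upset_up: "upset (up G)"
  by (auto simp: upset_def up_def intro: order_trans)

lemma supported_ideal:
  assumes "upset D"
  shows "ideal (supported D) S"
proof (rule idealI)
  show "ring S" by unfold_locales
  show "subgroup (supported D) (add_monoid S)"
  proof (rule S.add.subgroupI)
    show "supported D \<noteq> {}"
      using S.zero_closed by (auto simp: supported_def S_simps supp_zero)
    fix f g assume f: "f \<in> supported D" and g: "g \<in> supported D"
    show "\<ominus>\<^bsub>S\<^esub> f \<in> supported D"
      using f S_minus[of f] supp_minus[of f] S.a_inv_closed[of f] by (auto simp: supported_def)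
    show "f \<oplus>\<^bsub>S\<^esub> g \<in> supported D"
      using f g supp_add[of f g] S.a_closed[of f g] by (auto simp: supported_def S_simps)
  qed (auto simp: supported_def)
  fix f h assume f: "f \<in> supported D" and h: "h \<in> carrier S"
  have "supp (h \<otimes>\<^bsub>P\<^esub> f) \<subseteq> D"
  proof
    fix c assume c: "c \<in> supp (h \<otimes>\<^bsub>P\<^esub> f)"
    then obtain a b where "c = a + b" "b \<in> supp f"
      using supp_mult[of h f] f h by (auto simp: supported_def)
    then show "c \<in> D"
      using assms f c supp_exponents[of "h \<otimes>\<^bsub>P\<^esub> f"] le_add_fun(2)[of b a]
      by (auto simp: supported_def upset_def)
  qed
  then show *: "h \<otimes>\<^bsub>S\<^esub> f \<in> supported D"
    using f h S.m_closed[of h f] by (auto simp: supported_def S_simps)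
  then show "f \<otimes>\<^bsub>S\<^esub> h \<in> supported D"
    using f h by (simp add: S.m_comm supported_def)
qed

lemma monomial_mult_coeff:
  assumes "f \<in> carrier P" "c \<in> exponents n" "r \<in> exponents n"
  shows "(monomial K n r \<otimes>\<^bsub>P\<^esub> f) c = (if r \<le> c then f (c - r) else \<zero>)"
  using mult_single[OF monomial_closed_P assms(1,2), of r r] assms
  by (auto simp: monomial_coeff exponents_diff)

lemma monomial_factor:
  assumes f: "f \<in> carrier S" and r: "r \<in> exponents n" and supp: "supp f \<subseteq> up {r}"
  shows "\<exists>h\<in>carrier S. f = monomial K n r \<otimes>\<^bsub>S\<^esub> h"
proof -
  define h where "h = (\<lambda>b\<in>exponents n. f (b + r))"
  have hP: "h \<in> carrier P"
    using f r by (simp add: h_def restrict_closed exponents_add)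
  have "supp h \<subseteq> (\<lambda>b. b + r) -` supp f"
    using r by (auto simp: supp_def h_def exponents_add)
  moreover have "(\<lambda>b. b + r) -` supp f \<in> \<F>"
    using f by (intro allowed_vimage) (auto simp: carrier_S inj_on_def)
  ultimately have h: "h \<in> carrier S"
    using hP by (intro S_closed_of_supp)
  have "f = monomial K n r \<otimes>\<^bsub>S\<^esub> h"
  proof (rule S_eqI)
    fix c assume c: "c \<in> exponents n"
    show "f c = (monomial K n r \<otimes>\<^bsub>S\<^esub> h) c"
      using c r hP supp exponents_diff[OF c, of r]
      by (auto simp: S_simps monomial_mult_coeff h_def add_diff_fun supp_def up_def)
  qed (use f h monomial_closed in auto)
  then show ?thesis using h by blast
qed

text \<open>
  For the inclusion from right to left, one generator \<open>r\<close> is split off at a time: the terms of a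
  series with exponents above \<open>r\<close> have the common factor \<open>x\<^sup>r\<close>, and the remaining terms have
  exponents above one of the other generators. For power series this replaces the decomposition
  into monomials, which would be infinite.
\<close>

lemma genideal_monomials:
  assumes "finite G" "G \<subseteq> exponents n"
  shows "Idl\<^bsub>S\<^esub> (monomial K n ` G) = supported (up G)"
proof
  show "Idl\<^bsub>S\<^esub> (monomial K n ` G) \<subseteq> supported (up G)"
  proof (rule S.genideal_minimal[OF supported_ideal[OF upset_up]])
    show "monomial K n ` G \<subseteq> supported (up G)"
    proof
      fix f assume "f \<in> monomial K n ` G"
      then obtain r where "r \<in> G" "f = monomial K n r" by blast
      then show "f \<in> supported (up G)"
        using supp_monomial[of r] monomial_closed[of r] assms(2)
        by (auto simp: supported_def up_def)
    qed
  qed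
  show "supported (up G) \<subseteq> Idl\<^bsub>S\<^esub> (monomial K n ` G)"
    using assms
  proof (induction G rule: finite_induct)
    case empty
    have "f = \<zero>\<^bsub>S\<^esub>" if "f \<in> supported (up {})" for f
      using that S.zero_closed
      by (intro S_eqI) (auto simp: supported_def up_def supp_def S_simps coeff_zero)
    moreover have "\<zero>\<^bsub>S\<^esub> \<in> Idl\<^bsub>S\<^esub> {}"
      using S.genideal_ideal[of "{}"] by (simp add: additive_subgroup.zero_closed ideal.axioms(1))
    ultimately show ?case by auto
  next
    case (insert r G)
    let ?J = "Idl\<^bsub>S\<^esub> (monomial K n ` insert r G)"
    have sub: "monomial K n ` insert r G \<subseteq> carrier S"
      using monomial_closed by auto
    interpret J: ideal ?J S
      by (rule S.genideal_ideal[OF sub])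
    have J: "monomial K n ` insert r G \<subseteq> ?J"
      by (rule S.genideal_self[OF sub])
    have mono: "Idl\<^bsub>S\<^esub> (monomial K n ` G) \<subseteq> ?J"
      using J by (intro S.genideal_minimal J.ideal_axioms) auto
    show ?case
    proof
      fix f assume "f \<in> supported (up (insert r G))"
      then have f: "f \<in> carrier S" and sf: "supp f \<subseteq> up (insert r G)"
        by (auto simp: supported_def)
      have "mask (- up {r}) f \<in> supported (up G)"
        using f sf by (auto simp: supported_def mask_closed supp_mask up_def)
      then have 1: "mask (- up {r}) f \<in> ?J"
        using insert mono by auto
      obtain h where h: "h \<in> carrier S" "mask (up {r}) f = monomial K n r \<otimes>\<^bsub>S\<^esub> h"
        using monomial_factor[of "mask (up {r}) f" r] insert.prems f
        by (auto simp: mask_closed supp_mask)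
      have "monomial K n r \<in> ?J" using J by blast
      then have 2: "mask (up {r}) f \<in> ?J"
        unfolding h(2) by (rule J.I_r_closed[OF _ h(1)])
      have "f = mask (up {r}) f \<oplus>\<^bsub>S\<^esub> mask (- up {r}) f"
        using f by (intro S_eqI S.a_closed mask_closed) (auto simp: S_simps coeff_add mask_coeff)
      then show "f \<in> ?J"
        using J.a_closed[OF 2 1] by simp
    qed
  qed
qed

end

section \<open>Noetherianity\<close>

lemma (in ring_hom_ring) noetherian_image:
  assumes noeth: "noetherian_ring R" and surj: "h ` carrier R = carrier S"
  shows "noetherian_ring S"
proof (rule S.noetherian_ringI)
  fix J assume J: "ideal J S"
  interpret J: ideal J S by (rule J)
  let ?J' = "{r \<in> carrier R. h r \<in> J}"
  obtain A where A: "A \<subseteq> carrier R" "finite A" "?J' = Idl\<^bsub>R\<^esub> A"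
    using noetherian_ring.finetely_gen[OF noeth ideal_vimage[OF J]] by blast
  have AJ: "A \<subseteq> ?J'" using R.genideal_self[OF A(1)] A(3) by simp
  have hA: "h ` A \<subseteq> carrier S" using A(1) by auto
  have "J = Idl\<^bsub>S\<^esub> (h ` A)"
  proof
    show "Idl\<^bsub>S\<^esub> (h ` A) \<subseteq> J"
      using AJ by (intro S.genideal_minimal J) auto
    have "Idl\<^bsub>R\<^esub> A \<subseteq> {r \<in> carrier R. h r \<in> Idl\<^bsub>S\<^esub> (h ` A)}"
      using S.genideal_self[OF hA] A(1)
      by (intro R.genideal_minimal ideal_vimage S.genideal_ideal hA) auto
    moreover have "J \<subseteq> h ` ?J'"
    proof
      fix y assume y: "y \<in> J"
      then obtain r where "r \<in> carrier R" "y = h r" using J.a_subset surj by blast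
      then show "y \<in> h ` ?J'" using y by blast
    qed
    ultimately show "J \<subseteq> Idl\<^bsub>S\<^esub> (h ` A)"
      using A(3) by blast
  qed
  then show "\<exists>A\<subseteq>carrier S. finite A \<and> J = Idl\<^bsub>S\<^esub> A"
    using hA A(2) by blast
qed

locale field_series_ring = series_ring K n S \<F> + K?: field K
  for K :: "('a, 'b) ring_scheme" (structure) and n S \<F>
begin

lemma monom_closed_S: "k \<in> carrier K \<Longrightarrow> monom r k \<in> carrier S"
  by (rule S_closed_of_supp[of _ "{r}"])
     (auto simp: monom_closed monom_coeff supp_def allowed_finite split: if_splits)

lemma monom_mult_coeff:
  assumes "k \<in> carrier K" "f \<in> carrier S" "c \<in> exponents n" "r \<in> exponents n"
  shows "(monom r k \<otimes>\<^bsub>S\<^esub> f) c = (if r \<le> c then k \<otimes> f (c - r) else \<zero>)"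
  using mult_single[of "monom r k" f c r] assms
  by (auto simp: S_simps monom_closed monom_coeff)

lemma supp_nonempty:
  assumes "f \<in> carrier S" "f \<noteq> \<zero>\<^bsub>S\<^esub>"
  shows "supp f \<noteq> {}"
proof
  assume "supp f = {}"
  then have "f = \<zero>\<^bsub>S\<^esub>"
    using assms(1) S.zero_closed by (intro S_eqI) (auto simp: supp_def S_simps coeff_zero)
  then show False using assms(2) by simp
qed

text \<open>
  For any choice of leading exponents, Dickson's lemma provides finitely many elements of the ideal
  whose leading exponents generate those of all its elements.
\<close>

lemma lead_generators:
  assumes J: "ideal J S" and lead: "\<And>f. f \<in> J \<Longrightarrow> f \<noteq> \<zero>\<^bsub>S\<^esub> \<Longrightarrow> lead f \<in> supp f"
  obtains G where "finite G" and "G \<subseteq> J - {\<zero>\<^bsub>S\<^esub>}"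
    and "\<And>f. f \<in> J \<Longrightarrow> f \<noteq> \<zero>\<^bsub>S\<^esub> \<Longrightarrow> \<exists>g\<in>G. lead g \<le> lead f"
proof -
  let ?L = "lead ` (J - {\<zero>\<^bsub>S\<^esub>})"
  have "?L \<subseteq> exponents n" using lead supp_exponents by fastforce
  then obtain F where F: "finite F" "F \<subseteq> ?L" "\<And>x. x \<in> ?L \<Longrightarrow> \<exists>a\<in>F. a \<le> x"
    using dickson[of ?L n] by blast
  then obtain G where G: "finite G" "G \<subseteq> J - {\<zero>\<^bsub>S\<^esub>}" "F = lead ` G"
    using finite_subset_image[OF F(1,2)] by blast
  show ?thesis
  proof (rule that[OF G(1,2)])
    fix f assume "f \<in> J" "f \<noteq> \<zero>\<^bsub>S\<^esub>"
    then have "lead f \<in> ?L" by blast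
    then show "\<exists>g\<in>G. lead g \<le> lead f" using F(3) G(3) by blast
  qed
qed

lemma ideal_carrier: "ideal J S \<Longrightarrow> f \<in> J \<Longrightarrow> f \<in> carrier S"
  by (rule additive_subgroup.a_Hcarr[OF ideal.axioms(1)])

lemma ideal_diff_mult:
  assumes "ideal J S" "f \<in> J" "g \<in> J" "h \<in> carrier S"
  shows "f \<ominus>\<^bsub>S\<^esub> h \<otimes>\<^bsub>S\<^esub> g \<in> J"
proof -
  interpret ideal J S by fact
  show ?thesis
    using assms(2-4) by (simp add: a_minus_def I_l_closed a_closed a_inv_closed)
qed

lemma ideal_finsum:
  assumes J: "ideal J S" and "finite A" "\<And>a. a \<in> A \<Longrightarrow> F a \<in> J"
  shows "(\<Oplus>\<^bsub>S\<^esub>a\<in>A. F a) \<in> J"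
  using assms(2,3)
proof (induction A rule: finite_induct)
  case empty
  then show ?case using J by (simp add: additive_subgroup.zero_closed ideal.axioms(1))
next
  case (insert a A)
  then have "(\<Oplus>\<^bsub>S\<^esub>a\<in>insert a A. F a) = F a \<oplus>\<^bsub>S\<^esub> (\<Oplus>\<^bsub>S\<^esub>a\<in>A. F a)"
    using ideal_carrier[OF J] by (intro S.finsum_insert) auto
  then show ?case
    using insert J by (simp add: additive_subgroup.a_closed ideal.axioms(1))
qed

text \<open>
  Division algorithm: an exponent of largest weight in a polynomial of \<open>J\<close> is cancelled by a
  multiple of a generator, and all other exponents that this introduces have smaller weight.
\<close>

lemma poly_ideal_finitely_generated:
  assumes poly: "\<F> = {A. finite A}" and J: "ideal J S"
  shows "\<exists>A\<subseteq>carrier S. finite A \<and> J = Idl\<^bsub>S\<^esub> A"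
proof -
  interpret J: ideal J S by (rule J)
  define top where "top f a \<longleftrightarrow> a \<in> supp f \<and> (\<forall>b\<in>supp f. weight n b \<le> weight n a)" for f a
  define lead where "lead f = (SOME a. top f a)" for f
  have top: "top f (lead f)" if "f \<in> J" "f \<noteq> \<zero>\<^bsub>S\<^esub>" for f
  proof -
    have "finite (supp f)" "supp f \<noteq> {}"
      using that ideal_carrier[OF J] supp_nonempty poly by (auto simp: carrier_S)
    then have in_image: "Max (weight n ` supp f) \<in> weight n ` supp f"
      and le: "\<forall>b\<in>supp f. weight n b \<le> Max (weight n ` supp f)"
      by auto
    obtain a where "a \<in> supp f" "weight n a = Max (weight n ` supp f)"
      using in_image by (metis imageE)
    then have "\<exists>a. top f a" using le by (auto simp: top_def)
    then show ?thesis unfolding lead_def by (rule someI_ex)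
  qed
  obtain G where G: "finite G" "G \<subseteq> J - {\<zero>\<^bsub>S\<^esub>}"
    "\<And>f. f \<in> J \<Longrightarrow> f \<noteq> \<zero>\<^bsub>S\<^esub> \<Longrightarrow> \<exists>g\<in>G. lead g \<le> lead f"
    using lead_generators[OF J, of lead] top by (auto simp: top_def)
  have GS: "G \<subseteq> carrier S" using G(2) J.a_subset by blast
  interpret I: ideal "Idl\<^bsub>S\<^esub> G" S by (rule S.genideal_ideal[OF GS])
  have "f \<in> Idl\<^bsub>S\<^esub> G" if "f \<in> J" "\<forall>a\<in>supp f. weight n a < m" for f m
    using that
  proof (induction m arbitrary: f)
    case 0
    then have "supp f = {}" by auto
    then have "f = \<zero>\<^bsub>S\<^esub>" using supp_nonempty[OF ideal_carrier[OF J 0(1)]] by blast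
    then show ?case by simp
  next
    case (Suc m)
    have f: "f \<in> carrier S" using Suc.prems ideal_carrier[OF J] by blast
    show ?case
    proof (cases "f = \<zero>\<^bsub>S\<^esub>")
      case False
      obtain g where g: "g \<in> G" "lead g \<le> lead f" using G(3) Suc.prems(1) False by blast
      have gJ: "g \<in> J" "g \<noteq> \<zero>\<^bsub>S\<^esub>" and gS: "g \<in> carrier S" using g(1) G(2) GS by auto
      define a where "a = lead f"
      define b where "b = a - lead g"
      define k where "k = f a \<otimes> inv (g (lead g))"
      have topf: "a \<in> supp f" "\<And>c. c \<in> supp f \<Longrightarrow> weight n c \<le> weight n a"
        using top[OF Suc.prems(1) False] by (auto simp: top_def a_def)
      have topg: "lead g \<in> supp g" "\<And>c. c \<in> supp g \<Longrightarrow> weight n c \<le> weight n (lead g)"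
        using top[OF gJ] by (auto simp: top_def)
      have exps: "a \<in> exponents n" "lead g \<in> exponents n" "b \<in> exponents n" "b + lead g = a"
        using topf(1) topg(1) g(2) exponents_diff[of a n "lead g"]
        by (auto simp: b_def a_def add_diff_fun supp_def)
      have unit: "g (lead g) \<in> Units K"
        using topg(1) gS exps by (auto simp: field_Units supp_def)
      have k: "k \<in> carrier K" using unit f exps by (simp add: k_def)
      define f' where "f' = f \<ominus>\<^bsub>S\<^esub> monom b k \<otimes>\<^bsub>S\<^esub> g"
      have f'J: "f' \<in> J"
        unfolding f'_def by (intro ideal_diff_mult J Suc.prems gJ monom_closed_S k)
      have f'_coeff: "f' c = f c \<ominus> (if b \<le> c then k \<otimes> g (c - b) else \<zero>)" if "c \<in> exponents n" for c
        using that f gS k monom_closed_S[OF k, of b] exps S.m_closed[OF monom_closed_S[OF k, of b] gS]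
        by (simp add: f'_def S_diff coeff_diff monom_mult_coeff)
      have ab: "a - b = lead g" "b \<le> a" using exps(4) by (auto simp: le_fun_def)
      have "f' a = \<zero>"
        using unit f gS exps by (simp add: f'_coeff ab k_def m_assoc r_right_minus_eq)
      have "weight n c < m" if c: "c \<in> supp f'" for c
      proof -
        have cE: "c \<in> exponents n" and nz: "f' c \<noteq> \<zero>" using c by (auto simp: supp_def)
        have "c \<in> supp f \<or> (b \<le> c \<and> c - b \<in> supp g)"
          using nz cE f k gS exponents_diff[OF cE, of b]
          by (auto simp: f'_coeff supp_def split: if_splits)
        then have le: "weight n c \<le> weight n a"
        proof
          assume "b \<le> c \<and> c - b \<in> supp g"
          then have "weight n ((c - b) + b) \<le> weight n (lead g + b)"
            using topg(2) by (simp add: weight_add)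
          then show ?thesis using \<open>b \<le> c \<and> c - b \<in> supp g\<close> exps(4) by (simp add: add_diff_fun add.commute)
        qed (rule topf(2))
        have "c \<noteq> a" using \<open>f' a = \<zero>\<close> nz by blast
        then have "weight n c \<noteq> weight n a"
          using inj_on_weight[of n] cE exps(1) by (auto dest: inj_onD)
        moreover have "weight n a < Suc m" using Suc.prems(2) topf(1) by blast
        ultimately show ?thesis using le by simp
      qed
      then have "f' \<in> Idl\<^bsub>S\<^esub> G" using Suc.IH[OF f'J] by blast
      moreover have "monom b k \<otimes>\<^bsub>S\<^esub> g \<in> Idl\<^bsub>S\<^esub> G"
        using S.genideal_self[OF GS] g(1) by (intro I.I_l_closed monom_closed_S k) auto
      moreover have "f = f' \<oplus>\<^bsub>S\<^esub> monom b k \<otimes>\<^bsub>S\<^esub> g"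
        using f gS monom_closed_S[OF k] by (simp add: f'_def a_minus_def S.a_assoc S.l_neg)
      ultimately show ?thesis using I.a_closed by metis
    qed simp
  qed
  moreover have "\<exists>m. \<forall>a\<in>supp f. weight n a < m" if "f \<in> J" for f
  proof -
    have "finite (weight n ` supp f)"
      using that ideal_carrier[OF J] poly by (auto simp: carrier_S)
    then obtain m where "\<forall>w\<in>weight n ` supp f. w < m"
      by (auto simp: finite_nat_set_iff_bounded)
    then show ?thesis by auto
  qed
  ultimately have "J \<subseteq> Idl\<^bsub>S\<^esub> G" by blast
  moreover have "Idl\<^bsub>S\<^esub> G \<subseteq> J" using G(2) by (intro S.genideal_minimal J) auto
  ultimately show ?thesis using G(1) GS by blast
qed

text \<open>
  Here exponents of smallest weight lead. Division does not stop, so the quotients are obtained by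
  recursion on the weight: \<open>u d\<close> is the coefficient of the multiple of the generator \<open>\<gamma> d\<close> that
  cancels exponent \<open>d\<close>, and what has to be cancelled there depends only on the values of \<open>u\<close> at
  exponents of smaller weight. The remainder belongs to \<open>J\<close> but vanishes at every possible lowest
  exponent of an element of \<open>J\<close>, so it is zero.
\<close>

lemma powser_ideal_finitely_generated:
  assumes powser: "\<F> = UNIV" and J: "ideal J S"
  shows "\<exists>A\<subseteq>carrier S. finite A \<and> J = Idl\<^bsub>S\<^esub> A"
proof -
  interpret J: ideal J S by (rule J)
  define low where "low f a \<longleftrightarrow> a \<in> supp f \<and> (\<forall>b\<in>supp f. weight n a \<le> weight n b)" for f a
  define lead where "lead f = (SOME a. low f a)" for f
  have low: "low f (lead f)" if f: "f \<in> J" "f \<noteq> \<zero>\<^bsub>S\<^esub>" for f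
  proof -
    obtain a where "a \<in> supp f" using supp_nonempty[OF ideal_carrier[OF J f(1)] f(2)] by blast
    then have "low f (arg_min (weight n) (\<lambda>a. a \<in> supp f))"
      unfolding low_def using arg_min_natI[of "\<lambda>a. a \<in> supp f"] arg_min_nat_le[of "\<lambda>a. a \<in> supp f"] by blast
    then show ?thesis unfolding lead_def by (rule someI[of "low f"])
  qed
  obtain G where G: "finite G" "G \<subseteq> J - {\<zero>\<^bsub>S\<^esub>}"
    "\<And>f. f \<in> J \<Longrightarrow> f \<noteq> \<zero>\<^bsub>S\<^esub> \<Longrightarrow> \<exists>g\<in>G. lead g \<le> lead f"
    using lead_generators[OF J, of lead] low by (auto simp: low_def)
  have GS: "G \<subseteq> carrier S" using G(2) J.a_subset by blast
  interpret I: ideal "Idl\<^bsub>S\<^esub> G" S by (rule S.genideal_ideal[OF GS])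
  have lowg: "lead g \<in> exponents n" "g (lead g) \<in> Units K"
    "\<And>c. c \<in> exponents n \<Longrightarrow> weight n c < weight n (lead g) \<Longrightarrow> g c = \<zero>" if "g \<in> G" for g
  proof -
    have g: "low g (lead g)" "g \<in> carrier S" using that G(2) GS low[of g] by auto
    then show "lead g \<in> exponents n" "g (lead g) \<in> Units K"
      by (auto simp: low_def supp_def field_Units)
    show "g c = \<zero>" if "c \<in> exponents n" "weight n c < weight n (lead g)" for c
      using g(1) that by (force simp: low_def supp_def)
  qed
  define U where "U = up (lead ` G)"
  have "\<exists>\<gamma>. \<forall>d\<in>U. \<gamma> d \<in> G \<and> lead (\<gamma> d) \<le> d"
    by (intro bchoice) (auto simp: U_def up_def)
  then obtain \<gamma> where \<gamma>: "\<And>d. d \<in> U \<Longrightarrow> \<gamma> d \<in> G" "\<And>d. d \<in> U \<Longrightarrow> lead (\<gamma> d) \<le> d" by blast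
  have UE: "d \<in> exponents n" if "d \<in> U" for d using that by (auto simp: U_def up_def)
  have addU: "b + lead g \<in> U" if "g \<in> G" "b \<in> exponents n" for b g
    using that lowg(1) by (auto simp: U_def up_def exponents_add intro!: bexI[of _ g] le_add_fun)
  have "f \<in> Idl\<^bsub>S\<^esub> G" if fJ: "f \<in> J" for f
  proof -
    have f: "f \<in> carrier S" using fJ ideal_carrier[OF J] by blast
    define F where "F u d =
      (f d \<ominus> finsum K (\<lambda>(g, b). if weight n (b + lead g) < weight n d \<and> \<gamma> (b + lead g) = g
                                then u (b + lead g) \<otimes> g (d - b) else \<zero>) (G \<times> {b. b \<le> d}))
       \<otimes> inv (\<gamma> d (lead (\<gamma> d)))" for u d
    define u where "u = wfrec (Wellfounded.measure (weight n)) F"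
    have "adm_wf (Wellfounded.measure (weight n)) F"
      unfolding adm_wf_def F_def
      by (intro allI impI arg_cong[where f = "\<lambda>s. (f _ \<ominus> s) \<otimes> inv _"]
            arg_cong[where f = "\<lambda>s. finsum K s _"]) (auto simp: fun_eq_iff)
    then have u_eq: "u d = F u d" for d
      unfolding u_def using wfrec_fixpoint[of "Wellfounded.measure (weight n)" F] wf_measure by metis
    have u_closed: "u d \<in> carrier K" if "d \<in> U" for d
      using that
    proof (induction "weight n d" arbitrary: d rule: less_induct)
      case less
      have dE: "d \<in> exponents n" using UE less.prems by blast
      have "(\<lambda>(g, b). if weight n (b + lead g) < weight n d \<and> \<gamma> (b + lead g) = g
           then u (b + lead g) \<otimes> g (d - b) else \<zero>) \<in> G \<times> {b. b \<le> d} \<rightarrow> carrier K"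
        using less.hyps addU GS dE exponents_le[of _ d n] by (auto simp: exponents_diff subset_iff)
      then show ?case
        using f dE lowg(2)[OF \<gamma>(1)[OF less.prems]]
        by (subst u_eq) (auto simp: F_def finsum_closed)
    qed
    define h where "h g = (\<lambda>b\<in>exponents n. if \<gamma> (b + lead g) = g then u (b + lead g) else \<zero>)" for g
    have h: "h g \<in> carrier S" if "g \<in> G" for g
      using that addU u_closed powser by (auto simp: carrier_S h_def intro!: restrict_closed)
    have hg: "h g \<otimes>\<^bsub>S\<^esub> g \<in> carrier S" if "g \<in> G" for g
      using that h GS by auto
    define s where "s = (\<Oplus>\<^bsub>S\<^esub>g\<in>G. h g \<otimes>\<^bsub>S\<^esub> g)"
    have s: "s \<in> carrier S" unfolding s_def using hg by (intro S.finsum_closed) auto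
    have s_coeff: "s d = f d" if dU: "d \<in> U" for d
    proof -
      have dE: "d \<in> exponents n" using UE dU by blast
      let ?A = "G \<times> {b. b \<le> d}"
      \<comment> \<open>\<open>?T1\<close> collects the terms subtracted in the recursion. The only other nonzero term, \<open>?T2\<close>,
          is \<open>u d\<close> times the lowest coefficient of \<open>\<gamma> d\<close>: if \<open>b + lead g\<close> has larger weight than \<open>d\<close>,
          then \<open>d - b\<close> has smaller weight than \<open>lead g\<close>, so \<open>g\<close> vanishes at \<open>d - b\<close>.\<close>
      let ?T = "\<lambda>(g, b). h g b \<otimes> g (d - b)"
      let ?T1 = "\<lambda>(g, b). if weight n (b + lead g) < weight n d \<and> \<gamma> (b + lead g) = g
           then u (b + lead g) \<otimes> g (d - b) else \<zero>"
      let ?T2 = "\<lambda>(g, b). if b + lead g = d then h g b \<otimes> g (d - b) else \<zero>"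
      have fin: "finite {b. b \<le> d}" by (rule finite_exponents_le[OF dE])
      have exp: "b \<in> exponents n" "d - b \<in> exponents n" if "b \<le> d" for b
        using exponents_le[OF that dE] exponents_diff[OF dE] by auto
      have hK: "h g b \<in> carrier K" "g b \<in> carrier K" if "g \<in> G" "b \<in> exponents n" for g b
        using h GS that by auto
      have T1: "?T1 \<in> ?A \<rightarrow> carrier K" using hK exp addU u_closed by auto
      have T2: "?T2 \<in> ?A \<rightarrow> carrier K" using hK exp by auto
      have "s d = (\<Oplus>g\<in>G. (h g \<otimes>\<^bsub>S\<^esub> g) d)"
        unfolding s_def using hg G(1) dE by (intro coeff_finsum_S) auto
      also have "\<dots> = (\<Oplus>g\<in>G. \<Oplus>b\<in>{b. b \<le> d}. h g b \<otimes> g (d - b))"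
        using dE hK exp by (intro finsum_cong') (auto simp: S_simps coeff_mult intro!: finsum_closed)
      also have "\<dots> = finsum K ?T ?A"
        using G(1) fin hK exp by (intro finsum_Sigma) auto
      also have "\<dots> = (\<Oplus>x\<in>?A. ?T1 x \<oplus> ?T2 x)"
      proof (rule finsum_cong'[OF refl])
        show "(\<lambda>x. ?T1 x \<oplus> ?T2 x) \<in> ?A \<rightarrow> carrier K" using T1 T2 by blast
        fix x assume "x \<in> ?A"
        then obtain g b where x: "x = (g, b)" "g \<in> G" "b \<le> d" by auto
        consider "weight n (b + lead g) < weight n d" | "b + lead g = d"
          | "weight n d < weight n (b + lead g)"
          using inj_on_weight[of n] exp[OF x(3)] lowg(1)[OF x(2)] dE
          by (metis exponents_add inj_on_eq_iff linorder_neqE_nat)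
        then show "?T x = ?T1 x \<oplus> ?T2 x"
        proof cases
          case 1
          then show ?thesis using x exp hK addU u_closed by (auto simp: h_def)
        next
          case 2
          then show ?thesis using x exp hK by auto
        next
          case 3
          have "weight n (b + (d - b)) < weight n (b + lead g)" using 3 x(3) by (simp add: add_diff_fun)
          then have "weight n (d - b) < weight n (lead g)" using weight_pos[of n b] by (simp add: weight_add)
          then have "g (d - b) = \<zero>" using lowg(3)[OF x(2)] exp[OF x(3)] by blast
          then show ?thesis using 3 x exp hK by auto
        qed
      qed
      also have "\<dots> = finsum K ?T1 ?A \<oplus> finsum K ?T2 ?A"
        using T1 T2 by (rule finsum_addf)
      also have "finsum K ?T2 ?A = finsum K ?T2 {(\<gamma> d, d - lead (\<gamma> d))}"
      proof (rule finsum_mono_neutral)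
        show "finite ?A" using G(1) fin by simp
        show sub: "{(\<gamma> d, d - lead (\<gamma> d))} \<subseteq> ?A" using \<gamma>[OF dU] by (simp add: diff_le_fun)
        show "?T2 \<in> {(\<gamma> d, d - lead (\<gamma> d))} \<rightarrow> carrier K" using T2 sub by blast
        fix x assume x: "x \<in> ?A - {(\<gamma> d, d - lead (\<gamma> d))}"
        then obtain g b where gb: "x = (g, b)" "g \<in> G" "b \<le> d" by auto
        show "?T2 x = \<zero>"
        proof (cases "b + lead g = d")
          case True
          then have "b = d - lead g" by (metis add_diff_cancel_right')
          then have "g \<noteq> \<gamma> d" using x gb by auto
          then show ?thesis using gb exp hK True by (auto simp: h_def)
        qed (simp add: gb)
      qed
      also have "\<dots> = u d \<otimes> \<gamma> d (lead (\<gamma> d))"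
      proof -
        have "d - (d - lead (\<gamma> d)) = lead (\<gamma> d)" "d - lead (\<gamma> d) + lead (\<gamma> d) = d"
          using \<gamma>(2)[OF dU] by (auto simp: le_fun_def fun_eq_iff)
        then show ?thesis
          using exponents_diff[OF dE] u_closed[OF dU] hK(2)[OF \<gamma>(1)[OF dU] lowg(1)[OF \<gamma>(1)[OF dU]]]
          by (simp add: h_def Pi_def)
      qed
      also have "u d \<otimes> \<gamma> d (lead (\<gamma> d)) = f d \<ominus> finsum K ?T1 ?A"
      proof -
        have "finsum K ?T1 ?A \<in> carrier K" using T1 by (rule finsum_closed)
        then show ?thesis
          using lowg(2)[OF \<gamma>(1)[OF dU]] f dE
          by (subst u_eq) (simp add: F_def m_assoc Units_closed)
      qed
      also have "finsum K ?T1 ?A \<oplus> (f d \<ominus> finsum K ?T1 ?A) = f d"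
        using finsum_closed[OF T1] f dE by (simp add: add_minus_cancel)
      finally show ?thesis .
    qed
    have sI: "s \<in> Idl\<^bsub>S\<^esub> G"
      unfolding s_def
      using G(1) S.genideal_self[OF GS] h
      by (intro ideal_finsum[OF I.ideal_axioms]) (auto intro: I.I_l_closed)
    have sJ: "s \<in> J" using sI S.genideal_minimal[OF J, of G] G(2) by blast
    have "f \<ominus>\<^bsub>S\<^esub> s = \<zero>\<^bsub>S\<^esub>"
    proof (rule ccontr)
      assume nz: "f \<ominus>\<^bsub>S\<^esub> s \<noteq> \<zero>\<^bsub>S\<^esub>"
      have inJ: "f \<ominus>\<^bsub>S\<^esub> s \<in> J"
        using fJ sJ by (simp add: a_minus_def J.a_closed J.a_inv_closed)
      let ?d = "lead (f \<ominus>\<^bsub>S\<^esub> s)"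
      have d: "?d \<in> exponents n" "(f \<ominus>\<^bsub>S\<^esub> s) ?d \<noteq> \<zero>"
        using low[OF inJ nz] by (auto simp: low_def supp_def)
      then have "?d \<in> U" using G(3)[OF inJ nz] by (auto simp: U_def up_def)
      then have "(f \<ominus>\<^bsub>S\<^esub> s) ?d = \<zero>"
        using d(1) f s by (simp add: S_diff coeff_diff s_coeff r_right_minus_eq)
      then show False using d(2) by simp
    qed
    then have "f = s" using f s by (simp add: S.r_right_minus_eq)
    then show ?thesis using sI by simp
  qed
  then have "J \<subseteq> Idl\<^bsub>S\<^esub> G" by blast
  moreover have "Idl\<^bsub>S\<^esub> G \<subseteq> J" using G(2) by (intro S.genideal_minimal J) auto
  ultimately show ?thesis using G(1) GS by blast
qed

lemma noetherian_S: "noetherian_ring S"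
  using allowed poly_ideal_finitely_generated powser_ideal_finitely_generated
  by (intro S.noetherian_ringI) blast

end

section \<open>Powers of power series in characteristic p\<close>

context coefficient_ring
begin

abbreviation scale :: "nat \<Rightarrow> (nat \<Rightarrow> nat) \<Rightarrow> nat \<Rightarrow> nat" where
  "scale q b \<equiv> (\<lambda>i. q * b i)"

lemma scale_exponents: "b \<in> exponents n \<Longrightarrow> scale q b \<in> exponents n"
  by (simp add: exponents_def)

lemma monom_mult:
  assumes "k \<in> carrier K" "l \<in> carrier K" "r \<in> exponents n" "s \<in> exponents n"
  shows "monom r k \<otimes>\<^bsub>P\<^esub> monom s l = monom (r + s) (k \<otimes> l)"
proof (rule P_eqI)
  fix c assume c: "c \<in> exponents n"
  have "r \<le> c \<and> c - r = s \<longleftrightarrow> c = r + s"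
    using add_diff_fun(1)[of r c] le_add_fun(1)[of r s] by auto
  then show "(monom r k \<otimes>\<^bsub>P\<^esub> monom s l) c = monom (r + s) (k \<otimes> l) c"
    using assms c exponents_diff[OF c, of r]
    by (subst mult_single[where r = r]) (auto simp: monom_closed monom_coeff)
qed (use assms in \<open>simp_all add: monom_closed\<close>)

lemma monom_pow:
  assumes "k \<in> carrier K" "r \<in> exponents n"
  shows "monom r k [^]\<^bsub>P\<^esub> (m :: nat) = monom (scale m r) (k [^] m)"
proof (induction m)
  case 0
  have "(\<lambda>i. 0) = (0 :: nat \<Rightarrow> nat)" by (simp add: zero_fun_def)
  then show ?case by (auto intro!: P_eqI simp: monom_closed monom_coeff coeff_one)
next
  case (Suc m)
  have "scale m r + r = scale (Suc m) r" by (auto simp: fun_eq_iff)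
  then show ?case
    using Suc assms by (simp add: monom_mult scale_exponents del: mult_Suc)
qed

lemma char_P: "[(p :: nat)] \<cdot>\<^bsub>K\<^esub> \<one> = \<zero> \<Longrightarrow> [p] \<cdot>\<^bsub>P\<^esub> \<one>\<^bsub>P\<^esub> = \<zero>\<^bsub>P\<^esub>"
  by (rule P_eqI) (auto simp: coeff_add_pow coeff_zero coeff_one)

definition pow_coeffs :: "nat \<Rightarrow> ((nat \<Rightarrow> nat) \<Rightarrow> 'a) \<Rightarrow> bool" where
  "pow_coeffs q h \<longleftrightarrow>
    (\<forall>b\<in>exponents n. (h [^]\<^bsub>P\<^esub> q) (scale q b) = h b [^] q) \<and>
    (\<forall>c\<in>exponents n. c \<notin> scale q ` exponents n \<longrightarrow> (h [^]\<^bsub>P\<^esub> q) c = \<zero>)"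

lemma scale_inj: "q > 0 \<Longrightarrow> scale q a = scale q b \<longleftrightarrow> a = b"
  by (auto simp: fun_eq_iff)

lemma pow_coeffs_monom:
  assumes "k \<in> carrier K" "r \<in> exponents n" "q > 0"
  shows "pow_coeffs q (monom r k)"
  using assms
  by (auto simp: pow_coeffs_def monom_pow monom_coeff scale_exponents scale_inj nat_pow_zero)

context
  fixes p e q :: nat
  assumes p: "Factorial_Ring.prime p" and char: "[p] \<cdot>\<^bsub>K\<^esub> \<one> = \<zero>" and q: "q = p ^ e"
begin

lemma q_pos: "q > 0"
  using p prime_gt_0_nat by (simp add: q)

lemma pow_coeffs_add:
  assumes "f \<in> carrier P" "g \<in> carrier P" "pow_coeffs q f" "pow_coeffs q g"
  shows "pow_coeffs q (f \<oplus>\<^bsub>P\<^esub> g)"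
  using assms P.frobenius_add[OF p char_P[OF char], of f g e] frobenius_add[OF p char, of _ _ e]
  by (auto simp: pow_coeffs_def q[symmetric] coeff_add scale_exponents)

lemma pow_coeffs_finite:
  assumes h: "h \<in> carrier P" and A: "finite A" "A \<subseteq> exponents n"
  shows "pow_coeffs q (mask A h)"
  using A
proof (induction A rule: finite_induct)
  case empty
  have "mask {} h = monom 0 \<zero>"
    unfolding mask_def monom_def by auto
  then show ?case using q_pos by (simp add: pow_coeffs_monom exponents_zero)
next
  case (insert a A)
  have "mask (insert a A) h = mask A h \<oplus>\<^bsub>P\<^esub> monom a (h a)"
    using insert h
    by (intro P_eqI) (auto simp: mask_closed_P add_closed_P monom_closed mask_coeff coeff_add monom_coeff)
  then show ?case
    using insert h q_pos by (simp add: pow_coeffs_add pow_coeffs_monom mask_closed_P monom_closed)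
qed

text \<open>
  Additivity of the Frobenius map only handles finite sums of monomials. The coefficient of a power
  at \<open>c\<close>, however, does not see the terms of \<open>h\<close> with exponents outside the finite set of
  exponents below \<open>c\<close>.
\<close>

lemma pow_coeffs_local:
  assumes h: "h \<in> carrier P" and c: "c \<in> exponents n"
  shows "(h [^]\<^bsub>P\<^esub> q) c = (mask {a. a \<le> c} h [^]\<^bsub>P\<^esub> q) c"
proof -
  let ?A = "{a. a \<le> c}"
  have hh: "mask ?A h \<in> carrier P" "mask (- ?A) h \<in> carrier P"
    using h by (auto simp: mask_closed_P)
  obtain m where m: "q = Suc m" using q_pos by (cases q) auto
  have zero: "(mask (- ?A) h [^]\<^bsub>P\<^esub> q) c = \<zero>"
    unfolding m P.nat_pow_Suc
  proof (rule coeff_mult_eq_zero)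
    fix a assume "a \<le> c"
    then have "mask (- ?A) h (c - a) = \<zero>"
      using c by (simp add: mask_coeff exponents_diff diff_le_fun)
    then show "(mask (- ?A) h [^]\<^bsub>P\<^esub> m) a = \<zero> \<or> mask (- ?A) h (c - a) = \<zero>" by blast
  qed (use hh c in auto)
  have "h = mask ?A h \<oplus>\<^bsub>P\<^esub> mask (- ?A) h"
    using h hh by (intro P_eqI) (auto simp: mask_coeff coeff_add)
  then have "h [^]\<^bsub>P\<^esub> q = mask ?A h [^]\<^bsub>P\<^esub> q \<oplus>\<^bsub>P\<^esub> mask (- ?A) h [^]\<^bsub>P\<^esub> q"
    using P.frobenius_add[OF p char_P[OF char] hh, of e] by (simp add: q)
  then show ?thesis using zero hh c by (simp add: coeff_add)
qed

theorem coeff_frobenius: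
  assumes h: "h \<in> carrier P"
  shows "b \<in> exponents n \<Longrightarrow> (h [^]\<^bsub>P\<^esub> q) (scale q b) = h b [^] q"
    and "c \<in> exponents n \<Longrightarrow> c \<notin> scale q ` exponents n \<Longrightarrow> (h [^]\<^bsub>P\<^esub> q) c = \<zero>"
proof -
  have fin: "pow_coeffs q (mask {a. a \<le> c} h)" if "c \<in> exponents n" for c
    using that h finite_exponents_le[OF that] exponents_le[of _ c n]
    by (intro pow_coeffs_finite) auto
  show "(h [^]\<^bsub>P\<^esub> q) (scale q b) = h b [^] q" if b: "b \<in> exponents n"
  proof -
    have "b \<le> scale q b" using q_pos by (simp add: le_fun_def)
    then show ?thesis
      using fin[OF scale_exponents[OF b, of q]] b
      by (subst pow_coeffs_local[OF h]) (auto simp: pow_coeffs_def mask_coeff scale_exponents)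
  qed
  show "(h [^]\<^bsub>P\<^esub> q) c = \<zero>" if "c \<in> exponents n" "c \<notin> scale q ` exponents n"
    using fin[OF that(1)] that by (subst pow_coeffs_local[OF h]) (auto simp: pow_coeffs_def)
qed

end

end

section \<open>Bases over the subfield of q-th powers\<close>

context cring
begin

text \<open>
  A family \<open>\<beta>\<close> over a finite set \<open>B\<close> is a basis of \<open>R\<close> over its subring of \<open>q\<close>-th powers when every
  element is \<open>\<Sum>\<^sub>b \<beta> b \<cdot> (c b)\<^sup>q\<close> for exactly one \<open>c\<close>. Recording \<open>c b\<close> rather than the scalar \<open>(c b)\<^sup>q\<close>
  makes the coordinates additive in characteristic \<open>p\<close>, with \<open>coords (k\<^sup>q x) b = k \<cdot> coords x b\<close>, which is exactly linearity
  on the push-forward.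
\<close>

definition frobenius_comb :: "nat \<Rightarrow> 'i set \<Rightarrow> ('i \<Rightarrow> 'a) \<Rightarrow> ('i \<Rightarrow> 'a) \<Rightarrow> 'a" where
  "frobenius_comb q B \<beta> c = (\<Oplus>b\<in>B. \<beta> b \<otimes> c b [^] q)"

definition frobenius_basis :: "nat \<Rightarrow> 'i set \<Rightarrow> ('i \<Rightarrow> 'a) \<Rightarrow> bool" where
  "frobenius_basis q B \<beta> \<longleftrightarrow> finite B \<and> \<beta> \<in> B \<rightarrow> carrier R \<and>
    bij_betw (frobenius_comb q B \<beta>) (B \<rightarrow>\<^sub>E carrier R) (carrier R)"

lemma frobenius_comb_cong:
  assumes "\<beta> \<in> B \<rightarrow> carrier R" "d \<in> B \<rightarrow> carrier R" "\<And>b. b \<in> B \<Longrightarrow> c b = d b"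
  shows "frobenius_comb q B \<beta> c = frobenius_comb q B \<beta> d"
  unfolding frobenius_comb_def using assms by (intro finsum_cong') (auto simp: Pi_def)

lemma frobenius_comb_closed:
  assumes "\<beta> \<in> B \<rightarrow> carrier R" "d \<in> B \<rightarrow> carrier R"
  shows "frobenius_comb q B \<beta> d \<in> carrier R"
  unfolding frobenius_comb_def using assms by (intro finsum_closed) (auto simp: Pi_def)

definition coords :: "nat \<Rightarrow> 'i set \<Rightarrow> ('i \<Rightarrow> 'a) \<Rightarrow> 'a \<Rightarrow> 'i \<Rightarrow> 'a" where
  "coords q B \<beta> = the_inv_into (B \<rightarrow>\<^sub>E carrier R) (frobenius_comb q B \<beta>)"

context
  fixes q B \<beta>
  assumes basis: "frobenius_basis q B \<beta>"
begin

lemma basisD: "finite B" "\<beta> \<in> B \<rightarrow> carrier R"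
  "inj_on (frobenius_comb q B \<beta>) (B \<rightarrow>\<^sub>E carrier R)"
  "frobenius_comb q B \<beta> ` (B \<rightarrow>\<^sub>E carrier R) = carrier R"
  using basis by (auto simp: frobenius_basis_def bij_betw_def)

lemma coords_mem: "x \<in> carrier R \<Longrightarrow> coords q B \<beta> x \<in> B \<rightarrow>\<^sub>E carrier R"
  unfolding coords_def using basisD(4) by (intro the_inv_into_into[OF basisD(3)]) auto

lemma coords_closed: "x \<in> carrier R \<Longrightarrow> b \<in> B \<Longrightarrow> coords q B \<beta> x b \<in> carrier R"
  using coords_mem by blast

lemma comb_coords: "x \<in> carrier R \<Longrightarrow> frobenius_comb q B \<beta> (coords q B \<beta> x) = x"
  unfolding coords_def using basisD(4) by (intro f_the_inv_into_f[OF basisD(3)]) auto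

lemma coords_comb: "c \<in> B \<rightarrow>\<^sub>E carrier R \<Longrightarrow> coords q B \<beta> (frobenius_comb q B \<beta> c) = c"
  unfolding coords_def using basisD(3) by (rule the_inv_into_f_f)

lemma coords_unique:
  assumes "c \<in> B \<rightarrow> carrier R" "frobenius_comb q B \<beta> c = x" "b \<in> B"
  shows "coords q B \<beta> x b = c b"
proof -
  have "frobenius_comb q B \<beta> (restrict c B) = frobenius_comb q B \<beta> c"
    using assms(1) basisD(2) by (intro frobenius_comb_cong) auto
  then have "coords q B \<beta> x = restrict c B"
    using assms(1,2) coords_comb[of "restrict c B"] by auto
  then show ?thesis using assms(3) by simp
qed

lemma coords_smult:
  assumes k: "k \<in> carrier R" and x: "x \<in> carrier R" and b: "b \<in> B"
  shows "coords q B \<beta> (k [^] q \<otimes> x) b = k \<otimes> coords q B \<beta> x b"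
proof (rule coords_unique[OF _ _ b, where c = "\<lambda>b. k \<otimes> coords q B \<beta> x b"])
  show "(\<lambda>b. k \<otimes> coords q B \<beta> x b) \<in> B \<rightarrow> carrier R" using k coords_closed[OF x] by simp
  have "frobenius_comb q B \<beta> (\<lambda>b. k \<otimes> coords q B \<beta> x b)
      = (\<Oplus>b\<in>B. k [^] q \<otimes> (\<beta> b \<otimes> coords q B \<beta> x b [^] q))"
    unfolding frobenius_comb_def using k coords_closed[OF x] basisD(2)
    by (intro finsum_cong') (auto simp: Pi_def nat_pow_distrib m_ac)
  also have "\<dots> = k [^] q \<otimes> frobenius_comb q B \<beta> (coords q B \<beta> x)"
    unfolding frobenius_comb_def using k coords_closed[OF x] basisD(1,2)
    by (subst finsum_rdistr) (auto simp: Pi_def)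
  finally show "frobenius_comb q B \<beta> (\<lambda>b. k \<otimes> coords q B \<beta> x b) = k [^] q \<otimes> x"
    using comb_coords[OF x] by simp
qed

lemma coords_add:
  assumes p: "Factorial_Ring.prime (p :: nat)" and char: "[p] \<cdot>\<^bsub>R\<^esub> \<one> = \<zero>" and q: "q = p ^ e"
    and x: "x \<in> carrier R" and y: "y \<in> carrier R" and b: "b \<in> B"
  shows "coords q B \<beta> (x \<oplus> y) b = coords q B \<beta> x b \<oplus> coords q B \<beta> y b"
proof (rule coords_unique[OF _ _ b, where c = "\<lambda>b. coords q B \<beta> x b \<oplus> coords q B \<beta> y b"])
  let ?c = "coords q B \<beta>"
  note closed = coords_closed[OF x] coords_closed[OF y]
  show "(\<lambda>b. ?c x b \<oplus> ?c y b) \<in> B \<rightarrow> carrier R" using closed by simp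
  have "frobenius_comb q B \<beta> (\<lambda>b. ?c x b \<oplus> ?c y b)
      = (\<Oplus>b\<in>B. \<beta> b \<otimes> ?c x b [^] q \<oplus> \<beta> b \<otimes> ?c y b [^] q)"
    unfolding frobenius_comb_def using closed basisD(2) frobenius_add[OF p char, of _ _ e]
    by (intro finsum_cong') (auto simp: Pi_def q r_distr)
  also have "\<dots> = frobenius_comb q B \<beta> (?c x) \<oplus> frobenius_comb q B \<beta> (?c y)"
    unfolding frobenius_comb_def using closed basisD(2)
    by (intro finsum_addf) (auto simp: Pi_def)
  finally show "frobenius_comb q B \<beta> (\<lambda>b. ?c x b \<oplus> ?c y b) = x \<oplus> y"
    using comb_coords x y by simp
qed

lemma coords_finsum:
  assumes p: "Factorial_Ring.prime (p :: nat)" and char: "[p] \<cdot>\<^bsub>R\<^esub> \<one> = \<zero>" and q: "q = p ^ e"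
    and A: "finite A" "f \<in> A \<rightarrow> carrier R" and b: "b \<in> B"
  shows "coords q B \<beta> (\<Oplus>a\<in>A. f a) b = (\<Oplus>a\<in>A. coords q B \<beta> (f a) b)"
  using A
proof (induction A rule: finite_induct)
  case empty
  have "\<zero> = \<zero> [^] q \<otimes> \<zero>" by simp
  then have "coords q B \<beta> \<zero> b = \<zero> \<otimes> coords q B \<beta> \<zero> b"
    using coords_smult[OF zero_closed zero_closed b] by simp
  then show ?case using coords_closed[OF zero_closed b] by simp
next
  case (insert a A)
  then show ?case
    using coords_closed[OF _ b] coords_add[OF p char q _ _ b] by (simp add: Pi_def)
qed

end

lemma frobenius_basis_one: "frobenius_basis 1 {0 :: nat} (\<lambda>_. \<one>)"
proof -
  have comb: "frobenius_comb 1 {0 :: nat} (\<lambda>_. \<one>) c = c 0" if "c \<in> {0} \<rightarrow>\<^sub>E carrier R" for c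
    using that by (simp add: frobenius_comb_def Pi_def PiE_def)
  have "bij_betw (\<lambda>c. c 0) ({0 :: nat} \<rightarrow>\<^sub>E carrier R) (carrier R)"
    by (rule bij_betw_byWitness[where f' = "\<lambda>x. \<lambda>i\<in>{0}. x"]) (auto simp: fun_eq_iff PiE_def extensional_def)
  then show ?thesis
    using bij_betw_cong[of "{0 :: nat} \<rightarrow>\<^sub>E carrier R", OF comb] by (simp add: frobenius_basis_def)
qed

text \<open>
  Products \<open>\<beta> b \<cdot> (\<beta>' b')\<^sup>p\<close> form a basis for \<open>p q\<close>: expand an element by \<open>\<beta>\<close>, expand its coordinates by
  \<open>\<beta>'\<close>, and take the \<open>p\<close>-th power of the latter sums termwise. Pairs are encoded as numbers so that
  the index type stays the same when this is iterated.
\<close>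

lemma frobenius_basis_tower:
  fixes B B' :: "nat set"
  assumes p: "Factorial_Ring.prime (p :: nat)" and char: "[p] \<cdot>\<^bsub>R\<^esub> \<one> = \<zero>"
    and basis: "frobenius_basis p B \<beta>" and basis': "frobenius_basis q B' \<beta>'"
  shows "frobenius_basis (p * q) (prod_encode ` (B \<times> B'))
    (\<lambda>m. case prod_decode m of (b, b') \<Rightarrow> \<beta> b \<otimes> \<beta>' b' [^] p)"
proof -
  note D = basisD[OF basis] and D' = basisD[OF basis']
  let ?C = "prod_encode ` (B \<times> B')"
  let ?\<gamma> = "\<lambda>m. case prod_decode m of (b, b') \<Rightarrow> \<beta> b \<otimes> \<beta>' b' [^] p"
  have \<gamma>: "?\<gamma> \<in> ?C \<rightarrow> carrier R" using D(2) D'(2) by (auto simp: Pi_def)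
  let ?y = "\<lambda>c b. frobenius_comb q B' \<beta>' (\<lambda>b'\<in>B'. c (prod_encode (b, b')))"
  have y: "?y c b \<in> carrier R" if "c \<in> ?C \<rightarrow>\<^sub>E carrier R" "b \<in> B" for c b
    using that D'(2) by (intro frobenius_comb_closed) auto
  have comb: "frobenius_comb (p * q) ?C ?\<gamma> c = frobenius_comb p B \<beta> (\<lambda>b\<in>B. ?y c b)"
    if c: "c \<in> ?C \<rightarrow>\<^sub>E carrier R" for c
  proof -
    have cc: "c (prod_encode (b, b')) \<in> carrier R" if "b \<in> B" "b' \<in> B'" for b b'
      using c that by auto
    have \<beta>: "\<beta> b \<in> carrier R" if "b \<in> B" for b using D(2) that by auto
    have \<beta>': "\<beta>' b \<in> carrier R" if "b \<in> B'" for b using D'(2) that by auto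
    let ?t = "\<lambda>b b'. \<beta> b \<otimes> \<beta>' b' [^] p \<otimes> c (prod_encode (b, b')) [^] (p * q)"
    have "frobenius_comb (p * q) ?C ?\<gamma> c = finsum R (\<lambda>(b, b'). ?t b b') (B \<times> B')"
      unfolding frobenius_comb_def using cc \<beta> \<beta>'
      by (subst add.finprod_reindex) (auto simp: case_prod_unfold intro!: inj_on_subset[OF inj_prod_encode])
    also have "\<dots> = (\<Oplus>b\<in>B. \<Oplus>b'\<in>B'. ?t b b')"
      using D(1) D'(1) cc \<beta> \<beta>' by (intro finsum_Sigma[symmetric]) auto
    also have "\<dots> = (\<Oplus>b\<in>B. \<beta> b \<otimes> (\<lambda>b\<in>B. ?y c b) b [^] p)"
    proof (rule finsum_cong'[OF refl])
      show "(\<lambda>b. \<beta> b \<otimes> (\<lambda>b\<in>B. ?y c b) b [^] p) \<in> B \<rightarrow> carrier R"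
        using y[OF c] \<beta> by simp
      fix b assume b: "b \<in> B"
      have "?y c b = (\<Oplus>b'\<in>B'. \<beta>' b' \<otimes> c (prod_encode (b, b')) [^] q)"
        unfolding frobenius_comb_def using cc[OF b] \<beta>' by (intro finsum_cong') auto
      then have "?y c b [^] p = (\<Oplus>b'\<in>B'. (\<beta>' b' \<otimes> c (prod_encode (b, b')) [^] q) [^] p)"
        using frobenius_finsum[OF p char D'(1), of "\<lambda>b'. \<beta>' b' \<otimes> c (prod_encode (b, b')) [^] q" 1]
          cc[OF b] \<beta>' by simp
      also have "\<dots> = (\<Oplus>b'\<in>B'. \<beta>' b' [^] p \<otimes> c (prod_encode (b, b')) [^] (p * q))"
        using cc[OF b] \<beta>'
        by (intro finsum_cong') (auto simp: nat_pow_distrib nat_pow_pow mult.commute)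
      finally have "\<beta> b \<otimes> ?y c b [^] p = (\<Oplus>b'\<in>B'. \<beta> b \<otimes> (\<beta>' b' [^] p \<otimes> c (prod_encode (b, b')) [^] (p * q)))"
        using cc[OF b] \<beta>' \<beta>[OF b] D'(1) by (simp add: finsum_rdistr Pi_def)
      also have "\<dots> = (\<Oplus>b'\<in>B'. ?t b b')"
        using cc[OF b] \<beta>' \<beta>[OF b] by (intro finsum_cong') (auto simp: m_assoc)
      finally show "(\<Oplus>b'\<in>B'. ?t b b') = \<beta> b \<otimes> (\<lambda>b\<in>B. ?y c b) b [^] p"
        using b by simp
    qed
    finally show ?thesis by (simp add: frobenius_comb_def)
  qed
  have "inj_on (frobenius_comb (p * q) ?C ?\<gamma>) (?C \<rightarrow>\<^sub>E carrier R)"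
  proof (rule inj_onI)
    fix c d assume c: "c \<in> ?C \<rightarrow>\<^sub>E carrier R" and d: "d \<in> ?C \<rightarrow>\<^sub>E carrier R"
      and "frobenius_comb (p * q) ?C ?\<gamma> c = frobenius_comb (p * q) ?C ?\<gamma> d"
    then have eq: "frobenius_comb p B \<beta> (\<lambda>b\<in>B. ?y c b) = frobenius_comb p B \<beta> (\<lambda>b\<in>B. ?y d b)"
      by (simp add: comb)
    have y_fun: "(\<lambda>b\<in>B. ?y c b) = (\<lambda>b\<in>B. ?y d b)"
      by (rule inj_onD[OF D(3), OF eq]) (use y[OF c] y[OF d] in \<open>simp_all add: restrict_PiE_iff\<close>)
    have y_eq: "?y c b = ?y d b" if "b \<in> B" for b
      using fun_cong[OF y_fun, of b] that by simp
    have c_fun: "(\<lambda>b'\<in>B'. c (prod_encode (b, b'))) = (\<lambda>b'\<in>B'. d (prod_encode (b, b')))" if "b \<in> B" for b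
      by (rule inj_onD[OF D'(3), OF y_eq[OF that]]) (use PiE_mem[OF c] PiE_mem[OF d] that in \<open>simp_all add: restrict_PiE_iff\<close>)
    have cd: "c (prod_encode (b, b')) = d (prod_encode (b, b'))" if "b \<in> B" "b' \<in> B'" for b b'
      using fun_cong[OF c_fun[OF that(1)], of b'] that(2) by simp
    show "c = d" using c d cd by (intro PiE_ext) auto
  qed
  moreover have "frobenius_comb (p * q) ?C ?\<gamma> ` (?C \<rightarrow>\<^sub>E carrier R) = carrier R"
  proof
    show "frobenius_comb (p * q) ?C ?\<gamma> ` (?C \<rightarrow>\<^sub>E carrier R) \<subseteq> carrier R"
      using \<gamma> by (auto intro!: frobenius_comb_closed)
    show "carrier R \<subseteq> frobenius_comb (p * q) ?C ?\<gamma> ` (?C \<rightarrow>\<^sub>E carrier R)"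
    proof
      fix x assume x: "x \<in> carrier R"
      let ?k = "coords p B \<beta>" and ?k' = "coords q B' \<beta>'"
      let ?c = "\<lambda>m\<in>?C. ?k' (?k x (fst (prod_decode m))) (snd (prod_decode m))"
      have kx: "?k x b \<in> carrier R" if "b \<in> B" for b using coords_closed[OF basis x that] .
      have c: "?c \<in> ?C \<rightarrow>\<^sub>E carrier R"
        using kx coords_closed[OF basis'] by (auto simp: restrict_PiE_iff)
      have "?y ?c b = ?k x b" if b: "b \<in> B" for b
      proof -
        have "(\<lambda>b'\<in>B'. ?c (prod_encode (b, b'))) = ?k' (?k x b)"
          using b coords_mem[OF basis' kx[OF b]] by (intro PiE_ext[of _ B' "\<lambda>_. carrier R"]) auto
        then show ?thesis using comb_coords[OF basis' kx[OF b]] by simp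
      qed
      then have "(\<lambda>b\<in>B. ?y ?c b) = ?k x"
        using coords_mem[OF basis x] by (intro PiE_ext[of _ B "\<lambda>_. carrier R"]) auto
      then have "frobenius_comb (p * q) ?C ?\<gamma> ?c = x"
        unfolding comb[OF c] using comb_coords[OF basis x] by simp
      then show "x \<in> frobenius_comb (p * q) ?C ?\<gamma> ` (?C \<rightarrow>\<^sub>E carrier R)"
        by (intro image_eqI[OF _ c]) simp
    qed
  qed
  ultimately show ?thesis
    using D(1) D'(1) \<gamma> by (simp add: frobenius_basis_def bij_betw_def)
qed

end

lemma (in field) frobenius_inj:
  assumes p: "Factorial_Ring.prime (p :: nat)" and char: "[p] \<cdot>\<^bsub>R\<^esub> \<one> = \<zero>"
    and "x \<in> carrier R" "y \<in> carrier R" "x [^] p = y [^] p"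
  shows "x = y"
proof -
  have "(x \<ominus> y \<oplus> y) [^] p = (x \<ominus> y) [^] p \<oplus> y [^] p"
    using frobenius_add[OF p char, of "x \<ominus> y" y 1] assms(3,4) by simp
  moreover have "x \<ominus> y \<oplus> y = x" using assms(3,4) by (simp add: a_minus_def a_assoc l_neg)
  ultimately have "(x \<ominus> y) [^] p \<oplus> y [^] p = \<zero> \<oplus> y [^] p"
    using assms(3-5) by simp
  then have z: "(x \<ominus> y) [^] p = \<zero>"
    using assms(3,4) by (subst (asm) add.r_cancel) auto
  have "x \<ominus> y = \<zero>"
  proof (rule ccontr)
    assume "x \<ominus> y \<noteq> \<zero>"
    then have "x \<ominus> y \<in> Units R" using assms(3,4) by (simp add: field_Units)
    then have "(x \<ominus> y) [^] p \<in> Units R" by (rule Units_pow_closed)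
    then show False using z by (simp add: field_Units)
  qed
  then show ?thesis using assms(3,4) by (simp add: r_right_minus_eq)
qed

lemma (in field) frobenius_image_subfield:
  assumes p: "Factorial_Ring.prime (p :: nat)" and char: "[p] \<cdot>\<^bsub>R\<^esub> \<one> = \<zero>"
  shows "subfield ((\<lambda>x. x [^] p) ` carrier R) R"
proof -
  have "ring_hom_ring R R (\<lambda>x. x [^] p)"
    using frobenius_add[OF p char, of _ _ 1]
    by (intro ring_hom_ringI) (auto simp: nat_pow_distrib ring_axioms)
  then interpret F: ring_hom_ring R R "\<lambda>x. x [^] p" .
  show ?thesis
    using F.img_is_subfield(2)[OF carrier_is_subfield] by simp
qed

text \<open>
  Induction on the dimension. The new vector \<open>v\<close> is independent of \<open>E\<close>, which makes its coefficient
  \<open>(c m)\<^sup>p\<close> unique; \<open>c m\<close> itself is unique because the Frobenius map of a field is injective.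
\<close>

lemma (in field) frobenius_basis_of_dimension:
  assumes p: "Factorial_Ring.prime (p :: nat)" and char: "[p] \<cdot>\<^bsub>R\<^esub> \<one> = \<zero>"
    and "dimension m ((\<lambda>x. x [^] p) ` carrier R) E"
  shows "\<exists>\<beta>. \<beta> \<in> {..<m} \<rightarrow> carrier R \<and> bij_betw (frobenius_comb p {..<m} \<beta>) ({..<m} \<rightarrow>\<^sub>E carrier R) E"
  using assms(3)
proof (induction m "(\<lambda>x. x [^] p) ` carrier R" E rule: dimension.induct)
  case zero_dim
  show ?case by (auto simp: frobenius_comb_def bij_betw_def)
next
  case (Suc_dim v E m)
  let ?F = "(\<lambda>x. x [^] p) ` carrier R"
  have F: "subfield ?F R" by (rule frobenius_image_subfield[OF p char])
  have "subalgebra ?F E R"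
    using Suc_dim(3) by (intro finite_dimension_imp_subalgebra[OF F]) (rule finite_dimensionI)
  then interpret E: subalgebra ?F E R .
  have EK: "E \<subseteq> carrier R" using E.subset by simp
  obtain \<beta> where \<beta>: "\<beta> \<in> {..<m} \<rightarrow> carrier R"
    and bij: "bij_betw (frobenius_comb p {..<m} \<beta>) ({..<m} \<rightarrow>\<^sub>E carrier R) E"
    using Suc_dim(4) by blast
  let ?\<gamma> = "\<beta>(m := v)"
  let ?r = "\<lambda>c. restrict c {..<m}"
  have \<gamma>: "?\<gamma> \<in> {..<Suc m} \<rightarrow> carrier R" using \<beta> Suc_dim(1) by (auto simp: less_Suc_eq)
  have comb: "frobenius_comb p {..<Suc m} ?\<gamma> c = c m [^] p \<otimes> v \<oplus> frobenius_comb p {..<m} \<beta> (?r c)"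
    and r: "?r c \<in> {..<m} \<rightarrow>\<^sub>E carrier R" and cm: "c m \<in> carrier R"
    if c: "c \<in> {..<Suc m} \<rightarrow>\<^sub>E carrier R" for c
  proof -
    have cK: "c i \<in> carrier R" if "i < Suc m" for i using PiE_mem[OF c] that by simp
    then show "?r c \<in> {..<m} \<rightarrow>\<^sub>E carrier R" "c m \<in> carrier R"
      by (simp_all add: restrict_PiE_iff)
    have "(\<Oplus>b\<in>{..<m}. ?\<gamma> b \<otimes> c b [^] p) = (\<Oplus>b\<in>{..<m}. \<beta> b \<otimes> ?r c b [^] p)"
      using cK \<beta> by (intro finsum_cong') auto
    moreover have "(\<lambda>b. ?\<gamma> b \<otimes> c b [^] p) \<in> {..<m} \<rightarrow> carrier R"
      using cK \<beta> by (auto simp: Pi_def)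
    ultimately show "frobenius_comb p {..<Suc m} ?\<gamma> c = c m [^] p \<otimes> v \<oplus> frobenius_comb p {..<m} \<beta> (?r c)"
      unfolding frobenius_comb_def lessThan_Suc
      using cK Suc_dim(1) by (subst finsum_insert) (auto simp: m_comm)
  qed
  have inE: "frobenius_comb p {..<m} \<beta> d \<in> E" if "d \<in> {..<m} \<rightarrow>\<^sub>E carrier R" for d
    using bij_betwE[OF bij] that by blast
  have "inj_on (frobenius_comb p {..<Suc m} ?\<gamma>) ({..<Suc m} \<rightarrow>\<^sub>E carrier R)"
  proof (rule inj_onI)
    fix c d assume c: "c \<in> {..<Suc m} \<rightarrow>\<^sub>E carrier R" and d: "d \<in> {..<Suc m} \<rightarrow>\<^sub>E carrier R"
      and eq: "frobenius_comb p {..<Suc m} ?\<gamma> c = frobenius_comb p {..<Suc m} ?\<gamma> d"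
    let ?s = "frobenius_comb p {..<m} \<beta> (?r c)" and ?t = "frobenius_comb p {..<m} \<beta> (?r d)"
    have sE: "?s \<in> E" "?t \<in> E" using inE r[OF c] r[OF d] by auto
    note K = EK[THEN subsetD, OF sE(1)] EK[THEN subsetD, OF sE(2)] cm[OF c] cm[OF d] Suc_dim(1)
    have eq': "c m [^] p \<otimes> v \<oplus> ?s = d m [^] p \<otimes> v \<oplus> ?t" using eq comb[OF c] comb[OF d] by simp
    have cdm: "c m = d m"
    proof (rule ccontr)
      assume "c m \<noteq> d m"
      let ?k = "c m [^] p \<ominus> d m [^] p"
      have "?k \<noteq> \<zero>"
        using frobenius_inj[OF p char K(3,4)] \<open>c m \<noteq> d m\<close> K by (auto simp: r_right_minus_eq)
      moreover have kF: "?k \<in> ?F"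
        unfolding a_minus_def using K subringE(5,7)[OF subfieldE(1)[OF F]] by blast
      ultimately have "inv ?k \<in> ?F"
        using subfield_m_inv(1)[OF F, of ?k] by auto
      moreover have "?k \<otimes> v = ?t \<ominus> ?s"
        using minus_eq_minus[OF _ _ _ _ eq'] K by (simp add: a_minus_def l_distr l_minus)
      moreover have "?t \<ominus> ?s \<in> E"
        using E.m_closed[OF sE(2) E.m_inv_closed[OF sE(1)]] by (simp add: a_minus_def a_inv_def)
      ultimately have "inv ?k \<otimes> (?k \<otimes> v) \<in> E"
        using E.smult_closed by simp
      moreover have "inv ?k \<otimes> (?k \<otimes> v) = v"
        using \<open>?k \<noteq> \<zero>\<close> K by (simp add: m_assoc[symmetric] field_Units)
      ultimately show False using Suc_dim(2) by simp
    qed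
    then have st: "?s = ?t" using eq' K by simp
    have r_eq: "?r c = ?r d"
      by (rule inj_onD[OF bij_betw_imp_inj_on[OF bij], OF st r[OF c] r[OF d]])
    have "c i = d i" if "i < m" for i using fun_cong[OF r_eq, of i] that by simp
    then show "c = d" using c d cdm by (intro PiE_ext) (auto simp: less_Suc_eq)
  qed
  moreover have "frobenius_comb p {..<Suc m} ?\<gamma> ` ({..<Suc m} \<rightarrow>\<^sub>E carrier R) = line_extension ?F v E"
  proof safe
    fix c assume c: "c \<in> {..<Suc m} \<rightarrow>\<^sub>E carrier R"
    show "frobenius_comb p {..<Suc m} ?\<gamma> c \<in> line_extension ?F v E"
      unfolding comb[OF c] line_extension_mem_iff using inE[OF r[OF c]] cm[OF c] by blast
  next
    fix x assume "x \<in> line_extension ?F v E"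
    then obtain k s where k: "k \<in> carrier R" and s: "s \<in> E" and x: "x = k [^] p \<otimes> v \<oplus> s"
      unfolding line_extension_mem_iff by blast
    then obtain d where d: "d \<in> {..<m} \<rightarrow>\<^sub>E carrier R" "frobenius_comb p {..<m} \<beta> d = s"
      using bij_betw_imp_surj_on[OF bij] by blast
    let ?c = "d(m := k)"
    have c: "?c \<in> {..<Suc m} \<rightarrow>\<^sub>E carrier R"
      using d(1) k by (auto simp: less_Suc_eq PiE_def extensional_def)
    have "?r ?c = d" using d(1) by (intro PiE_ext[of _ "{..<m}" "\<lambda>_. carrier R"]) auto
    then have "frobenius_comb p {..<Suc m} ?\<gamma> ?c = x" using comb[OF c] d(2) x by simp
    then show "x \<in> frobenius_comb p {..<Suc m} ?\<gamma> ` ({..<Suc m} \<rightarrow>\<^sub>E carrier R)" using c by blast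
  qed
  ultimately show ?case using \<gamma> by (auto simp: bij_betw_def)
qed

theorem (in field) frobenius_basis_exists:
  assumes p: "Factorial_Ring.prime (p :: nat)" and char: "[p] \<cdot>\<^bsub>R\<^esub> \<one> = \<zero>"
    and dim: "finite_dimension ((\<lambda>x. x [^] p) ` carrier R) (carrier R)"
  shows "\<exists>(B :: nat set) \<beta>. frobenius_basis (p ^ e) B \<beta>"
proof (induction e)
  case 0
  show ?case using frobenius_basis_one by auto
next
  case (Suc e)
  obtain m where "dimension m ((\<lambda>x. x [^] p) ` carrier R) (carrier R)"
    using dim by (auto simp: finite_dimension_def)
  then obtain \<beta> where "frobenius_basis p {..<m} \<beta>"
    using frobenius_basis_of_dimension[OF p char, of m "carrier R"]
    unfolding frobenius_basis_def by blast
  moreover obtain B' :: "nat set" and \<beta>' where "frobenius_basis (p ^ e) B' \<beta>'"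
    using Suc by blast
  ultimately show ?case
    unfolding power_Suc using frobenius_basis_tower[OF p char] by blast
qed

section \<open>Direct sums and finite F-representation type\<close>

lemma module_isomorphic_trans:
  assumes "module_isomorphic A L M" "module_isomorphic A M N"
  shows "module_isomorphic A L N"
proof -
  obtain g h where g: "g \<in> module_hom A L M" "bij_betw g (carrier L) (carrier M)"
    and h: "h \<in> module_hom A M N" "bij_betw h (carrier M) (carrier N)"
    using assms by (auto simp: module_isomorphic_def)
  have "h \<circ> g \<in> module_hom A L N"
    using g(1) h(1) by (auto simp: module_hom_def Pi_def)
  then show ?thesis
    using bij_betw_trans[OF g(2) h(2)] by (auto simp: module_isomorphic_def)
qed

lemma bij_betw_PiE:
  assumes \<theta>: "bij_betw \<theta> J' J" and h: "\<And>j. j \<in> J' \<Longrightarrow> bij_betw (h j) (F (\<theta> j)) (G j)"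
  shows "bij_betw (\<lambda>x. \<lambda>j\<in>J'. h j (x (\<theta> j))) (\<Pi>\<^sub>E i\<in>J. F i) (\<Pi>\<^sub>E j\<in>J'. G j)"
proof (rule bij_betw_byWitness[where f' = "\<lambda>y. \<lambda>i\<in>J. the_inv_into (F i) (h (the_inv_into J' \<theta> i)) (y (the_inv_into J' \<theta> i))"])
  let ?\<theta>' = "the_inv_into J' \<theta>"
  let ?g = "\<lambda>i. the_inv_into (F i) (h (?\<theta>' i))"
  have \<theta>': "?\<theta>' i \<in> J'" "\<theta> (?\<theta>' i) = i" if "i \<in> J" for i
    using that \<theta> by (auto simp: bij_betw_def f_the_inv_into_f intro!: the_inv_into_into)
  have \<theta>'': "\<theta> j \<in> J" "?\<theta>' (\<theta> j) = j" if "j \<in> J'" for j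
    using that \<theta> by (auto simp: bij_betw_def the_inv_into_f_f)
  have hg: "h j (the_inv_into (F (\<theta> j)) (h j) y) = y" "the_inv_into (F (\<theta> j)) (h j) y \<in> F (\<theta> j)"
    if "j \<in> J'" "y \<in> G j" for j y
    using h[OF that(1)] that(2) f_the_inv_into_f_bij_betw[OF h[OF that(1)]]
      bij_betwE[OF bij_betw_the_inv_into[OF h[OF that(1)]]] by auto
  have gh: "the_inv_into (F (\<theta> j)) (h j) (h j y) = y" if "j \<in> J'" "y \<in> F (\<theta> j)" for j y
    using h[OF that(1)] that(2) by (simp add: bij_betw_def the_inv_into_f_f)
  show "\<forall>x\<in>\<Pi>\<^sub>E i\<in>J. F i. (\<lambda>i\<in>J. ?g i ((\<lambda>j\<in>J'. h j (x (\<theta> j))) (?\<theta>' i))) = x"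
  proof
    fix x assume x: "x \<in> (\<Pi>\<^sub>E i\<in>J. F i)"
    show "(\<lambda>i\<in>J. ?g i ((\<lambda>j\<in>J'. h j (x (\<theta> j))) (?\<theta>' i))) = x"
    proof
      fix i
      show "(\<lambda>i\<in>J. ?g i ((\<lambda>j\<in>J'. h j (x (\<theta> j))) (?\<theta>' i))) i = x i"
        using gh[of "?\<theta>' i" "x i"] \<theta>'[of i] PiE_mem[OF x, of i] PiE_arb[OF x, of i] by (cases "i \<in> J") auto
    qed
  qed
  show "\<forall>y\<in>\<Pi>\<^sub>E j\<in>J'. G j. (\<lambda>j\<in>J'. h j ((\<lambda>i\<in>J. ?g i (y (?\<theta>' i))) (\<theta> j))) = y"
  proof
    fix y assume y: "y \<in> (\<Pi>\<^sub>E j\<in>J'. G j)"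
    show "(\<lambda>j\<in>J'. h j ((\<lambda>i\<in>J. ?g i (y (?\<theta>' i))) (\<theta> j))) = y"
    proof
      fix j
      show "(\<lambda>j\<in>J'. h j ((\<lambda>i\<in>J. ?g i (y (?\<theta>' i))) (\<theta> j))) j = y j"
        using hg[of j "y j"] \<theta>''[of j] PiE_mem[OF y, of j] PiE_arb[OF y, of j] by (cases "j \<in> J'") auto
    qed
  qed
  show "(\<lambda>x. \<lambda>j\<in>J'. h j (x (\<theta> j))) ` (\<Pi>\<^sub>E i\<in>J. F i) \<subseteq> (\<Pi>\<^sub>E j\<in>J'. G j)"
  proof (rule image_subsetI)
    fix x assume x: "x \<in> (\<Pi>\<^sub>E i\<in>J. F i)"
    show "(\<lambda>j\<in>J'. h j (x (\<theta> j))) \<in> (\<Pi>\<^sub>E j\<in>J'. G j)"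
      unfolding restrict_PiE_iff
    proof
      fix j assume j: "j \<in> J'"
      show "h j (x (\<theta> j)) \<in> G j"
        using bij_betwE[OF h[OF j]] PiE_mem[OF x \<theta>''(1)[OF j]] by blast
    qed
  qed
  show "(\<lambda>y. \<lambda>i\<in>J. ?g i (y (?\<theta>' i))) ` (\<Pi>\<^sub>E j\<in>J'. G j) \<subseteq> (\<Pi>\<^sub>E i\<in>J. F i)"
  proof (rule image_subsetI)
    fix y assume y: "y \<in> (\<Pi>\<^sub>E j\<in>J'. G j)"
    show "(\<lambda>i\<in>J. ?g i (y (?\<theta>' i))) \<in> (\<Pi>\<^sub>E i\<in>J. F i)"
      unfolding restrict_PiE_iff
    proof
      fix i assume i: "i \<in> J"
      show "?g i (y (?\<theta>' i)) \<in> F i"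
        using hg(2)[of "?\<theta>' i" "y (?\<theta>' i)"] \<theta>'[OF i] PiE_mem[OF y, of "?\<theta>' i"] by simp
    qed
  qed
qed

lemma direct_sum_reindex:
  assumes \<theta>: "bij_betw \<theta> J' J" and iso: "\<And>j. j \<in> J' \<Longrightarrow> module_isomorphic A (N (\<theta> j)) (M j)"
  shows "module_isomorphic A (direct_sum_module J N) (direct_sum_module J' M)"
proof -
  obtain h where h: "h j \<in> module_hom A (N (\<theta> j)) (M j)" "bij_betw (h j) (carrier (N (\<theta> j))) (carrier (M j))"
    if "j \<in> J'" for j
    using iso unfolding module_isomorphic_def by metis
  let ?f = "\<lambda>x. \<lambda>j\<in>J'. h j (x (\<theta> j))"
  have bij: "bij_betw ?f (carrier (direct_sum_module J N)) (carrier (direct_sum_module J' M))"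
    unfolding direct_sum_module_def using bij_betw_PiE[where F = "\<lambda>i. carrier (N i)" and G = "\<lambda>j. carrier (M j)", OF \<theta> h(2)]
    by simp
  have \<theta>J: "\<theta> j \<in> J" if "j \<in> J'" for j using bij_betwE[OF \<theta>] that by blast
  have "?f \<in> module_hom A (direct_sum_module J N) (direct_sum_module J' M)"
    unfolding module_hom_def
  proof (intro CollectI conjI allI impI)
    show "?f \<in> carrier (direct_sum_module J N) \<rightarrow> carrier (direct_sum_module J' M)"
      using bij_betwE[OF bij] by blast
  next
    fix x y assume xy: "x \<in> carrier (direct_sum_module J N) \<and> y \<in> carrier (direct_sum_module J N)"
    have mem: "x i \<in> carrier (N i)" "y i \<in> carrier (N i)" if "i \<in> J" for i
      using xy that by (auto simp: direct_sum_module_def)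
    show "?f (x \<oplus>\<^bsub>direct_sum_module J N\<^esub> y) = ?f x \<oplus>\<^bsub>direct_sum_module J' M\<^esub> ?f y"
      using module_hom_add[OF h(1)] mem \<theta>J by (simp add: direct_sum_module_def fun_eq_iff)
  next
    fix r x assume rx: "r \<in> carrier A \<and> x \<in> carrier (direct_sum_module J N)"
    have mem: "x i \<in> carrier (N i)" if "i \<in> J" for i
      using rx that by (auto simp: direct_sum_module_def)
    show "?f (r \<odot>\<^bsub>direct_sum_module J N\<^esub> x) = r \<odot>\<^bsub>direct_sum_module J' M\<^esub> ?f x"
      using module_hom_smult[OF h(1)] mem \<theta>J rx by (simp add: direct_sum_module_def fun_eq_iff)
  qed
  then show ?thesis using bij by (auto simp: module_isomorphic_def)
qed

text \<open>
  The summands of the push-forwards may be indexed by arbitrary finite sets as long as they are taken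
  from one finite family. Enumerating the family and, for each member, the summands equal to it gives
  the multiplicities that the definition asks for; the members are replaced by copies in the
  required type.
\<close>

theorem FFRT_criterion:
  fixes A :: "('a, 'b) ring_scheme" and N :: "'c \<Rightarrow> ('a, 'm, 'd) module_scheme"
    and J :: "nat \<Rightarrow> 'j set" and \<kappa> :: "nat \<Rightarrow> 'j \<Rightarrow> 'c"
  assumes "cring A" "noetherian_ring A" "Factorial_Ring.prime p" "[p] \<cdot>\<^bsub>A\<^esub> \<one>\<^bsub>A\<^esub> = \<zero>\<^bsub>A\<^esub>"
    and C: "finite C" and fg: "\<And>c. c \<in> C \<Longrightarrow> finitely_generated_module A (N c)"
    and J: "\<And>e. finite (J e)" and \<kappa>: "\<And>e j. j \<in> J e \<Longrightarrow> \<kappa> e j \<in> C"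
    and iso: "\<And>e. e > 0 \<Longrightarrow> module_isomorphic A (frobenius_pushforward p e A (regular_module A))
                  (direct_sum_module (J e) (\<lambda>j. N (\<kappa> e j)))"
  shows "FFRT p A"
proof -
  have "\<forall>c\<in>C. \<exists>N' :: ('a, (nat \<Rightarrow> 'a) set) module.
      finitely_generated_module A N' \<and> module_isomorphic A (N c) N'"
    using finitely_generated_module_copy[OF fg] by blast
  then obtain N' :: "'c \<Rightarrow> ('a, (nat \<Rightarrow> 'a) set) module" where
    N': "\<And>c. c \<in> C \<Longrightarrow> finitely_generated_module A (N' c)"
      "\<And>c. c \<in> C \<Longrightarrow> module_isomorphic A (N c) (N' c)"
    by metis
  define s where "s = card C"
  obtain g where g: "bij_betw g {..<s} C"
    using ex_bij_betw_nat_finite[OF C] by (auto simp: s_def atLeast0LessThan)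
  define M where "M j = N' (g j)" for j
  have "\<exists>t :: nat \<Rightarrow> nat. module_isomorphic A (frobenius_pushforward p e A (regular_module A))
          (direct_sum_module (SIGMA j:{..<s}. {..<t j}) (\<lambda>(j, k). M j))" if e: "e > 0" for e
  proof -
    define L where "L j = {x \<in> J e. \<kappa> e x = g j}" for j
    define t where "t j = card (L j)" for j
    have "\<exists>\<theta>. bij_betw \<theta> {..<t j} (L j)" for j
      using ex_bij_betw_nat_finite[of "L j"] J[of e] by (auto simp: t_def atLeast0LessThan L_def)
    then obtain \<theta> where \<theta>: "\<And>j. bij_betw (\<theta> j) {..<t j} (L j)" by metis
    have \<theta>L: "\<theta> j k \<in> J e" "\<kappa> e (\<theta> j k) = g j" if "k < t j" for j k
      using bij_betwE[OF \<theta>[of j]] that by (auto simp: L_def)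
    have "bij_betw (\<lambda>(j, k). \<theta> j k) (SIGMA j:{..<s}. {..<t j}) (J e)"
      unfolding bij_betw_def
    proof
      show "inj_on (\<lambda>(j, k). \<theta> j k) (SIGMA j:{..<s}. {..<t j})"
      proof (rule inj_onI, clarsimp)
        fix j k j' k' assume jk: "j < s" "k < t j" "j' < s" "k' < t j'" "\<theta> j k = \<theta> j' k'"
        then have "g j = g j'" using \<theta>L by metis
        then have "j = j'" using bij_betw_imp_inj_on[OF g] jk by (auto dest: inj_onD)
        then show "j = j' \<and> k = k'"
          using bij_betw_imp_inj_on[OF \<theta>[of j]] jk by (auto dest: inj_onD)
      qed
      show "(\<lambda>(j, k). \<theta> j k) ` (SIGMA j:{..<s}. {..<t j}) = J e"
      proof
        show "(\<lambda>(j, k). \<theta> j k) ` (SIGMA j:{..<s}. {..<t j}) \<subseteq> J e" using \<theta>L by auto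
        show "J e \<subseteq> (\<lambda>(j, k). \<theta> j k) ` (SIGMA j:{..<s}. {..<t j})"
        proof
          fix x assume x: "x \<in> J e"
          then have "\<kappa> e x \<in> g ` {..<s}" using \<kappa> g by (auto simp: bij_betw_def)
          then obtain j where j: "j < s" "\<kappa> e x = g j" by auto
          then have "x \<in> \<theta> j ` {..<t j}" using \<theta>[of j] x by (auto simp: bij_betw_def L_def)
          then show "x \<in> (\<lambda>(j, k). \<theta> j k) ` (SIGMA j:{..<s}. {..<t j})" using j by force
        qed
      qed
    qed
    then have "module_isomorphic A (direct_sum_module (J e) (\<lambda>j. N (\<kappa> e j)))
          (direct_sum_module (SIGMA j:{..<s}. {..<t j}) (\<lambda>(j, k). M j))"
    proof (rule direct_sum_reindex)
      fix x assume "x \<in> (SIGMA j:{..<s}. {..<t j})"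
      then show "module_isomorphic A (N (\<kappa> e ((\<lambda>(j, k). \<theta> j k) x))) (case x of (j, k) \<Rightarrow> M j)"
        using \<theta>L N'(2) bij_betwE[OF g] by (auto simp: M_def)
    qed
    then show ?thesis using module_isomorphic_trans[OF iso[OF e]] by blast
  qed
  moreover have "\<forall>j<s. finitely_generated_module A (M j)"
    using N'(1) bij_betwE[OF g] by (auto simp: M_def)
  ultimately show ?thesis
    using assms(1-4) unfolding FFRT_def by blast
qed

section \<open>Truncated series as modules over the quotient\<close>

locale monomial_quotient = field_series_ring K n S \<F>
  for K :: "('a, 'b) ring_scheme" (structure) and n S \<F> +
  fixes D :: "(nat \<Rightarrow> nat) set"
  assumes upset_D: "upset D"
begin

abbreviation I where "I \<equiv> supported D"
abbreviation R where "R \<equiv> S Quot I"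

sublocale I: ideal I S
  by (rule supported_ideal[OF upset_D])

lemma cring_R: "cring R"
  by (rule I.quotient_is_cring[OF S.is_cring])

sublocale Q: ring_hom_ring S R "(+>\<^bsub>S\<^esub>) I"
  by (rule I.rcos_ring_hom_ring)

lemma coset_of: "x \<in> carrier R \<Longrightarrow> \<exists>f\<in>carrier S. x = I +>\<^bsub>S\<^esub> f"
  unfolding FactRing_def A_RCOSETS_def' by auto

lemma coset_eq_iff:
  "f \<in> carrier S \<Longrightarrow> g \<in> carrier S \<Longrightarrow> I +>\<^bsub>S\<^esub> f = I +>\<^bsub>S\<^esub> g \<longleftrightarrow> f \<ominus>\<^bsub>S\<^esub> g \<in> I"
  using S.quotient_eq_iff_same_a_r_cos[OF I.ideal_axioms] by blast

definition rep :: "((nat \<Rightarrow> nat) \<Rightarrow> 'a) set \<Rightarrow> (nat \<Rightarrow> nat) \<Rightarrow> 'a" where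
  "rep x = (SOME f. f \<in> carrier S \<and> x = I +>\<^bsub>S\<^esub> f)"

lemma rep:
  assumes "f \<in> carrier S"
  shows "rep (I +>\<^bsub>S\<^esub> f) \<in> carrier S" and "rep (I +>\<^bsub>S\<^esub> f) \<ominus>\<^bsub>S\<^esub> f \<in> I"
proof -
  have "rep (I +>\<^bsub>S\<^esub> f) \<in> carrier S \<and> I +>\<^bsub>S\<^esub> f = I +>\<^bsub>S\<^esub> rep (I +>\<^bsub>S\<^esub> f)"
    unfolding rep_def by (rule someI[of _ f]) (use assms in simp)
  then show "rep (I +>\<^bsub>S\<^esub> f) \<in> carrier S" and "rep (I +>\<^bsub>S\<^esub> f) \<ominus>\<^bsub>S\<^esub> f \<in> I"
    using assms coset_eq_iff[of "rep (I +>\<^bsub>S\<^esub> f)" f] by auto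
qed

text \<open>
  For an upward closed set \<open>U\<close> containing \<open>D\<close> this is the quotient of \<open>S\<close> by the monomial ideal of
  \<open>U\<close>, as a module over \<open>S/I\<close>: a class is represented by its only member without exponents in \<open>U\<close>,
  and products are truncated to that form. This allows the decomposition of the push-forward to be
  checked coefficient by coefficient.
\<close>

definition truncated_module ::
    "(nat \<Rightarrow> nat) set \<Rightarrow> (((nat \<Rightarrow> nat) \<Rightarrow> 'a) set, (nat \<Rightarrow> nat) \<Rightarrow> 'a) module" where
  "truncated_module U =
    \<lparr>carrier = {f \<in> carrier S. supp f \<inter> U = {}}, monoid.mult = monoid.mult S, one = one S,
     ring.zero = ring.zero S, add = add S, smult = (\<lambda>x f. mask (- U) (rep x \<otimes>\<^bsub>S\<^esub> f))\<rparr>"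

lemma mask_add_S: "f \<in> carrier S \<Longrightarrow> g \<in> carrier S \<Longrightarrow> mask A (f \<oplus>\<^bsub>S\<^esub> g) = mask A f \<oplus>\<^bsub>S\<^esub> mask A g"
  by (simp add: S_simps mask_add)

lemma mask_eq_iff:
  assumes "f \<in> carrier S" "g \<in> carrier S"
  shows "mask (- U) f = mask (- U) g \<longleftrightarrow> f \<ominus>\<^bsub>S\<^esub> g \<in> supported U"
proof -
  have "mask (- U) f = mask (- U) g \<longleftrightarrow> (\<forall>a\<in>exponents n. a \<notin> U \<longrightarrow> f a = g a)"
  proof
    assume eq: "mask (- U) f = mask (- U) g"
    show "\<forall>a\<in>exponents n. a \<notin> U \<longrightarrow> f a = g a"
    proof (intro ballI impI)
      fix a assume "a \<in> exponents n" "a \<notin> U"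
      then show "f a = g a" using fun_cong[OF eq, of a] by (simp add: mask_coeff)
    qed
  qed (use assms in \<open>auto intro!: S_eqI simp: mask_closed mask_coeff\<close>)
  also have "\<dots> \<longleftrightarrow> f \<ominus>\<^bsub>S\<^esub> g \<in> supported U"
  proof -
    have "(f \<ominus>\<^bsub>S\<^esub> g) a = \<zero> \<longleftrightarrow> f a = g a" if "a \<in> exponents n" for a
      using assms that by (simp add: S_diff coeff_diff r_right_minus_eq)
    then show ?thesis
      using S.minus_closed[OF assms] unfolding supported_def supp_def by blast
  qed
  finally show ?thesis .
qed

lemma mask_mult_cong:
  assumes U: "upset U" and f: "f \<in> carrier S" "f' \<in> carrier S" "f \<ominus>\<^bsub>S\<^esub> f' \<in> supported U"
    and g: "g \<in> carrier S"
  shows "mask (- U) (f \<otimes>\<^bsub>S\<^esub> g) = mask (- U) (f' \<otimes>\<^bsub>S\<^esub> g)"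
proof -
  have "(f \<ominus>\<^bsub>S\<^esub> f') \<otimes>\<^bsub>S\<^esub> g \<in> supported U"
    using f g by (intro ideal.I_r_closed[OF supported_ideal[OF U]])
  moreover have "(f \<ominus>\<^bsub>S\<^esub> f') \<otimes>\<^bsub>S\<^esub> g = f \<otimes>\<^bsub>S\<^esub> g \<ominus>\<^bsub>S\<^esub> f' \<otimes>\<^bsub>S\<^esub> g"
    using f g by (simp add: a_minus_def S.l_distr S.l_minus)
  ultimately show ?thesis using f g by (simp add: mask_eq_iff)
qed

lemma mask_mult_mask:
  assumes "upset U" "f \<in> carrier S" "g \<in> carrier S"
  shows "mask (- U) (f \<otimes>\<^bsub>S\<^esub> mask (- U) g) = mask (- U) (f \<otimes>\<^bsub>S\<^esub> g)"
proof -
  have "mask (- U) (mask (- U) g) = mask (- U) g" by (simp add: mask_mask)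
  then have "mask (- U) g \<ominus>\<^bsub>S\<^esub> g \<in> supported U"
    using assms by (simp add: mask_eq_iff[symmetric] mask_closed)
  then have "mask (- U) (mask (- U) g \<otimes>\<^bsub>S\<^esub> f) = mask (- U) (g \<otimes>\<^bsub>S\<^esub> f)"
    using assms by (intro mask_mult_cong) (auto simp: mask_closed)
  then show ?thesis using assms by (simp add: S.m_comm mask_closed)
qed

lemma mask_fixed: "f \<in> carrier S \<Longrightarrow> supp f \<inter> U = {} \<Longrightarrow> mask (- U) f = f"
  by (rule mask_id) auto

context
  fixes U assumes U: "upset U" and DU: "D \<subseteq> U"
begin

lemma truncated_smult:
  assumes "f \<in> carrier S" "g \<in> carrier S"
  shows "(I +>\<^bsub>S\<^esub> f) \<odot>\<^bsub>truncated_module U\<^esub> g = mask (- U) (f \<otimes>\<^bsub>S\<^esub> g)"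
proof -
  have "I \<subseteq> supported U" using DU unfolding supported_def by blast
  then have "rep (I +>\<^bsub>S\<^esub> f) \<ominus>\<^bsub>S\<^esub> f \<in> supported U" using rep(2)[OF assms(1)] by blast
  from mask_mult_cong[OF U rep(1)[OF assms(1)] assms(1) this assms(2)]
  show ?thesis unfolding truncated_module_def by simp
qed

lemma truncated_simps:
  "carrier (truncated_module U) = {f \<in> carrier S. supp f \<inter> U = {}}"
  "f \<oplus>\<^bsub>truncated_module U\<^esub> g = f \<oplus>\<^bsub>S\<^esub> g"
  "\<zero>\<^bsub>truncated_module U\<^esub> = \<zero>\<^bsub>S\<^esub>"
  by (simp_all add: truncated_module_def)

lemma truncated_module: "module R (truncated_module U)"
proof (rule moduleI[OF cring_R])
  let ?T = "{f \<in> carrier S. supp f \<inter> U = {}}"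
  have supp_add_S: "supp (f \<oplus>\<^bsub>S\<^esub> g) \<subseteq> supp f \<union> supp g" if "f \<in> carrier S" "g \<in> carrier S" for f g
    using that supp_add[of f g] by (simp add: S_simps)
  show "abelian_group (truncated_module U)"
  proof (rule abelian_groupI)
    fix f g assume "f \<in> carrier (truncated_module U)" "g \<in> carrier (truncated_module U)"
    then show "f \<oplus>\<^bsub>truncated_module U\<^esub> g \<in> carrier (truncated_module U)"
      using supp_add_S[of f g] by (auto simp: truncated_simps)
  next
    fix f assume f: "f \<in> carrier (truncated_module U)"
    then have "\<ominus>\<^bsub>S\<^esub> f \<in> carrier (truncated_module U)"
      using supp_minus[of f] S.a_inv_closed[of f] by (auto simp: truncated_simps S_minus)
    then show "\<exists>g\<in>carrier (truncated_module U). g \<oplus>\<^bsub>truncated_module U\<^esub> f = \<zero>\<^bsub>truncated_module U\<^esub>"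
      using f by (intro bexI[of _ "\<ominus>\<^bsub>S\<^esub> f"]) (auto simp: truncated_simps S.l_neg)
  qed (use S.zero_closed in \<open>auto simp: truncated_simps S.a_ac S_simps(3) supp_zero\<close>)
  fix x f assume x: "x \<in> carrier R" and f: "f \<in> carrier (truncated_module U)"
  obtain r where r: "r \<in> carrier S" "x = I +>\<^bsub>S\<^esub> r" using coset_of[OF x] by blast
  have f': "f \<in> carrier S" "supp f \<inter> U = {}" using f by (auto simp: truncated_simps)
  show "x \<odot>\<^bsub>truncated_module U\<^esub> f \<in> carrier (truncated_module U)"
    using r f' by (auto simp: truncated_smult truncated_simps mask_closed supp_mask)
  {
    fix y assume y: "y \<in> carrier R"
    obtain s where s: "s \<in> carrier S" "y = I +>\<^bsub>S\<^esub> s" using coset_of[OF y] by blast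
    have add: "x \<oplus>\<^bsub>R\<^esub> y = I +>\<^bsub>S\<^esub> (r \<oplus>\<^bsub>S\<^esub> s)" and mult: "x \<otimes>\<^bsub>R\<^esub> y = I +>\<^bsub>S\<^esub> (r \<otimes>\<^bsub>S\<^esub> s)"
      using r s by simp_all
    show "(x \<oplus>\<^bsub>R\<^esub> y) \<odot>\<^bsub>truncated_module U\<^esub> f
        = x \<odot>\<^bsub>truncated_module U\<^esub> f \<oplus>\<^bsub>truncated_module U\<^esub> y \<odot>\<^bsub>truncated_module U\<^esub> f"
      unfolding add using r s f'
      by (simp add: truncated_smult truncated_simps S.l_distr mask_add_S del: Q.hom_add)
    show "(x \<otimes>\<^bsub>R\<^esub> y) \<odot>\<^bsub>truncated_module U\<^esub> f
        = x \<odot>\<^bsub>truncated_module U\<^esub> (y \<odot>\<^bsub>truncated_module U\<^esub> f)"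
      unfolding mult using r s f' U
      by (simp add: truncated_smult mask_closed mask_mult_mask S.m_assoc del: Q.hom_mult)
  }
  {
    fix g assume "g \<in> carrier (truncated_module U)"
    then have "g \<in> carrier S" by (auto simp: truncated_simps)
    then show "x \<odot>\<^bsub>truncated_module U\<^esub> (f \<oplus>\<^bsub>truncated_module U\<^esub> g)
        = x \<odot>\<^bsub>truncated_module U\<^esub> f \<oplus>\<^bsub>truncated_module U\<^esub> x \<odot>\<^bsub>truncated_module U\<^esub> g"
      using r f' by (simp add: truncated_smult truncated_simps S.r_distr mask_add_S)
  }
next
  fix f assume "f \<in> carrier (truncated_module U)"
  then have f': "f \<in> carrier S" "supp f \<inter> U = {}" by (auto simp: truncated_simps)
  have "\<one>\<^bsub>R\<^esub> = I +>\<^bsub>S\<^esub> \<one>\<^bsub>S\<^esub>" by simp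
  then show "\<one>\<^bsub>R\<^esub> \<odot>\<^bsub>truncated_module U\<^esub> f = f"
    using f' by (simp only: truncated_smult S.one_closed S.l_one mask_fixed)
qed

lemma truncated_finitely_generated: "finitely_generated_module R (truncated_module U)"
proof -
  interpret M: module R "truncated_module U" by (rule truncated_module)
  let ?g = "mask (- U) \<one>\<^bsub>S\<^esub>"
  have g: "?g \<in> carrier (truncated_module U)"
    by (auto simp: truncated_simps mask_closed supp_mask)
  have "f \<in> M.span {?g}" if f: "f \<in> carrier (truncated_module U)" for f
  proof -
    have f': "f \<in> carrier S" "supp f \<inter> U = {}" using f by (auto simp: truncated_simps)
    have x: "I +>\<^bsub>S\<^esub> f \<in> carrier R" using f' by simp
    have "(I +>\<^bsub>S\<^esub> f) \<odot>\<^bsub>truncated_module U\<^esub> ?g = f"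
      using f' U by (simp add: truncated_smult mask_closed mask_mult_mask mask_fixed)
    then have "M.lincomb (\<lambda>_. I +>\<^bsub>S\<^esub> f) {?g} = f"
      unfolding M.lincomb_def using x g f by simp
    then show ?thesis
      unfolding M.span_def using x by (intro CollectI exI[of _ "\<lambda>_. I +>\<^bsub>S\<^esub> f"] exI[of _ "{?g}"]) auto
  qed
  then have "M.span {?g} = carrier (truncated_module U)"
    using M.span_is_subset2[of "{?g}"] g by auto
  then show ?thesis
    using g M.module_axioms unfolding finitely_generated_module_def by blast
qed

end

end

section \<open>Decomposing the Frobenius push-forward\<close>

definition residues :: "nat \<Rightarrow> nat \<Rightarrow> (nat \<Rightarrow> nat) set" where
  "residues n q = {a \<in> exponents n. \<forall>i. a i < q}"

lemma finite_residues: "finite (residues n q)"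
proof -
  have "residues n q \<subseteq> {a. a \<le> (\<lambda>i. if i < n then q else 0)}"
    by (auto simp: residues_def exponents_def le_fun_def less_imp_le)
  moreover have "finite {a. a \<le> (\<lambda>i. if i < n then q else 0 :: nat)}"
    by (rule finite_exponents_le[of _ n]) (simp add: exponents_def)
  ultimately show ?thesis by (rule finite_subset)
qed

context monomial_quotient
begin

lemma hom_pow: "f \<in> carrier S \<Longrightarrow> (I +>\<^bsub>S\<^esub> f) [^]\<^bsub>R\<^esub> (m :: nat) = I +>\<^bsub>S\<^esub> (f [^]\<^bsub>S\<^esub> m)"
  by (induction m) simp_all

lemma hom_add_pow: "f \<in> carrier S \<Longrightarrow> [(m :: nat)] \<cdot>\<^bsub>R\<^esub> (I +>\<^bsub>S\<^esub> f) = I +>\<^bsub>S\<^esub> ([m] \<cdot>\<^bsub>S\<^esub> f)"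
  by (induction m) simp_all

lemma char_R:
  assumes "[(p :: nat)] \<cdot>\<^bsub>K\<^esub> \<one> = \<zero>"
  shows "[p] \<cdot>\<^bsub>R\<^esub> \<one>\<^bsub>R\<^esub> = \<zero>\<^bsub>R\<^esub>"
proof -
  have "[p] \<cdot>\<^bsub>S\<^esub> \<one>\<^bsub>S\<^esub> = [p] \<cdot>\<^bsub>P\<^esub> \<one>\<^bsub>P\<^esub>"
    unfolding S_eq add_pow_def nat_pow_def by simp
  then have "[p] \<cdot>\<^bsub>S\<^esub> \<one>\<^bsub>S\<^esub> = \<zero>\<^bsub>S\<^esub>"
    using char_P[OF assms] by (simp add: S_simps)
  then have "I +>\<^bsub>S\<^esub> ([p] \<cdot>\<^bsub>S\<^esub> \<one>\<^bsub>S\<^esub>) = \<zero>\<^bsub>R\<^esub>" by simp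
  then show ?thesis using hom_add_pow[OF S.one_closed, of p] by simp
qed

lemma noetherian_R: "noetherian_ring R"
proof (rule Q.noetherian_image[OF noetherian_S])
  show "(+>\<^bsub>S\<^esub>) I ` carrier S = carrier R"
    using coset_of Q.hom_closed by blast
qed

context
  fixes p e q :: nat and B :: "'i set" and \<beta> :: "'i \<Rightarrow> 'a"
  assumes p: "Factorial_Ring.prime p" and char: "[p] \<cdot>\<^bsub>K\<^esub> \<one> = \<zero>" and q: "q = p ^ e"
    and basis: "frobenius_basis q B \<beta>"
begin

abbreviation \<kappa> where "\<kappa> \<equiv> coords q B \<beta>"

text \<open>The exponent set of the ideal \<open>J\<^sub>a\<close> into which \<open>I\<close> turns in the coordinates with index \<open>a\<close>.\<close>

definition residual :: "(nat \<Rightarrow> nat) \<Rightarrow> (nat \<Rightarrow> nat) set" where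
  "residual a = {c \<in> exponents n. a + scale q c \<in> D}"

text \<open>The coordinate of \<open>f\<close> with respect to the element \<open>\<beta> b \<cdot> x\<^sup>a\<close> of the basis of \<open>F\<^sup>e\<^sub>*(S)\<close>.\<close>

definition component :: "'i \<Rightarrow> (nat \<Rightarrow> nat) \<Rightarrow> ((nat \<Rightarrow> nat) \<Rightarrow> 'a) \<Rightarrow> (nat \<Rightarrow> nat) \<Rightarrow> 'a" where
  "component b a f = (\<lambda>c\<in>exponents n. \<kappa> (f (a + scale q c)) b)"

lemma q0: "q > 0"
  by (rule q_pos[OF p char q])

lemma \<kappa>_zero: "b \<in> B \<Longrightarrow> \<kappa> \<zero> b = \<zero>"
  using coords_finsum[OF basis p char q, of "{}"] by simp

lemma residuesD: "a \<in> residues n q \<Longrightarrow> a \<in> exponents n" "a \<in> residues n q \<Longrightarrow> a i < q"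
  by (auto simp: residues_def)

lemma upset_residual:
  assumes "a \<in> exponents n"
  shows "upset (residual a)"
  unfolding upset_def
proof (intro conjI ballI impI)
  show "residual a \<subseteq> exponents n" by (auto simp: residual_def)
  fix c d assume c: "c \<in> residual a" and d: "d \<in> exponents n" "c \<le> d"
  have "a + scale q c \<le> a + scale q d" using d(2) by (auto simp: le_fun_def)
  moreover have "a + scale q d \<in> exponents n" using assms d(1) by (intro exponents_add scale_exponents)
  ultimately show "d \<in> residual a"
    using c d(1) upset_D by (auto simp: residual_def upset_def)
qed

lemma D_subset_residual:
  assumes "a \<in> exponents n"
  shows "D \<subseteq> residual a"
proof
  fix c assume c: "c \<in> D"
  then have cE: "c \<in> exponents n" using upset_D by (auto simp: upset_def)
  have "c i \<le> a i + q * c i" for i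
    using q0 by (metis add.commute le_add_same_cancel1 mult_le_mono1 nat_mult_1 trans_le_add1 zero_le Suc_leI One_nat_def)
  then have "c \<le> a + scale q c" by (simp add: le_fun_def)
  moreover have "a + scale q c \<in> exponents n" using assms cE by (intro exponents_add scale_exponents)
  ultimately show "c \<in> residual a" using c cE upset_D by (auto simp: residual_def upset_def)
qed

context
  fixes b a
  assumes b: "b \<in> B" and a: "a \<in> residues n q"
begin

lemma shift_exponents: "c \<in> exponents n \<Longrightarrow> a + scale q c \<in> exponents n"
  using residuesD(1)[OF a] by (intro exponents_add scale_exponents)

lemma component_coeff: "c \<in> exponents n \<Longrightarrow> component b a f c = \<kappa> (f (a + scale q c)) b"
  by (simp add: component_def)

lemma component_closed:
  assumes f: "f \<in> carrier S"
  shows "component b a f \<in> carrier S"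
proof (rule S_closed_of_supp)
  show "component b a f \<in> carrier P"
    unfolding component_def using f b shift_exponents coords_closed[OF basis] by (intro restrict_closed) simp
  show "supp (component b a f) \<subseteq> (\<lambda>c. a + scale q c) -` supp f"
    using \<kappa>_zero[OF b] shift_exponents by (auto simp: supp_def component_coeff)
  show "(\<lambda>c. a + scale q c) -` supp f \<in> \<F>"
    using f q0 by (intro allowed_vimage) (auto simp: carrier_S inj_def scale_inj)
qed

lemma component_add:
  assumes f: "f \<in> carrier S" and g: "g \<in> carrier S"
  shows "component b a (f \<oplus>\<^bsub>S\<^esub> g) = component b a f \<oplus>\<^bsub>S\<^esub> component b a g"
proof (rule S_eqI)
  fix c assume c: "c \<in> exponents n"
  then show "component b a (f \<oplus>\<^bsub>S\<^esub> g) c = (component b a f \<oplus>\<^bsub>S\<^esub> component b a g) c"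
    using f g shift_exponents[OF c] coords_add[OF basis p char q _ _ b]
    by (simp add: component_coeff S_simps coeff_add)
qed (use f g in \<open>simp_all add: component_closed\<close>)

lemma component_diff:
  assumes f: "f \<in> carrier S" and g: "g \<in> carrier S"
  shows "component b a (f \<ominus>\<^bsub>S\<^esub> g) = component b a f \<ominus>\<^bsub>S\<^esub> component b a g"
proof -
  have d: "f \<ominus>\<^bsub>S\<^esub> g \<in> carrier S" using f g by simp
  have "f = g \<oplus>\<^bsub>S\<^esub> (f \<ominus>\<^bsub>S\<^esub> g)" using S.add_minus_cancel[OF g f] by simp
  then have "component b a f = component b a g \<oplus>\<^bsub>S\<^esub> component b a (f \<ominus>\<^bsub>S\<^esub> g)"
    using component_add[OF g d] by simp
  then have "component b a f \<oplus>\<^bsub>S\<^esub> \<zero>\<^bsub>S\<^esub> = component b a g \<oplus>\<^bsub>S\<^esub> component b a (f \<ominus>\<^bsub>S\<^esub> g)"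
    using component_closed[OF f] by simp
  then have "component b a f \<ominus>\<^bsub>S\<^esub> component b a g = component b a (f \<ominus>\<^bsub>S\<^esub> g) \<ominus>\<^bsub>S\<^esub> \<zero>\<^bsub>S\<^esub>"
    using component_closed f g d by (intro S.minus_eq_minus) auto
  then show ?thesis using component_closed[OF d] by (simp add: a_minus_def)
qed

text \<open>
  Linearity of the coordinates over \<open>S\<close>. The series \<open>f\<^sup>q\<close> has only exponents \<open>q d\<close>, and since the
  entries of \<open>a\<close> are below \<open>q\<close>, such an exponent is below \<open>a + q c\<close> exactly when \<open>d \<le> c\<close>. The
  product at \<open>a + q c\<close> is therefore a sum over \<open>d \<le> c\<close>, in which the factors \<open>(f d)\<^sup>q\<close> leave
  \<open>\<kappa>\<close> as \<open>f d\<close>.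
\<close>

lemma component_mult:
  assumes f: "f \<in> carrier S" and g: "g \<in> carrier S"
  shows "component b a (f [^]\<^bsub>S\<^esub> q \<otimes>\<^bsub>S\<^esub> g) = f \<otimes>\<^bsub>S\<^esub> component b a g"
proof (rule S_eqI)
  fix c assume c: "c \<in> exponents n"
  let ?c = "a + scale q c"
  let ?h = "f [^]\<^bsub>P\<^esub> q"
  have fP: "f \<in> carrier P" and gP: "g \<in> carrier P" and hP: "?h \<in> carrier P" using f g by auto
  note cE = shift_exponents[OF c]
  have fin: "finite {d. d \<le> ?c}" "finite {d. d \<le> c}"
    using cE c by (auto intro: finite_exponents_le)
  have dE: "d \<in> exponents n" "scale q d \<in> exponents n" if "d \<le> c" for d
    using exponents_le[OF that c] scale_exponents by auto
  have sub: "scale q d \<le> ?c" "?c - scale q d = a + scale q (c - d)" if "d \<le> c" for d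
    using that by (auto simp: le_fun_def fun_eq_iff trans_le_add2 diff_mult_distrib2)
  have zero: "?h d \<otimes> g (?c - d) = \<zero>" if d: "d \<in> {d. d \<le> ?c} - scale q ` {d. d \<le> c}" for d
  proof -
    have dE: "d \<in> exponents n" using d exponents_le[OF _ cE] by blast
    have "d \<notin> scale q ` exponents n"
    proof
      assume "d \<in> scale q ` exponents n"
      then obtain d' where d': "d = scale q d'" by blast
      have "d' i \<le> c i" for i
      proof -
        have "q * d' i \<le> a i + q * c i" using d d' by (auto simp: le_fun_def)
        also have "\<dots> < q * (c i + 1)" using residuesD(2)[OF a, of i] by simp
        finally have "d' i < c i + 1" by (simp only: mult_less_cancel1)
        then show ?thesis by simp
      qed
      then have "d' \<le> c" by (simp add: le_fun_def)
      then show False using d d' by blast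
    qed
    then have "?h d = \<zero>" using coeff_frobenius(2)[OF p char q fP dE] by blast
    then show ?thesis using gP exponents_diff[OF cE, of d] by simp
  qed
  have closed: "f d \<in> carrier K" "g (a + scale q (c - d)) \<in> carrier K" if "d \<le> c" for d
    using fP gP dE[OF that] shift_exponents[OF exponents_diff[OF c, of d]] by auto
  have "(?h \<otimes>\<^bsub>P\<^esub> g) ?c = (\<Oplus>d\<in>scale q ` {d. d \<le> c}. ?h d \<otimes> g (?c - d))"
    unfolding coeff_mult[OF cE]
  proof (rule finsum_mono_neutral[OF fin(1)])
    show "scale q ` {d. d \<le> c} \<subseteq> {d. d \<le> ?c}" using sub(1) by auto
    then show "(\<lambda>d. ?h d \<otimes> g (?c - d)) \<in> scale q ` {d. d \<le> c} \<rightarrow> carrier K"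
      using mult_term_closed[OF hP gP cE] by blast
  qed (rule zero)
  also have "\<dots> = (\<Oplus>d\<in>{d. d \<le> c}. ?h (scale q d) \<otimes> g (?c - scale q d))"
    using q0 hP gP cE dE
    by (intro add.finprod_reindex) (auto simp: inj_on_def scale_inj exponents_diff)
  also have "\<dots> = (\<Oplus>d\<in>{d. d \<le> c}. f d [^] q \<otimes> g (a + scale q (c - d)))"
    using dE sub closed coeff_frobenius(1)[OF p char q fP] by (intro finsum_cong') auto
  finally have "\<kappa> ((?h \<otimes>\<^bsub>P\<^esub> g) ?c) b = (\<Oplus>d\<in>{d. d \<le> c}. \<kappa> (f d [^] q \<otimes> g (a + scale q (c - d))) b)"
    using closed by (simp add: coords_finsum[OF basis p char q fin(2) _ b])
  also have "\<dots> = (\<Oplus>d\<in>{d. d \<le> c}. f d \<otimes> component b a g (c - d))"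
    using closed coords_closed[OF basis _ b] exponents_diff[OF c]
    by (intro finsum_cong') (auto simp: coords_smult[OF basis _ _ b] component_coeff)
  finally show "component b a (f [^]\<^bsub>S\<^esub> q \<otimes>\<^bsub>S\<^esub> g) c = (f \<otimes>\<^bsub>S\<^esub> component b a g) c"
    by (simp add: component_coeff c S_simps coeff_mult[OF c])
qed (use f g component_closed in \<open>auto\<close>)

lemma component_supported:
  assumes "f \<in> supported D"
  shows "component b a f \<in> supported (residual a)"
proof -
  have f: "f \<in> carrier S" "supp f \<subseteq> D" using assms unfolding supported_def by simp_all
  have "c \<in> residual a" if c: "c \<in> supp (component b a f)" for c
  proof (rule ccontr)
    have cE: "c \<in> exponents n" using c by (simp add: supp_def)
    assume "c \<notin> residual a"
    then have "a + scale q c \<notin> supp f" using f(2) cE by (auto simp: residual_def)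
    then have "f (a + scale q c) = \<zero>" using shift_exponents[OF cE] by (simp add: supp_def)
    then have "component b a f c = \<zero>" using cE \<kappa>_zero[OF b] by (simp add: component_coeff)
    then show False using c by (simp add: supp_def)
  qed
  then show ?thesis using component_closed[OF f(1)] unfolding supported_def by blast
qed

end

lemma exponent_split:
  assumes "c \<in> exponents n"
  shows "(\<lambda>i. c i mod q) \<in> residues n q" "(\<lambda>i. c i div q) \<in> exponents n"
    "(\<lambda>i. c i mod q) + scale q (\<lambda>i. c i div q) = c"
  using assms q0 by (auto simp: residues_def exponents_def fun_eq_iff)

lemma supported_of_components:
  assumes f: "f \<in> carrier S"
    and comp: "\<And>b a. b \<in> B \<Longrightarrow> a \<in> residues n q \<Longrightarrow> component b a f \<in> supported (residual a)"
  shows "f \<in> supported D"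
proof -
  have "c \<in> D" if c: "c \<in> exponents n" "f c \<noteq> \<zero>" for c
  proof (rule ccontr)
    assume "c \<notin> D"
    let ?a = "\<lambda>i. c i mod q" and ?d = "\<lambda>i. c i div q"
    note split = exponent_split[OF c(1)]
    have fc: "f c \<in> carrier K" using f c(1) by simp
    have zero: "\<kappa> (f c) b = \<zero>" if b: "b \<in> B" for b
    proof -
      have "?d \<notin> residual ?a" using \<open>c \<notin> D\<close> split by (simp add: residual_def)
      moreover have "supp (component b ?a f) \<subseteq> residual ?a"
        using comp[OF b split(1)] unfolding supported_def by simp
      ultimately have "?d \<notin> supp (component b ?a f)" by blast
      then have "component b ?a f ?d = \<zero>" using split(2) by (simp add: supp_def)
      then show ?thesis using component_coeff[OF b split(1,2), of f] split(3) by simp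
    qed
    have "f c = frobenius_comb q B \<beta> (\<kappa> (f c))" using comb_coords[OF basis fc] by simp
    also have "\<dots> = \<zero>"
      unfolding frobenius_comb_def
      using zero basisD(2)[OF basis] q0
      by (intro add.finprod_one_eqI) (auto simp: Pi_def nat_pow_zero)
    finally show False using c(2) by simp
  qed
  then show ?thesis using f unfolding supported_def supp_def by blast
qed

text \<open>
  The map \<open>\<Psi>\<close> sends a class to its truncated coordinates. It is well defined and injective because a
  series lies in \<open>I\<close> exactly when each of its coordinates lies in the corresponding \<open>J\<^sub>a\<close>, and
  surjective because coordinates can be prescribed: the coefficient at an exponent \<open>c\<close> is assembled
  from the coordinates with index \<open>c mod q\<close>, at \<open>c div q\<close>.
\<close>

theorem frobenius_decomposition:
  "module_isomorphic R (frobenius_pushforward p e R (regular_module R))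
    (direct_sum_module (B \<times> residues n q) (\<lambda>j. truncated_module (residual (snd j))))"
  (is "module_isomorphic R ?M ?N")
proof -
  let ?J = "B \<times> residues n q"
  define \<Psi> where "\<Psi> x = (\<lambda>(b, a)\<in>?J. mask (- residual a) (component b a (rep x)))" for x
  have N: "carrier ?N = (\<Pi>\<^sub>E j\<in>?J. {f \<in> carrier S. supp f \<inter> residual (snd j) = {}})"
    by (simp add: direct_sum_module_def truncated_module_def)
  have M: "carrier ?M = carrier R" "x \<oplus>\<^bsub>?M\<^esub> y = x \<oplus>\<^bsub>R\<^esub> y" "r \<odot>\<^bsub>?M\<^esub> x = r [^]\<^bsub>R\<^esub> q \<otimes>\<^bsub>R\<^esub> x" for x y r
    by (simp_all add: frobenius_pushforward_def regular_module_def q)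
  have \<Psi>: "\<Psi> (I +>\<^bsub>S\<^esub> f) = (\<lambda>(b, a)\<in>?J. mask (- residual a) (component b a f))" if f: "f \<in> carrier S" for f
  proof -
    have "mask (- residual a) (component b a (rep (I +>\<^bsub>S\<^esub> f))) = mask (- residual a) (component b a f)"
      if ba: "b \<in> B" "a \<in> residues n q" for b a
      using component_supported[OF ba rep(2)[OF f]] component_closed[OF ba] rep(1)[OF f] f
      by (simp add: mask_eq_iff component_diff[OF ba])
    then show ?thesis unfolding \<Psi>_def by (auto simp: fun_eq_iff)
  qed
  have up: "upset (residual a)" "D \<subseteq> residual a" if "a \<in> residues n q" for a
    using upset_residual D_subset_residual residuesD(1)[OF that] by auto
  have \<Psi>_mem: "\<Psi> x \<in> carrier ?N" if x: "x \<in> carrier R" for x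
  proof -
    obtain f where f: "f \<in> carrier S" "x = I +>\<^bsub>S\<^esub> f" using coset_of[OF x] by blast
    show ?thesis
      unfolding N f(2) \<Psi>[OF f(1)] restrict_PiE_iff
      using component_closed f(1) by (auto simp: mask_closed supp_mask)
  qed
  have "\<Psi> \<in> module_hom R ?M ?N"
    unfolding module_hom_def
  proof (intro CollectI conjI allI impI)
    show "\<Psi> \<in> carrier ?M \<rightarrow> carrier ?N" using \<Psi>_mem by (simp add: M)
  next
    fix x y assume "x \<in> carrier ?M \<and> y \<in> carrier ?M"
    then obtain f g where f: "f \<in> carrier S" "x = I +>\<^bsub>S\<^esub> f" and g: "g \<in> carrier S" "y = I +>\<^bsub>S\<^esub> g"
      using coset_of M(1) by metis
    have sum: "x \<oplus>\<^bsub>?M\<^esub> y = I +>\<^bsub>S\<^esub> (f \<oplus>\<^bsub>S\<^esub> g)" using f g by (simp add: M)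
    show "\<Psi> (x \<oplus>\<^bsub>?M\<^esub> y) = \<Psi> x \<oplus>\<^bsub>?N\<^esub> \<Psi> y"
      unfolding sum unfolding f(2) g(2)
      using f(1) g(1) component_closed
      by (auto simp: \<Psi> direct_sum_module_def truncated_module_def fun_eq_iff component_add mask_add_S
          simp del: Q.hom_add)
  next
    fix r x assume "r \<in> carrier R \<and> x \<in> carrier ?M"
    then obtain f g where f: "f \<in> carrier S" "r = I +>\<^bsub>S\<^esub> f" and g: "g \<in> carrier S" "x = I +>\<^bsub>S\<^esub> g"
      using coset_of M(1) by metis
    have prod: "r \<odot>\<^bsub>?M\<^esub> x = I +>\<^bsub>S\<^esub> (f [^]\<^bsub>S\<^esub> q \<otimes>\<^bsub>S\<^esub> g)"
      using f g by (simp add: M hom_pow)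
    show "\<Psi> (r \<odot>\<^bsub>?M\<^esub> x) = r \<odot>\<^bsub>?N\<^esub> \<Psi> x"
    proof
      fix j
      show "\<Psi> (r \<odot>\<^bsub>?M\<^esub> x) j = (r \<odot>\<^bsub>?N\<^esub> \<Psi> x) j"
      proof (cases "j \<in> ?J")
        case True
        then obtain b a where j: "j = (b, a)" and ba: "b \<in> B" "a \<in> residues n q" by auto
        have "\<Psi> (r \<odot>\<^bsub>?M\<^esub> x) j = mask (- residual a) (f \<otimes>\<^bsub>S\<^esub> component b a g)"
          unfolding prod using f(1) g(1) ba by (simp add: \<Psi> j component_mult del: Q.hom_mult)
        also have "\<dots> = mask (- residual a) (f \<otimes>\<^bsub>S\<^esub> mask (- residual a) (component b a g))"
          using f(1) g(1) by (simp add: mask_mult_mask[OF up(1)[OF ba(2)]] component_closed[OF ba])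
        also have "\<dots> = r \<odot>\<^bsub>truncated_module (residual a)\<^esub> \<Psi> x j"
          unfolding f(2) g(2) using f(1) g(1) ba
          by (simp add: truncated_smult[OF up[OF ba(2)]] mask_closed component_closed[OF ba] \<Psi> j)
        also have "\<dots> = (r \<odot>\<^bsub>?N\<^esub> \<Psi> x) j" using True by (simp add: direct_sum_module_def j)
        finally show ?thesis .
      next
        case False
        then show ?thesis by (simp add: \<Psi>_def direct_sum_module_def)
      qed
    qed
  qed
  moreover have "inj_on \<Psi> (carrier R)"
  proof (rule inj_onI)
    fix x y assume x: "x \<in> carrier R" and y: "y \<in> carrier R" and eq: "\<Psi> x = \<Psi> y"
    obtain f g where f: "f \<in> carrier S" "x = I +>\<^bsub>S\<^esub> f" and g: "g \<in> carrier S" "y = I +>\<^bsub>S\<^esub> g"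
      using coset_of x y by metis
    have "f \<ominus>\<^bsub>S\<^esub> g \<in> I"
    proof (rule supported_of_components)
      fix b a assume ba: "b \<in> B" "a \<in> residues n q"
      have "mask (- residual a) (component b a f) = mask (- residual a) (component b a g)"
        using fun_cong[OF eq, of "(b, a)"] ba f g by (simp add: \<Psi>)
      then show "component b a (f \<ominus>\<^bsub>S\<^esub> g) \<in> supported (residual a)"
        using f(1) g(1) component_closed[OF ba] by (simp add: mask_eq_iff component_diff[OF ba])
    qed (use f g in simp)
    then show "x = y" using f g coset_eq_iff by blast
  qed
  moreover have "carrier ?N \<subseteq> \<Psi> ` carrier R"
  proof
    fix h assume h: "h \<in> carrier ?N"
    have hS: "h (b, a) \<in> carrier S" "supp (h (b, a)) \<inter> residual a = {}"
      if "b \<in> B" "a \<in> residues n q" for b a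
      using PiE_mem[OF h[unfolded N], of "(b, a)"] that by auto
    let ?a = "\<lambda>c i. c i mod q" and ?d = "\<lambda>c i. c i div q"
    let ?k = "\<lambda>c b. h (b, ?a c) (?d c)"
    define f where "f = (\<lambda>c\<in>exponents n. frobenius_comb q B \<beta> (?k c))"
    have k: "?k c \<in> B \<rightarrow> carrier K" if "c \<in> exponents n" for c
      using hS exponent_split[OF that] by auto
    have f: "f \<in> carrier S"
    proof (rule S_closed_of_supp)
      show "f \<in> carrier P"
        unfolding f_def using k basisD(2)[OF basis] by (intro restrict_closed frobenius_comb_closed)
      show "supp f \<subseteq> (\<Union>j\<in>?J. (\<lambda>d. snd j + scale q d) ` supp (h j))"
      proof
        fix c assume c: "c \<in> supp f"
        then have cE: "c \<in> exponents n" and nz: "frobenius_comb q B \<beta> (?k c) \<noteq> \<zero>"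
          by (auto simp: supp_def f_def)
        have "\<exists>b\<in>B. ?k c b \<noteq> \<zero>"
        proof (rule ccontr)
          assume "\<not> (\<exists>b\<in>B. ?k c b \<noteq> \<zero>)"
          then have "frobenius_comb q B \<beta> (?k c) = \<zero>"
            unfolding frobenius_comb_def using basisD(2)[OF basis] q0
            by (intro add.finprod_one_eqI) (auto simp: Pi_def nat_pow_zero)
          then show False using nz by simp
        qed
        then obtain b where "b \<in> B" "?d c \<in> supp (h (b, ?a c))"
          using exponent_split(2)[OF cE] by (auto simp: supp_def)
        then show "c \<in> (\<Union>j\<in>?J. (\<lambda>d. snd j + scale q d) ` supp (h j))"
          using exponent_split(1,3)[OF cE] by (intro UN_I[of "(b, ?a c)"] image_eqI[of _ _ "?d c"]) auto
      qed
      show "(\<Union>j\<in>?J. (\<lambda>d. snd j + scale q d) ` supp (h j)) \<in> \<F>"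
        using basisD(1)[OF basis] finite_residues hS(1)
        by (intro allowed_UN allowed_image) (auto simp: carrier_S)
    qed
    have comp: "component b a f = h (b, a)" if ba: "b \<in> B" "a \<in> residues n q" for b a
    proof (rule S_eqI)
      fix c assume c: "c \<in> exponents n"
      let ?c = "a + scale q c"
      have cE: "?c \<in> exponents n" by (rule shift_exponents[OF ba c])
      have "?a ?c = a" "?d ?c = c"
        using residuesD(2)[OF ba(2)] q0 by (simp_all add: fun_eq_iff)
      moreover have "\<kappa> (frobenius_comb q B \<beta> (?k ?c)) b = ?k ?c b"
        by (rule coords_unique[OF basis k[OF cE] refl ba(1)])
      ultimately show "component b a f c = h (b, a) c"
        using cE c by (simp add: component_coeff[OF ba] f_def)
    qed (use component_closed[OF ba f] hS[OF ba] in auto)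
    have "\<Psi> (I +>\<^bsub>S\<^esub> f) = h"
    proof
      fix j show "\<Psi> (I +>\<^bsub>S\<^esub> f) j = h j"
      proof (cases "j \<in> ?J")
        case True
        then show ?thesis using hS comp mask_fixed by (auto simp: \<Psi>[OF f])
      next
        case False
        then show ?thesis using PiE_arb[OF h[unfolded N]] by (auto simp: \<Psi>[OF f])
      qed
    qed
    then show "h \<in> \<Psi> ` carrier R" using f by (intro image_eqI[of _ _ "I +>\<^bsub>S\<^esub> f"]) auto
  qed
  ultimately show ?thesis
    using \<Psi>_mem unfolding module_isomorphic_def bij_betw_def M(1) by blast
qed

text \<open>
  Lowering \<open>c\<close> to \<open>min(c, r)\<close> keeps \<open>a + q c\<close> above \<open>r\<close>. Thus the generators of \<open>J\<^sub>a\<close> can be chosen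
  below the generators of \<open>I\<close>, independently of \<open>q\<close> and \<open>a\<close>.
\<close>

lemma residual_generated:
  assumes D: "D = up G" and G: "G \<subseteq> exponents n" and a: "a \<in> exponents n"
  shows "residual a = up (residual a \<inter> {c. \<exists>r\<in>G. c \<le> r})"
proof
  show "up (residual a \<inter> {c. \<exists>r\<in>G. c \<le> r}) \<subseteq> residual a"
    using upset_residual[OF a] by (auto simp: up_def upset_def)
  show "residual a \<subseteq> up (residual a \<inter> {c. \<exists>r\<in>G. c \<le> r})"
  proof
    fix c assume c: "c \<in> residual a"
    then have "a + scale q c \<in> D" and cE: "c \<in> exponents n"
      by (auto simp: residual_def)
    then obtain r where r: "r \<in> G" "r \<le> a + scale q c"
      unfolding D up_def by blast
    define d where "d = (\<lambda>i. min (c i) (r i))"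
    have d: "d \<le> c" "d \<le> r" by (auto simp: d_def le_fun_def)
    have dE: "d \<in> exponents n" using exponents_le[OF d(1) cE] .
    have "r i \<le> a i + q * d i" for i
    proof (cases "c i \<le> r i")
      case True
      then show ?thesis using r(2) by (simp add: d_def le_fun_def min_absorb1)
    next
      case False
      have "r i \<le> q * r i" using q0 by simp
      then show ?thesis using False by (simp add: d_def min_absorb2 trans_le_add2)
    qed
    then have "r \<le> a + scale q d" by (simp add: le_fun_def)
    moreover have "a + scale q d \<in> exponents n" using a dE by (intro exponents_add scale_exponents)
    ultimately have "a + scale q d \<in> D" using r(1) unfolding D up_def by blast
    then have "d \<in> residual a" using dE by (simp add: residual_def)
    then show "c \<in> up (residual a \<inter> {c. \<exists>r\<in>G. c \<le> r})"
      using d r(1) cE by (auto simp: up_def)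
  qed
qed

end

text \<open>
  The finite family consists of the quotients by all monomial ideals that contain \<open>I\<close> and are
  generated in exponents below some element of \<open>G\<close>.
\<close>

theorem FFRT_monomial_quotient:
  assumes p: "Factorial_Ring.prime (p :: nat)" and char: "[p] \<cdot>\<^bsub>K\<^esub> \<one> = \<zero>"
    and dim: "finite_dimension ((\<lambda>x. x [^] p) ` carrier K) (carrier K)"
    and D: "D = up G" and G: "finite G" "G \<subseteq> exponents n"
  shows "FFRT p R"
proof -
  have "\<exists>B \<beta>. frobenius_basis (p ^ e) (B :: nat set) \<beta>" for e
    by (rule frobenius_basis_exists[OF p char dim])
  then obtain B :: "nat \<Rightarrow> nat set" and \<beta> where basis: "\<And>e. frobenius_basis (p ^ e) (B e) (\<beta> e)"
    by metis
  define E where "E = {c. \<exists>r\<in>G. c \<le> r}"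
  define C where "C = {U \<in> up ` Pow E. upset U \<and> D \<subseteq> U}"
  have "E = (\<Union>r\<in>G. {c. c \<le> r})" by (auto simp: E_def)
  then have "finite E" using G finite_exponents_le[of _ n] by auto
  then have C: "finite C" by (simp add: C_def)
  show ?thesis
  proof (rule FFRT_criterion[OF cring_R noetherian_R p char_R[OF char] C])
    show "finitely_generated_module R (truncated_module U)" if "U \<in> C" for U
      using that by (intro truncated_finitely_generated) (auto simp: C_def)
    show "finite (B e \<times> residues n (p ^ e))" for e
      using basisD(1)[OF basis] finite_residues by blast
    show "residual (p ^ e) (snd j) \<in> C" if j: "j \<in> B e \<times> residues n (p ^ e)" for e j
    proof -
      have a: "snd j \<in> exponents n" using j by (auto simp: residues_def)
      have "residual (p ^ e) (snd j) \<in> up ` Pow E"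
        unfolding E_def
        by (subst residual_generated[OF p char refl basis D G(2) a]) blast
      then show ?thesis
        using upset_residual[OF p char refl basis a] D_subset_residual[OF p char refl basis a]
        by (simp add: C_def)
    qed
    show "module_isomorphic R (frobenius_pushforward p e R (regular_module R))
        (direct_sum_module (B e \<times> residues n (p ^ e)) (\<lambda>j. truncated_module (residual (p ^ e) (snd j))))"
      if "e > 0" for e
      by (rule frobenius_decomposition[OF p char refl basis])
  qed
qed

end

theorem theorem5p27:
  fixes K :: "('a, 'b) ring_scheme"
    and S :: "((nat \<Rightarrow> nat) \<Rightarrow> 'a) ring"
    and f :: "nat \<Rightarrow> (nat \<Rightarrow> nat) \<Rightarrow> 'a"
    and p n t :: nat
  assumes "field K"
    and "Factorial_Ring.prime p" and "ring_char K = p"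
    and "ring.finite_dimension K ((\<lambda>x. x [^]\<^bsub>K\<^esub> p) ` carrier K) (carrier K)"
    and "S = mpoly_ring K n \<or> S = mpowser_ring K n"
    and "\<forall>i\<in>{1..t}. f i \<in> monomials K n"
    and "I = Idl\<^bsub>S\<^esub> (f ` {1..t})"
    and "R = S Quot I"
  shows "FFRT p R"
proof -
  interpret K: field K by (rule assms(1))
  interpret coefficient_ring K n by unfold_locales
  define \<F> :: "(nat \<Rightarrow> nat) set set" where "\<F> = (if S = mpowser_ring K n then UNIV else {A. finite A})"
  have "S = (mpowser_ring K n)\<lparr>carrier := {f \<in> carrier (mpowser_ring K n). supp f \<in> \<F>}\<rparr>"
  proof (cases "S = mpowser_ring K n")
    case True
    then show ?thesis by (simp add: \<F>_def)
  next
    case False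
    then have "S = mpoly_ring K n" using assms(5) by blast
    then show ?thesis using False by (simp add: \<F>_def mpoly_ring_def supp_def carrier_P)
  qed
  then interpret field_series_ring K n S \<F>
    by unfold_locales (auto simp: \<F>_def)
  have char: "[p] \<cdot>\<^bsub>K\<^esub> \<one>\<^bsub>K\<^esub> = \<zero>\<^bsub>K\<^esub>"
    unfolding assms(3)[symmetric] ring_char_def by (rule K.add.pow_ord_eq_1) simp
  have "\<forall>i\<in>{1..t}. \<exists>r\<in>exponents n. f i = monomial K n r"
    using assms(6) by (auto simp: monomials_def)
  then obtain r where r: "\<And>i. i \<in> {1..t} \<Longrightarrow> r i \<in> exponents n \<and> f i = monomial K n (r i)"
    by metis
  let ?G = "r ` {1..t}"
  have G: "finite ?G" "?G \<subseteq> exponents n" using r by auto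
  have "f ` {1..t} = monomial K n ` ?G" using r by (auto simp: image_image)
  then have I: "I = supported (up ?G)"
    using genideal_monomials[OF G] assms(7) by simp
  interpret monomial_quotient K n S \<F> "up ?G"
    by unfold_locales (rule upset_up)
  show ?thesis
    using FFRT_monomial_quotient[OF assms(2) char assms(4) refl G] I assms(8) by simp
qed

end
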